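(* Let $I$ be a finite set with a partition $I=I_0\cup J_0\cup K_0\cup I_1\cup J_1$ (each part may be empty) such that $I_0\cup J_0$ is not empty. An SDSE (with all $F_i$ non-constant) defined in the following way is Hopf: 1. For all $i\in I_0$ there exists $\beta_i\in K$ such that $$F_i=f_{\beta_i}(h_i)\prod_{j\in I_0-\{i\}}f_{\frac{\beta_j}{1+\beta_j}}((1+\beta_j)h_j)\prod_{j\in J_0}f_1(h_j).$$ 2. For all $i\in J_0$: $$F_i=\prod_{j\in I_0}f_{\frac{\beta_j}{1+\beta_j}}((1+\beta_j)h_j)\prod_{j\in J_0-\{i\}}f_1(h_j).$$ 3. For all $i\in K_0$: $$F_i=\prod_{j\in I_0}f_{\frac{\beta_j}{1+\beta_j}}((1+\beta_j)h_j)\prod_{j\in J_0}f_1(h_j).$$ 4. For all $i\in I_1$ there exist $\nu_i\in K$ and scalars $(a^{(i)}_j)_{j\in I_0\cup J_0\cup K_0}$ such that ($\nu_i\neq1$) or ($\exists j\in I_0$, $a^{(i)}_j\ne1+\beta_j$) or ($\exists j\in J_0$, $a^{(i)}_j\ne1$) or ($\exists j\in K_0$, $a^{(i)}_j\neq0$), and, if $\nu_i\ne0$: $$F_i=\frac1{\nu_i}\prod_{j\in I_0}f_{\frac{\beta_j}{\nu_ia^{(i)}_j}}(\nu_ia^{(i)}_jh_j)\prod_{j\in J_0}f_{\frac1{\nu_ia^{(i)}_j}}(\nu_ia^{(i)}_jh_j)\prod_{j\in K_0}f_0(\nu_ia^{(i)}_jh_j)+1-\frac1{\nu_i},$$ while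 if $\nu_i=0$: $$F_i=-\sum_{j\in I_0}\frac{a^{(i)}_j}{\beta_j}\ln(1-\beta_jh_j)-\sum_{j\in J_0}a^{(i)}_j\ln(1-h_j)+\sum_{j\in K_0}a^{(i)}_jh_j+1.$$ 5. For all $i\in J_1$ there exist $\nu_i\in K-\{0\}$ and scalars $(a^{(i)}_j)_{j\in I_0\cup J_0\cup K_0\cup I_1}$ such that: $I_1^{(i)}=\{j\in I_1:a^{(i)}_j\neq0\}$ is not empty; $\nu_j=1$ for all $j\in I_1^{(i)}$; $F_j=F_k$ for all $j,k\in I_1^{(i)}$. Putting $b^{(i)}_t=a^{(j)}_t$ for any $j\in I_1^{(i)}$ and all $t\in I_0\cup J_0\cup K_0$: $$F_i=\frac1{\nu_i}\prod_{j\in I_0}f_{\frac{\beta_j}{b^{(i)}_j-1-\beta_j}}\big((b^{(i)}_j-1-\beta_j)h_j\big)\prod_{j\in J_0}f_{\frac1{b^{(i)}_j-1}}\big((b^{(i)}_j-1)h_j\big)\prod_{j\in K_0}f_0(b^{(i)}_jh_j)+\sum_{j\in I_1^{(i)}}a^{(i)}_jh_j+1-\frac1{\nu_i}.$$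
   Context: $K$ is a field of characteristic zero and $I$ a finite non-empty set. $\mathcal{H}_I$ is the (Connes-Kreimer) polynomial algebra generated by the set of (isomorphism classes of non-planar) rooted trees whose vertices are decorated by elements of $I$; monomials are forests; it is graded by the number of vertices, and $\widehat{\mathcal H_I}=\prod_n\mathcal H_I(n)$ is its completion. The coproduct is the algebra morphism with $\Delta(t)=t\otimes1+1\otimes t+\sum_cP^c(t)\otimes R^c(t)$ for each tree $t$, where $c$ runs over non-empty sets of edges of $t$ such that every path from the root to a leaf meets at most one edge of $c$; after deleting the edges of $c$, $R^c(t)$ is the component containing the root and $P^c(t)$ is the product of the other components. This makes $\mathcal H_I$ a Hopf algebra. $B_i^+$ is the linear (continuous) operator sending a forest to the tree obtained by grafting its trees on a common root decorated by $i$. The SDSE $(S)$ associated to non-constant series $(F_i)_{i\in I}$, $F_i\in K[[h_j,j\in I]]$, is the system $X_i=B_i^+(F_i(X_j,j\in I))$, $i\in I$; it has a unique solution $(X_i)_{i\in I}\in\widehat{\mathcal H_I}^{\,I}$. $X_i(n)$ is the homogeneous component of degree $n$ of $X_i$, and $\mathcal H_{(S)}$ is the subalgebra of $\mathcal H_I$ generated by all the $X_i(n)$. $(S)$ is Hopf if $\mathcal H_{(S)}$ is a Hopf subalgebra of $\mathcal H_I$. For $\beta\in K$, $f_\beta(h)=\sum_{k\ge0}\frac{(1+\beta)(1+2\beta)\cdots(1+(k-1)\beta)}{k!}h^k$, i.e. $(1-\beta h)^{-1/\beta}$ if $\beta\ne0$ and $e^h$ if $\beta=0$. Convention: $f_{\beta/\lambda}(\lambda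 h)$ means $\sum_{k\ge0}\frac{\lambda(\lambda+\beta)\cdots(\lambda+(k-1)\beta)}{k!}h^k$, which is also defined for $\lambda=0$ and then equals $1$. Likewise $-\frac{a}{\beta}\ln(1-\beta h)$ means $ah$ if $\beta=0$. *)

theory Defs
  imports
    Complex_Main
    "HOL-Library.Multiset"
    "HOL-Library.Sublist"
    "HOL-Library.Product_Plus"
    "HOL-Library.Poly_Mapping"
    "HOL-Library.Groups_Big_Fun"
    "HOL-Computational_Algebra.Formal_Power_Series"
begin

section \<open>Formal power series in several commuting variables\<close>

text \<open>
  A series in the variables \<open>'v\<close> is a coefficient function on monomials, and a monomial is a
  finite multiset of variables. For a finite type \<open>'i\<close>, the type \<open>('i, 'k) mps\<close> is the ring
  \<open>K[[h_j, j \<in> I]]\<close>. With trees as variables, \<open>('i rtree, 'k) mps\<close> is the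
  completion of the polynomial algebra on trees: it consists of all families of coefficients
  indexed by forests, which is the product of the homogeneous components because there are only
  finitely many forests with a given number of vertices (lemma \<open>finite_forest_weight\<close>).
\<close>

typedef ('v, 'a) mps = "UNIV :: ('v multiset \<Rightarrow> 'a) set"
  morphisms mcoeff Abs_mps ..

lemma mcoeff_Abs_mps [simp]: "mcoeff (Abs_mps f) = f"
  by (simp add: Abs_mps_inverse)

lemma mps_eqI: "(\<And>m. mcoeff F m = mcoeff G m) \<Longrightarrow> F = G"
  by (metis ext mcoeff_inject)

lemma finite_submsets: "finite {u. u \<subseteq># (m :: 'v multiset)}"
proof -
  have "{u. u \<subseteq># m} \<subseteq> mset ` {xs. set xs \<subseteq> set_mset m \<and> length xs \<le> size m}"
  proof
    fix u assume "u \<in> {u. u \<subseteq># m}"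
    then have u: "u \<subseteq># m" by simp
    obtain xs where xs: "u = mset xs" by (metis ex_mset)
    have "set xs \<subseteq> set_mset m" using u xs mset_subset_eqD by fastforce
    moreover have "length xs \<le> size m" using size_mset_mono[OF u] xs by simp
    ultimately show "u \<in> mset ` {xs. set xs \<subseteq> set_mset m \<and> length xs \<le> size m}"
      using xs by blast
  qed
  then show ?thesis
    by (rule finite_subset) (simp add: finite_lists_length_le)
qed

instantiation mps :: (type, comm_ring_1) comm_ring_1
begin

definition "0 = Abs_mps (\<lambda>_. 0)"
definition "1 = Abs_mps (\<lambda>m. if m = {#} then 1 else 0)"
definition "F + G = Abs_mps (\<lambda>m. mcoeff F m + mcoeff G m)"
definition "- F = Abs_mps (\<lambda>m. - mcoeff F m)"
definition "F - G = Abs_mps (\<lambda>m. mcoeff F m - mcoeff G m)"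
definition "F * G = Abs_mps (\<lambda>m. \<Sum>u | u \<subseteq># m. mcoeff F u * mcoeff G (m - u))"

instance
proof
  fix F G H :: "('a, 'b) mps"
  show "F * G * H = F * (G * H)"
  proof (rule mps_eqI)
    fix m :: "'a multiset"
    let ?f = "mcoeff F" and ?g = "mcoeff G" and ?h = "mcoeff H"
    have "mcoeff (F * G * H) m =
        (\<Sum>u | u \<subseteq># m. \<Sum>v | v \<subseteq># u. ?f v * ?g (u - v) * ?h (m - u))"
      by (simp add: times_mps_def sum_distrib_right)
    also have "\<dots> = (\<Sum>(u, v) \<in> Sigma {u. u \<subseteq># m} (\<lambda>u. {v. v \<subseteq># u}).
        ?f v * ?g (u - v) * ?h (m - u))"
      by (rule sum.Sigma) (auto simp: finite_submsets)
    also have "\<dots> = (\<Sum>(v, x) \<in> Sigma {v. v \<subseteq># m} (\<lambda>v. {x. x \<subseteq># m - v}).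
        ?f v * ?g x * ?h (m - v - x))"
    proof (rule sum.reindex_bij_witness[where i = "\<lambda>(v, x). (v + x, v)"
          and j = "\<lambda>(u, v). (v, u - v)"], goal_cases)
      case (1 a)
      then show ?case by auto
    next
      case (2 a)
      then show ?case
        by (auto simp: subseteq_mset_def intro!: diff_le_mono intro: order_trans)
    next
      case (3 b)
      then show ?case by auto
    next
      case (4 b)
      then show ?case
        by (auto simp: subset_mset.le_diff_conv2 add.commute)
    next
      case (5 a)
      obtain u v where a: "a = (u, v)" by (cases a)
      with 5 have "m - v - (u - v) = m - u"
        by (metis (no_types, lifting) SigmaE2 diff_diff_add_mset mem_Collect_eq
            subset_mset.add_diff_inverse)
      then show ?case using a by simp
    qed
    also have "\<dots> = (\<Sum>v | v \<subseteq># m. \<Sum>x | x \<subseteq># m - v. ?f v * ?g x * ?h (m - v - x))"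
      by (rule sum.Sigma[symmetric]) (auto simp: finite_submsets)
    also have "\<dots> = mcoeff (F * (G * H)) m"
      by (simp add: times_mps_def sum_distrib_left mult.assoc)
    finally show "mcoeff (F * G * H) m = mcoeff (F * (G * H)) m" .
  qed
  show "F * G = G * F"
  proof (rule mps_eqI)
    fix m :: "'a multiset"
    have "(\<Sum>u | u \<subseteq># m. mcoeff F u * mcoeff G (m - u)) =
        (\<Sum>u | u \<subseteq># m. mcoeff G u * mcoeff F (m - u))"
      by (rule sum.reindex_bij_witness[where i = "\<lambda>u. m - u" and j = "\<lambda>u. m - u"])
        (auto simp: mult.commute subset_mset.diff_diff_right)
    then show "mcoeff (F * G) m = mcoeff (G * F) m"
      by (simp add: times_mps_def)
  qed
  show "1 * F = F"
  proof (rule mps_eqI)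
    fix m :: "'a multiset"
    have "(\<Sum>u | u \<subseteq># m. (if u = {#} then 1 else 0) * mcoeff F (m - u)) =
        (\<Sum>u \<in> {{#}}. (if u = {#} then 1 else 0) * mcoeff F (m - u))"
      by (rule sum.mono_neutral_right) (auto simp: finite_submsets)
    then show "mcoeff (1 * F) m = mcoeff F m"
      by (simp add: times_mps_def one_mps_def)
  qed
  show "(F + G) * H = F * H + G * H"
    by (rule mps_eqI) (simp add: times_mps_def plus_mps_def algebra_simps sum.distrib)
  show "(0 :: ('a, 'b) mps) \<noteq> 1"
  proof
    assume "(0 :: ('a, 'b) mps) = 1"
    then have "mcoeff (0 :: ('a, 'b) mps) {#} = mcoeff 1 {#}" by simp
    then show False by (simp add: zero_mps_def one_mps_def)
  qed
qed (rule mps_eqI; simp add: plus_mps_def zero_mps_def uminus_mps_def minus_mps_def algebra_simps)+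

end

definition mps_const :: "'a \<Rightarrow> ('v, 'a :: comm_ring_1) mps" where
  "mps_const c = Abs_mps (\<lambda>m. if m = {#} then c else 0)"

definition mps_var :: "'v \<Rightarrow> ('v, 'a :: comm_ring_1) mps" where
  "mps_var j = Abs_mps (\<lambda>m. if m = {#j#} then 1 else 0)"

definition mps_of_fps :: "'v \<Rightarrow> 'a fps \<Rightarrow> ('v, 'a :: comm_ring_1) mps" where
  \<comment> \<open>\<open>g(h_j)\<close> for a series \<open>g\<close> in one variable\<close>
  "mps_of_fps j g = Abs_mps (\<lambda>m. if m = replicate_mset (size m) j then fps_nth g (size m) else 0)"

definition mps_nonconstant :: "('v, 'a :: comm_ring_1) mps \<Rightarrow> bool" where
  "mps_nonconstant F \<longleftrightarrow> (\<nexists>c. F = mps_const c)"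

definition mps_subst :: "('v, 'a) mps \<Rightarrow> ('v \<Rightarrow> ('w, 'a) mps) \<Rightarrow> ('w, 'a :: comm_ring_1) mps" where
  \<comment> \<open>\<open>F(X_j, j \<in> I)\<close>. If \<open>'v\<close> is finite and the \<open>X_j\<close> have no constant
    term, only finitely many monomials \<open>p\<close> contribute to the coefficient of \<open>m\<close>.\<close>
  "mps_subst F X = Abs_mps (\<lambda>m. Sum_any (\<lambda>p. mcoeff F p * mcoeff (\<Prod>j\<in>#p. X j) m))"


section \<open>Decorated rooted trees and forests\<close>

text \<open>Children form a multiset, so that elements of this type are isomorphism classes of
  non-planar trees.\<close>

datatype 'i rtree = Node 'i "'i rtree multiset"

type_synonym 'i forest = "'i rtree multiset"

primrec nvertices :: "'i rtree \<Rightarrow> nat" where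
  "nvertices (Node i ts) = Suc (sum_mset (image_mset nvertices ts))"

definition forest_weight :: "'i forest \<Rightarrow> nat" where
  "forest_weight w = (\<Sum>t\<in>#w. nvertices t)"

lemma size_le_forest_weight: "size w \<le> forest_weight w"
proof (induction w)
  case (add t w)
  then show ?case by (cases t) (auto simp: forest_weight_def)
qed (simp add: forest_weight_def)

lemma nvertices_le_forest_weight: "t \<in># w \<Longrightarrow> nvertices t \<le> forest_weight w"
  by (auto simp: forest_weight_def dest!: multi_member_split)

lemma finite_forests_aux:
  assumes "finite {t :: 'i rtree. nvertices t \<le> n}"
  shows "finite {w :: 'i forest. forest_weight w \<le> n}"
proof -
  have "{w :: 'i forest. forest_weight w \<le> n} \<subseteq>
      mset ` {xs. set xs \<subseteq> {t. nvertices t \<le> n} \<and> length xs \<le> n}"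
  proof
    fix w :: "'i forest" assume "w \<in> {w. forest_weight w \<le> n}"
    then have w: "forest_weight w \<le> n" by simp
    obtain xs where xs: "w = mset xs" by (metis ex_mset)
    have "set xs \<subseteq> {t. nvertices t \<le> n}"
      using nvertices_le_forest_weight[of _ w] w xs by fastforce
    moreover have "length xs \<le> n" using size_le_forest_weight[of w] w xs by simp
    ultimately show "w \<in> mset ` {xs. set xs \<subseteq> {t. nvertices t \<le> n} \<and> length xs \<le> n}"
      using xs by blast
  qed
  then show ?thesis
    by (rule finite_subset) (simp add: finite_lists_length_le assms)
qed

lemma finite_trees: "finite {t :: 'i :: finite rtree. nvertices t \<le> n}"
proof (induction n)
  case 0
  have "{t :: 'i rtree. nvertices t \<le> 0} = {}"
  proof (rule equals0I)
    fix t :: "'i rtree" assume "t \<in> {t. nvertices t \<le> 0}"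
    then show False by (cases t) simp
  qed
  then show ?case by (simp only: finite.emptyI)
next
  case (Suc n)
  have "{t :: 'i rtree. nvertices t \<le> Suc n} \<subseteq>
      (\<lambda>(i, w). Node i w) ` (UNIV \<times> {w. forest_weight w \<le> n})"
  proof
    fix t :: "'i rtree" assume t: "t \<in> {t. nvertices t \<le> Suc n}"
    obtain i w where "t = Node i w" by (cases t)
    then show "t \<in> (\<lambda>(i, w). Node i w) ` (UNIV \<times> {w. forest_weight w \<le> n})"
      using t by (auto simp: forest_weight_def)
  qed
  then show ?case
    by (rule finite_subset) (simp add: finite_forests_aux Suc)
qed

lemma finite_forest_weight: "finite {w :: 'i :: finite forest. forest_weight w = n}"
  by (rule finite_subset[OF _ finite_forests_aux[OF finite_trees[of n]]]) auto


section \<open>Edges and admissible cuts\<close>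

text \<open>
  A child of the root of \<open>Node i ts\<close> is a pair \<open>(s, k)\<close> with \<open>k < count ts s\<close>: the
  \<open>k\<close>-th copy of the subtree \<open>s\<close>. A vertex is addressed by the list of choices of children
  leading to it from the root, and an edge is identified with its lower endpoint, that is with a
  non-empty address. In this way several isomorphic subtrees of one vertex are kept apart.
\<close>

type_synonym 'i address = "('i rtree \<times> nat) list"

inductive is_vertex :: "'i rtree \<Rightarrow> 'i address \<Rightarrow> bool" where
  root: "is_vertex t []"
| child: "k < count ts s \<Longrightarrow> is_vertex s p \<Longrightarrow> is_vertex (Node i ts) ((s, k) # p)"

definition edges :: "'i rtree \<Rightarrow> 'i address set" where
  "edges t = {p. is_vertex t p \<and> p \<noteq> []}"

definition leaves :: "'i rtree \<Rightarrow> 'i address set" where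
  "leaves t = {p. is_vertex t p \<and> (\<nexists>x. is_vertex t (p @ [x]))}"

definition path_edges :: "'i address \<Rightarrow> 'i address set" where
  \<comment> \<open>the edges on the path from the root to the vertex \<open>p\<close>\<close>
  "path_edges p = {q. prefix q p \<and> q \<noteq> []}"

definition admissible_cuts :: "'i rtree \<Rightarrow> 'i address set set" where
  "admissible_cuts t =
    {c. c \<subseteq> edges t \<and> c \<noteq> {} \<and> (\<forall>l\<in>leaves t. card (c \<inter> path_edges l) \<le> 1)}"

definition subtree_at :: "'i rtree \<Rightarrow> 'i address \<Rightarrow> 'i rtree" where
  \<comment> \<open>an address ends with the full subtree below the vertex it denotes\<close>
  "subtree_at t p = (if p = [] then t else fst (last p))"

lemma mem_mset_set_child:
  assumes "x \<in># mset_set {(s, k). k < count ts s \<and> P s k}" (is "_ \<in># mset_set ?A")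
  shows "fst x \<in># ts"
proof -
  have "finite ?A" using assms by (metis empty_iff mset_set.infinite set_mset_empty)
  then have "x \<in> ?A" using assms by simp
  then show ?thesis
    by (auto simp: count_greater_zero_iff[symmetric] simp del: count_greater_zero_iff)
qed

lemmas [fundef_cong] = image_mset_cong

function root_component :: "'i address set \<Rightarrow> 'i rtree \<Rightarrow> 'i rtree" where
  \<comment> \<open>the component of the root after deletion of the edges in \<open>c\<close>\<close>
  "root_component c (Node i ts) =
    Node i (image_mset (\<lambda>x. root_component {q. x # q \<in> c} (fst x))
      (mset_set {(s, k). k < count ts s \<and> [(s, k)] \<notin> c}))"
  by pat_completeness auto
termination
proof (relation "measure (nvertices \<circ> snd)")
  fix c :: "'i address set" and i ts x
  assume "x \<in># mset_set {(s, k). k < count ts s \<and> [(s, k)] \<notin> c}"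
  then have "fst x \<in># ts" by (rule mem_mset_set_child)
  from nvertices_le_forest_weight[OF this]
  show "(({q. x # q \<in> c}, fst x), (c, Node i ts)) \<in> measure (nvertices \<circ> snd)"
    by (simp add: forest_weight_def)
qed simp

definition component_at :: "'i address set \<Rightarrow> 'i rtree \<Rightarrow> 'i address \<Rightarrow> 'i rtree" where
  \<comment> \<open>the component with topmost vertex \<open>p\<close>, for \<open>p\<close> the root or the lower endpoint
    of an edge in \<open>c\<close>\<close>
  "component_at c t p = root_component {q. p @ q \<in> c} (subtree_at t p)"

definition R_cut :: "'i address set \<Rightarrow> 'i rtree \<Rightarrow> 'i rtree" where
  "R_cut c t = component_at c t []"

definition P_cut :: "'i address set \<Rightarrow> 'i rtree \<Rightarrow> 'i forest" where
  "P_cut c t = image_mset (component_at c t) (mset_set c)"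


section \<open>The Hopf algebra of decorated rooted trees\<close>

text \<open>
  The polynomial algebra on trees is the monoid algebra of the monoid of forests, and its tensor
  square is the monoid algebra of the monoid of pairs of forests. In both cases the product is the
  convolution product of \<open>Poly_Mapping\<close>.
\<close>

type_synonym ('i, 'k) ckh = "'i forest \<Rightarrow>\<^sub>0 'k"
type_synonym ('i, 'k) ckh2 = "('i forest \<times> 'i forest) \<Rightarrow>\<^sub>0 'k"

definition pm_scale :: "'k :: field \<Rightarrow> ('a \<Rightarrow>\<^sub>0 'k) \<Rightarrow> ('a \<Rightarrow>\<^sub>0 'k)" where
  "pm_scale c x = Poly_Mapping.map ((*) c) x"

lemma lookup_pm_scale [simp]: "Poly_Mapping.lookup (pm_scale c x) a = c * Poly_Mapping.lookup x a"
  by (simp add: pm_scale_def Poly_Mapping.map.rep_eq when_def)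

interpretation pm: vector_space "pm_scale :: 'k :: field \<Rightarrow> ('a \<Rightarrow>\<^sub>0 'k) \<Rightarrow> ('a \<Rightarrow>\<^sub>0 'k)"
  by unfold_locales (auto intro!: poly_mapping_eqI simp: lookup_add algebra_simps)

abbreviation basis :: "'a \<Rightarrow> ('a \<Rightarrow>\<^sub>0 'k :: field)" where
  "basis a \<equiv> Poly_Mapping.single a 1"

definition tensor :: "('i, 'k :: field) ckh \<Rightarrow> ('i, 'k) ckh \<Rightarrow> ('i, 'k) ckh2" where
  "tensor x y = (\<Sum>u\<in>Poly_Mapping.keys x. \<Sum>v\<in>Poly_Mapping.keys y.
    Poly_Mapping.single (u, v) (Poly_Mapping.lookup x u * Poly_Mapping.lookup y v))"

definition coproduct_tree :: "'i rtree \<Rightarrow> ('i, 'k :: field) ckh2" where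
  "coproduct_tree t = tensor (basis {#t#}) 1 + tensor 1 (basis {#t#}) +
    (\<Sum>c\<in>admissible_cuts t. tensor (basis (P_cut c t)) (basis {#R_cut c t#}))"

definition coproduct :: "('i, 'k :: field) ckh \<Rightarrow> ('i, 'k) ckh2" where
  "coproduct x = (\<Sum>w\<in>Poly_Mapping.keys x.
    pm_scale (Poly_Mapping.lookup x w) (\<Prod>t\<in>#w. coproduct_tree t))"

definition counit :: "('i, 'k :: field) ckh \<Rightarrow> 'k" where
  "counit x = Poly_Mapping.lookup x {#}"

definition mult_tensor :: "(('i, 'k :: field) ckh \<Rightarrow> ('i, 'k) ckh) \<Rightarrow>
    (('i, 'k) ckh \<Rightarrow> ('i, 'k) ckh) \<Rightarrow> ('i, 'k) ckh2 \<Rightarrow> ('i, 'k) ckh" where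
  \<comment> \<open>the composite of \<open>f \<otimes> g\<close> with the product, for linear \<open>f\<close> and \<open>g\<close>\<close>
  "mult_tensor f g z = (\<Sum>(u, v)\<in>Poly_Mapping.keys z.
    pm_scale (Poly_Mapping.lookup z (u, v)) (f (basis u) * g (basis v)))"

definition is_antipode :: "(('i, 'k :: field) ckh \<Rightarrow> ('i, 'k) ckh) \<Rightarrow> bool" where
  "is_antipode S \<longleftrightarrow> Vector_Spaces.linear pm_scale pm_scale S \<and>
    (\<forall>x. mult_tensor S id (coproduct x) = pm_scale (counit x) 1 \<and>
         mult_tensor id S (coproduct x) = pm_scale (counit x) 1)"

definition is_subalgebra :: "('i, 'k :: field) ckh set \<Rightarrow> bool" where
  "is_subalgebra A \<longleftrightarrow> pm.subspace A \<and> 1 \<in> A \<and> (\<forall>x\<in>A. \<forall>y\<in>A. x * y \<in> A)"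

definition is_hopf_subalgebra :: "('i, 'k :: field) ckh set \<Rightarrow> bool" where
  \<comment> \<open>the span is the image of \<open>A \<otimes> A\<close>; the antipode is unique, being the convolution
    inverse of the identity\<close>
  "is_hopf_subalgebra A \<longleftrightarrow> is_subalgebra A \<and>
    coproduct ` A \<subseteq> pm.span {tensor x y | x y. x \<in> A \<and> y \<in> A} \<and>
    (\<exists>S. is_antipode S \<and> S ` A \<subseteq> A)"


section \<open>Systems of Dyson-Schwinger equations\<close>

definition B_plus :: "'i \<Rightarrow> ('i rtree, 'k) mps \<Rightarrow> ('i rtree, 'k :: field) mps" where
  \<comment> \<open>the continuous linear extension of \<open>u \<mapsto> Node i u\<close>\<close>
  "B_plus i X = Abs_mps (\<lambda>w. Sum_any (\<lambda>u. mcoeff X u when {#Node i u#} = w))"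

definition is_SDSE_solution ::
  "('i \<Rightarrow> ('i, 'k :: field) mps) \<Rightarrow> ('i \<Rightarrow> ('i rtree, 'k) mps) \<Rightarrow> bool" where
  "is_SDSE_solution F X \<longleftrightarrow> (\<forall>i. X i = B_plus i (mps_subst (F i) X))"

definition SDSE_solution ::
  "('i \<Rightarrow> ('i, 'k :: field) mps) \<Rightarrow> ('i \<Rightarrow> ('i rtree, 'k) mps)" where
  "SDSE_solution F = (THE X. is_SDSE_solution F X)"

definition homogeneous_component :: "('i :: finite rtree, 'k :: field) mps \<Rightarrow> nat \<Rightarrow> ('i, 'k) ckh" where
  "homogeneous_component X n =
    (\<Sum>w | forest_weight w = n. Poly_Mapping.single w (mcoeff X w))"

definition SDSE_algebra :: "('i :: finite \<Rightarrow> ('i, 'k :: field) mps) \<Rightarrow> ('i, 'k) ckh set" where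
  "SDSE_algebra F = is_subalgebra hull {homogeneous_component (SDSE_solution F i) n | i n. True}"

definition SDSE_is_hopf :: "('i :: finite \<Rightarrow> ('i, 'k :: field) mps) \<Rightarrow> bool" where
  "SDSE_is_hopf F \<longleftrightarrow> is_hopf_subalgebra (SDSE_algebra F)"


section \<open>The series occurring in the systems\<close>

definition f_ser :: "'k :: field_char_0 \<Rightarrow> 'k fps" where
  \<comment> \<open>the factor for \<open>i = 0\<close> is \<open>1\<close>\<close>
  "f_ser \<beta> = Abs_fps (\<lambda>k. (\<Prod>i<k. 1 + of_nat i * \<beta>) / fact k)"

definition f_quot :: "'k :: field_char_0 \<Rightarrow> 'k \<Rightarrow> 'k fps" where
  \<comment> \<open>\<open>f_quot \<beta> \<mu>\<close> is what is written \<open>f_{\<beta>/\<mu>}(\<mu>h)\<close>, including \<open>\<mu> = 0\<close>\<close>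
  "f_quot \<beta> \<mu> = Abs_fps (\<lambda>k. (\<Prod>i<k. \<mu> + of_nat i * \<beta>) / fact k)"

definition log_ser :: "'k :: field_char_0 \<Rightarrow> 'k \<Rightarrow> 'k fps" where
  \<comment> \<open>\<open>log_ser a \<beta>\<close> is what is written \<open>-(a/\<beta>) ln(1 - \<beta>h)\<close>, including \<open>\<beta> = 0\<close>\<close>
  "log_ser a \<beta> = Abs_fps (\<lambda>k. if k = 0 then 0 else a * \<beta> ^ (k - 1) / of_nat k)"

lemma f_quot_1: "f_quot \<beta> 1 = f_ser \<beta>"
  by (simp add: f_quot_def f_ser_def)

lemma f_quot_0: "f_quot \<beta> 0 = 1"
proof (rule fps_ext)
  fix n show "fps_nth (f_quot \<beta> 0) n = fps_nth 1 n"
  proof (cases n)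
    case (Suc m)
    then have "(\<Prod>i<n. 0 + of_nat i * \<beta>) = 0"
      by (intro prod_zero bexI[of _ 0]) auto
    then show ?thesis using Suc by (simp add: f_quot_def)
  qed (simp add: f_quot_def)
qed

lemma f_quot_eq_compose:
  assumes "\<mu> \<noteq> 0"
  shows "f_quot \<beta> \<mu> = fps_compose (f_ser (\<beta> / \<mu>)) (fps_const \<mu> * fps_X)"
proof (rule fps_ext)
  fix n
  have "(\<Prod>i<n. \<mu> + of_nat i * \<beta>) = (\<Prod>i<n. \<mu> * (1 + of_nat i * (\<beta> / \<mu>)))"
    using assms by (intro prod.cong) (auto simp: field_simps)
  also have "\<dots> = \<mu> ^ n * (\<Prod>i<n. 1 + of_nat i * (\<beta> / \<mu>))"
    by (simp add: prod.distrib)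
  finally show "fps_nth (f_quot \<beta> \<mu>) n =
      fps_nth (fps_compose (f_ser (\<beta> / \<mu>)) (fps_const \<mu> * fps_X)) n"
    by (simp add: f_quot_def f_ser_def fps_compose_linear)
qed

lemma log_ser_0: "log_ser a 0 = fps_const a * fps_X"
  by (rule fps_ext) (auto simp: log_ser_def fps_X_def)

lemma log_ser_eq_ln:
  fixes \<beta> :: "'a :: field_char_0"
  assumes "\<beta> \<noteq> 0"
  shows "log_ser a \<beta> =
    fps_const (- (a / \<beta>)) * fps_compose (fps_ln 1) (fps_const (- \<beta>) * fps_X)"
proof (rule fps_ext)
  fix n
  show "fps_nth (log_ser a \<beta>) n = fps_nth
      (fps_const (- (a / \<beta>)) * fps_compose (fps_ln 1) (fps_const (- \<beta>) * fps_X)) n"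
    unfolding fps_mult_left_const_nth fps_nth_compose_linear
  proof (cases n)
    case (Suc m)
    have "(- \<beta>) ^ Suc m * (- 1) ^ m = - (\<beta> ^ Suc m)"
      by (simp add: power_mult_distrib[symmetric])
    then have "- (a / \<beta>) * ((- \<beta>) ^ Suc m * ((- 1) ^ m / of_nat (Suc m))) =
        - (a / \<beta>) * (- (\<beta> ^ Suc m) / of_nat (Suc m))"
      by (metis times_divide_eq_right)
    also have "\<dots> = a * \<beta> ^ m / of_nat (Suc m)"
      using assms by simp
    also have "\<dots> = fps_nth (log_ser a \<beta>) n"
      using Suc by (simp add: log_ser_def)
    also have "(- 1) ^ m / of_nat (Suc m) = fps_nth (fps_ln (1 :: 'a)) n"
      using Suc by (simp add: fps_ln_def)
    finally show "fps_nth (log_ser a \<beta>) n =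
        - (a / \<beta>) * ((- \<beta>) ^ n * fps_nth (fps_ln 1) n)"
      using Suc by simp
  qed (simp add: log_ser_def fps_ln_def)
qed

end

theory Submission
  imports Defs
begin

text \<open>
  Let \<open>Q\<close> be the product of the series \<open>f\<^bsub>\<beta>\<^sub>j/(1 + \<beta>\<^sub>j)\<^esub>((1 + \<beta>\<^sub>j) h\<^sub>j)\<close> for \<open>j \<in> I\<^sub>0\<close> and
  \<open>f\<^sub>1(h\<^sub>j)\<close> for \<open>j \<in> J\<^sub>0\<close>, and put \<open>\<beta>\<^sub>j = 1\<close> on \<open>J\<^sub>0\<close> and \<open>\<beta>\<^sub>j = 0\<close> on \<open>K\<^sub>0\<close>. Then
  \<open>F\<^sub>j = Q (1 - \<beta>\<^sub>j h\<^sub>j)\<close> for \<open>j \<in> I\<^sub>0 \<union> J\<^sub>0 \<union> K\<^sub>0\<close>. Since \<open>\<Delta> \<circ> B\<^sub>i = B\<^sub>i \<otimes> 1 + (id \<otimes> B\<^sub>i) \<circ> \<Delta>\<close>, the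
  coproducts \<open>\<Delta> X\<^sub>i\<close> are the unique solution of
  \<open>Y\<^sub>i = X\<^sub>i \<otimes> 1 + (id \<otimes> B\<^sub>i)(F\<^sub>i(Y))\<close>. One checks that the family
  \<open>Y\<^sub>i = X\<^sub>i \<otimes> 1 + F\<^sub>i(X) \<otimes> X\<^sub>i(1) + \<Sum>\<^sub>n\<^sub>\<ge>\<^sub>1 E\<^sub>i(X) Q(X)\<^sup>n \<otimes> X\<^sub>i(n + 1)\<close>
  solves it, for suitable series \<open>E\<^sub>i\<close> (\<open>E\<^sub>i = F\<^sub>i\<close> for \<open>i \<in> I\<^sub>0 \<union> J\<^sub>0 \<union> K\<^sub>0\<close>). For such \<open>i\<close> it reads
  \<open>Y\<^sub>i = x + (1 - \<beta>\<^sub>i x) y\<close> with \<open>x = X\<^sub>i \<otimes> 1\<close> and \<open>y = \<Sum>\<^sub>n Q(X)\<^sup>n \<otimes> X\<^sub>i(n)\<close>, and every series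
  \<open>(1 - \<beta>\<^sub>i h)\<^bsup>-\<mu>/\<beta>\<^sub>i\<^esup>\<close> is multiplicative, and \<open>ln (1 - \<beta>\<^sub>i h)\<close> additive, for this composition of
  \<open>x\<close> and \<open>y\<close>. As \<open>n \<mapsto> Q(X)\<^sup>n \<otimes> _\<close> is a rescaling of the grading, it is compatible with products,
  and \<open>F\<^sub>i(Y)\<close> can be computed factor by factor.
\<close>

section \<open>Linear extension in monoid algebras\<close>

definition lin_extend :: "('a \<Rightarrow> ('b \<Rightarrow>\<^sub>0 'k :: field)) \<Rightarrow> ('a \<Rightarrow>\<^sub>0 'k) \<Rightarrow> ('b \<Rightarrow>\<^sub>0 'k)" where
  "lin_extend h x = (\<Sum>a\<in>Poly_Mapping.keys x. pm_scale (Poly_Mapping.lookup x a) (h a))"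

lemma lin_extend_superset:
  assumes "finite A" "Poly_Mapping.keys x \<subseteq> A"
  shows "lin_extend h x = (\<Sum>a\<in>A. pm_scale (Poly_Mapping.lookup x a) (h a))"
  unfolding lin_extend_def
  by (rule sum.mono_neutral_left) (use assms in \<open>auto simp: in_keys_iff\<close>)

lemma lin_extend_add: "lin_extend h (x + y) = lin_extend h x + lin_extend h y"
proof -
  let ?A = "Poly_Mapping.keys x \<union> Poly_Mapping.keys y"
  have "Poly_Mapping.keys (x + y) \<subseteq> ?A" by (rule keys_add)
  then show ?thesis
    by (simp add: lin_extend_superset[of ?A] lookup_add pm.scale_left_distrib sum.distrib)
qed

lemma lin_extend_single: "lin_extend h (Poly_Mapping.single a c) = pm_scale c (h a)"
  by (subst lin_extend_superset[of "{a}"]) auto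

lemma lin_extend_basis [simp]: "lin_extend h (basis a) = h a"
  by (simp add: lin_extend_single)

lemma lin_extend_scale: "lin_extend h (pm_scale c x) = pm_scale c (lin_extend h x)"
proof -
  have "Poly_Mapping.keys (pm_scale c x) \<subseteq> Poly_Mapping.keys x"
    by (auto simp: in_keys_iff)
  then show ?thesis
    by (simp add: lin_extend_superset[of "Poly_Mapping.keys x"] pm.scale_sum_right)
qed

lemma pm_scale_conv_mult: "pm_scale c x = Poly_Mapping.single 0 c * x"
  unfolding pm_scale_def by (rule mult_map_scale_conv_mult)

lemma single_conv_scale: "Poly_Mapping.single a c = pm_scale c (basis a)"
  by (rule poly_mapping_eqI) (simp add: lookup_single when_def)

lemma poly_mapping_sum_monomials:
  "x = (\<Sum>a\<in>Poly_Mapping.keys x. Poly_Mapping.single a (Poly_Mapping.lookup x a))"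
  by (rule poly_mapping_eqI) (auto simp: lookup_sum lookup_single when_def in_keys_iff)

locale pm_linear =
  fixes f :: "('a \<Rightarrow>\<^sub>0 'k :: field) \<Rightarrow> ('b \<Rightarrow>\<^sub>0 'k)"
  assumes add: "f (x + y) = f x + f y"
    and scale: "f (pm_scale c x) = pm_scale c (f x)"
begin

sublocale Vector_Spaces.linear pm_scale pm_scale f
  by unfold_locales (simp_all add: add scale)

lemma map_single: "f (Poly_Mapping.single a c) = pm_scale c (f (basis a))"
  by (metis scale single_conv_scale)

end

named_theorems pm_linear_intros

lemma pm_linear_lin_extend [simp, pm_linear_intros]: "pm_linear (lin_extend h)"
  by unfold_locales (simp_all add: lin_extend_add lin_extend_scale)

lemma pm_linear_id [pm_linear_intros]: "pm_linear (\<lambda>x. x)"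
  by unfold_locales simp_all

lemma pm_linear_compose: "pm_linear f \<Longrightarrow> pm_linear g \<Longrightarrow> pm_linear (\<lambda>x. f (g x))"
  by (simp add: pm_linear_def)

lemmas pm_linear_compose_lin_extend [pm_linear_intros] =
  pm_linear_compose[OF pm_linear_lin_extend]

lemma pm_linear_add [pm_linear_intros]:
  "pm_linear f \<Longrightarrow> pm_linear g \<Longrightarrow> pm_linear (\<lambda>x. f x + g x)"
  by (simp add: pm_linear_def algebra_simps)

lemma pm_linear_uminus [pm_linear_intros]: "pm_linear f \<Longrightarrow> pm_linear (\<lambda>x. - f x)"
  by (simp add: pm_linear_def)

lemma pm_linear_mult_left [pm_linear_intros]:
  fixes a :: "'b :: comm_monoid_add \<Rightarrow>\<^sub>0 'k :: field"
  shows "pm_linear f \<Longrightarrow> pm_linear (\<lambda>x. a * f x)"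
  by (simp add: pm_linear_def pm_scale_conv_mult distrib_left mult.left_commute)

lemma pm_linear_mult_right [pm_linear_intros]: "pm_linear f \<Longrightarrow> pm_linear (\<lambda>x. f x * a)"
  by (simp add: pm_linear_def pm_scale_conv_mult distrib_right mult.assoc)

lemma pm_linear_eqI:
  fixes x :: "'a \<Rightarrow>\<^sub>0 'b :: field" and f g :: "_ \<Rightarrow> 'c \<Rightarrow>\<^sub>0 'b"
  assumes f: "pm_linear f" and g: "pm_linear g" and eq: "\<And>a. f (basis a) = g (basis a)"
  shows "f x = g x"
proof -
  have expand: "h x = (\<Sum>a\<in>Poly_Mapping.keys x. pm_scale (Poly_Mapping.lookup x a) (h (basis a)))"
    if "pm_linear h" for h :: "('a \<Rightarrow>\<^sub>0 'b) \<Rightarrow> ('c \<Rightarrow>\<^sub>0 'b)"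
  proof -
    interpret pm_linear h by (rule that)
    have "h x = h (\<Sum>a\<in>Poly_Mapping.keys x. Poly_Mapping.single a (Poly_Mapping.lookup x a))"
      using poly_mapping_sum_monomials[of x] by (rule arg_cong)
    then show ?thesis
      unfolding sum by (simp only: map_single[symmetric])
  qed
  show ?thesis
    unfolding expand[OF f] expand[OF g] eq ..
qed

section \<open>Algebra morphisms of monoid algebras\<close>

definition alg_hom ::
  "(('a :: comm_monoid_add \<Rightarrow>\<^sub>0 'k :: field) \<Rightarrow> ('b :: comm_monoid_add \<Rightarrow>\<^sub>0 'k)) \<Rightarrow> bool" where
  "alg_hom f \<longleftrightarrow> pm_linear f \<and> f 1 = 1 \<and> (\<forall>x y. f (x * y) = f x * f y)"

lemma alg_hom_linear: "alg_hom f \<Longrightarrow> pm_linear f"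
  and alg_hom_1: "alg_hom f \<Longrightarrow> f 1 = 1"
  and alg_hom_mult: "alg_hom f \<Longrightarrow> f (x * y) = f x * f y"
  by (simp_all add: alg_hom_def)

lemma alg_hom_add: "alg_hom f \<Longrightarrow> f (x + y) = f x + f y"
  by (simp add: alg_hom_def pm_linear_def)

lemma alg_hom_0:
  assumes f: "alg_hom f"
  shows "f 0 = 0"
proof -
  have "f 0 + f 0 = f 0 + 0"
    using alg_hom_add[OF f, of 0 0] by simp
  then show ?thesis by (simp only: add_left_cancel)
qed

lemma alg_hom_sum:
  assumes f: "alg_hom f"
  shows "f (sum g A) = (\<Sum>a\<in>A. f (g a))"
  by (induction A rule: infinite_finite_induct) (simp_all add: alg_hom_0[OF f] alg_hom_add[OF f])

lemma alg_hom_prod_mset: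
  assumes f: "alg_hom f"
  shows "f (\<Prod>a\<in>#A. g a) = (\<Prod>a\<in>#A. f (g a))"
  by (induction A) (simp_all add: alg_hom_1[OF f] alg_hom_mult[OF f])

lemma alg_hom_scalar:
  assumes f: "alg_hom f"
  shows "f (Poly_Mapping.single 0 c) = Poly_Mapping.single 0 c"
  using pm_linear.map_single[OF alg_hom_linear[OF f], of 0 c]
  by (simp add: alg_hom_1[OF f] pm_scale_conv_mult)

lemma alg_hom_compose: "alg_hom f \<Longrightarrow> alg_hom g \<Longrightarrow> alg_hom (\<lambda>x. f (g x))"
  unfolding alg_hom_def using pm_linear_compose by auto

lemma alg_hom_id: "alg_hom (\<lambda>x. x)"
  by (simp add: alg_hom_def pm_linear_id)

lemma alg_hom_lin_extend:
  assumes "h 0 = 1" "\<And>a b. h (a + b) = h a * h b"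
  shows "alg_hom (lin_extend h)"
proof -
  have 1: "lin_extend h (basis a * y) = h a * lin_extend h y" for a y
    by (rule pm_linear_eqI[of "\<lambda>y. lin_extend h (basis a * y)" "\<lambda>y. h a * lin_extend h y"])
      (auto intro!: pm_linear_intros simp: mult_single assms)
  have "lin_extend h (x * y) = lin_extend h x * lin_extend h y" for x y
    by (rule pm_linear_eqI[of "\<lambda>x. lin_extend h (x * y)" "\<lambda>x. lin_extend h x * lin_extend h y"])
      (rule pm_linear_intros | simp add: 1)+
  moreover have "lin_extend h 1 = 1"
    using lin_extend_basis[of h 0] by (simp add: assms)
  ultimately show ?thesis by (simp add: alg_hom_def)
qed

lemma basis_add: "basis (a + b) = basis a * basis (b :: 'a :: comm_monoid_add)"
  by (simp add: mult_single)

lemma basis_empty [simp]: "basis {#} = 1"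
  unfolding zero_multiset_def[symmetric] by (rule single_one)

lemma basis_forest: "(basis w :: _ \<Rightarrow>\<^sub>0 'k :: field) = (\<Prod>t\<in>#w. basis {#t#})"
proof (induction w)
  case empty
  show ?case by simp
next
  case (add t w)
  have "(basis (add_mset t w) :: _ \<Rightarrow>\<^sub>0 'k) = basis {#t#} * basis w"
    by (simp add: mult_single)
  then show ?case using add by simp
qed

text \<open>Trees generate the algebra, since a forest is the product of its trees.\<close>

lemma alg_hom_eqI:
  fixes x :: "'t multiset \<Rightarrow>\<^sub>0 'k :: field"
  assumes f: "alg_hom f" and g: "alg_hom g" and eq: "\<And>t. f (basis {#t#}) = g (basis {#t#})"
  shows "f x = g x"
proof (rule pm_linear_eqI[of f g])
  fix w :: "'t multiset"
  show "f (basis w) = g (basis w)"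
    by (subst (1 2) basis_forest) (simp add: alg_hom_prod_mset[OF f] alg_hom_prod_mset[OF g] eq)
qed (rule alg_hom_linear[OF f] alg_hom_linear[OF g])+

text \<open>The universal property of the polynomial algebra on trees: any choice of images for the
  trees extends to an algebra morphism. The coproduct, the antipode and the counit are all obtained
  in this way below.\<close>

definition tree_extend ::
  "('t \<Rightarrow> ('b :: comm_monoid_add \<Rightarrow>\<^sub>0 'k :: field)) \<Rightarrow> ('t multiset \<Rightarrow>\<^sub>0 'k) \<Rightarrow> ('b \<Rightarrow>\<^sub>0 'k)" where
  "tree_extend h = lin_extend (\<lambda>w. \<Prod>t\<in>#w. h t)"

lemma alg_hom_tree_extend [simp]: "alg_hom (tree_extend h)"
  unfolding tree_extend_def by (rule alg_hom_lin_extend) auto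

lemma tree_extend_basis: "tree_extend h (basis w) = (\<Prod>t\<in>#w. h t)"
  by (simp add: tree_extend_def)

lemma tree_extend_tree [simp]: "tree_extend h (basis {#t#}) = h t"
  by (simp add: tree_extend_basis)

section \<open>The tensor square\<close>

definition in_left :: "('i, 'k :: field) ckh \<Rightarrow> ('i, 'k) ckh2" where
  "in_left = lin_extend (\<lambda>u. basis (u, {#}))"

definition in_right :: "('i, 'k :: field) ckh \<Rightarrow> ('i, 'k) ckh2" where
  "in_right = lin_extend (\<lambda>v. basis ({#}, v))"

lemma basis_pair_0 [simp]: "basis ({#}, {#}) = 1"
  unfolding zero_multiset_def[symmetric] zero_prod_def[symmetric] by (rule single_one)

lemma pm_linear_in_left [pm_linear_intros]: "pm_linear f \<Longrightarrow> pm_linear (\<lambda>x. in_left (f x))"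
  and pm_linear_in_right [pm_linear_intros]: "pm_linear f \<Longrightarrow> pm_linear (\<lambda>x. in_right (f x))"
  unfolding in_left_def in_right_def by (auto intro!: pm_linear_intros)

lemma alg_hom_in_left [simp]: "alg_hom in_left" and alg_hom_in_right [simp]: "alg_hom in_right"
  unfolding in_left_def in_right_def
  by (rule alg_hom_lin_extend; simp add: mult_single)+

lemma in_left_basis [simp]: "in_left (basis u) = basis (u, {#})"
  and in_right_basis [simp]: "in_right (basis v) = basis ({#}, v)"
  by (simp_all add: in_left_def in_right_def)

lemma basis_pair: "in_left (basis u) * in_right (basis v) = basis (u, v)"
  by (simp add: mult_single)

text \<open>With both factors embedded in the commutative tensor square, a pure tensor is a product,
  so identities between tensors reduce to facts about algebra morphisms.\<close>

lemma tensor_conv: "tensor x y = in_left x * in_right y"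
proof -
  have "in_left x * in_right y =
      (\<Sum>u\<in>Poly_Mapping.keys x. \<Sum>v\<in>Poly_Mapping.keys y.
        pm_scale (Poly_Mapping.lookup x u) (basis (u, {#})) *
        pm_scale (Poly_Mapping.lookup y v) (basis ({#}, v)))"
    by (simp add: in_left_def in_right_def lin_extend_def sum_product)
  also have "\<dots> = tensor x y"
    unfolding tensor_def
    by (intro sum.cong refl) (simp add: single_conv_scale[symmetric] mult_single)
  finally show ?thesis by simp
qed

lemma tensor_basis [simp]: "tensor (basis u) (basis v) = basis (u, v)"
  by (simp only: tensor_conv basis_pair)

definition multiply :: "('i, 'k :: field) ckh2 \<Rightarrow> ('i, 'k) ckh" where
  "multiply = lin_extend (\<lambda>(u, v). basis (u + v))"

lemma pm_linear_multiply [pm_linear_intros]: "pm_linear f \<Longrightarrow> pm_linear (\<lambda>x. multiply (f x))"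
  unfolding multiply_def by (auto intro!: pm_linear_intros)

lemma alg_hom_multiply [simp]: "alg_hom multiply"
  unfolding multiply_def
  by (rule alg_hom_lin_extend) (auto simp: mult_single ac_simps zero_prod_def)

lemma multiply_in_left [simp]: "multiply (in_left x) = x"
  by (rule pm_linear_eqI[of "\<lambda>x. multiply (in_left x)" "\<lambda>x. x"])
    (auto intro!: pm_linear_intros simp: multiply_def)

lemma multiply_in_right [simp]: "multiply (in_right x) = x"
  by (rule pm_linear_eqI[of "\<lambda>x. multiply (in_right x)" "\<lambda>x. x"])
    (auto intro!: pm_linear_intros simp: multiply_def)

lemma mult_tensor_conv:
  "mult_tensor f g = lin_extend (\<lambda>(u, v). f (basis u) * g (basis v))"
  by (rule ext) (auto simp: mult_tensor_def lin_extend_def intro!: sum.cong)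

lemma alg_hom_mult_tensor:
  assumes f: "alg_hom f" and g: "alg_hom g"
  shows "alg_hom (mult_tensor f g)"
  unfolding mult_tensor_conv
proof (rule alg_hom_lin_extend)
  show "(case 0 of (u, v) \<Rightarrow> f (basis u) * g (basis v)) = 1"
    by (simp add: zero_prod_def alg_hom_1[OF f] alg_hom_1[OF g])
  fix a b
  show "(case a + b of (u, v) \<Rightarrow> f (basis u) * g (basis v)) =
      (case a of (u, v) \<Rightarrow> f (basis u) * g (basis v)) *
      (case b of (u, v) \<Rightarrow> f (basis u) * g (basis v))"
    by (auto simp: basis_add alg_hom_mult[OF f] alg_hom_mult[OF g] ac_simps split: prod.splits)
qed

section \<open>The grafting operators\<close>

definition graft :: "'i \<Rightarrow> ('i, 'k :: field) ckh \<Rightarrow> ('i, 'k) ckh" where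
  "graft i = lin_extend (\<lambda>w. basis {#Node i w#})"

text \<open>This is id \<otimes> B_i on the tensor square.\<close>

definition graft_right :: "'i \<Rightarrow> ('i, 'k :: field) ckh2 \<Rightarrow> ('i, 'k) ckh2" where
  "graft_right i = lin_extend (\<lambda>(u, v). basis (u, {#Node i v#}))"

lemma pm_linear_graft [pm_linear_intros]: "pm_linear f \<Longrightarrow> pm_linear (\<lambda>x. graft i (f x))"
  and pm_linear_graft_right [pm_linear_intros]:
    "pm_linear g \<Longrightarrow> pm_linear (\<lambda>x. graft_right i (g x))"
  unfolding graft_def graft_right_def by (auto intro!: pm_linear_intros)

lemma graft_basis [simp]: "graft i (basis w) = basis {#Node i w#}"
  and graft_right_basis [simp]: "graft_right i (basis (u, v)) = basis (u, {#Node i v#})"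
  by (simp_all add: graft_def graft_right_def)

lemma graft_right_in_right: "graft_right i (in_right x) = in_right (graft i x)"
  by (rule pm_linear_eqI[of "\<lambda>x. graft_right i (in_right x)" "\<lambda>x. in_right (graft i x)"])
    (auto intro!: pm_linear_intros)

text \<open>id \<otimes> B_i touches the right factor only, so it is linear over the subalgebra of
  left factors.\<close>

lemma graft_right_in_left_mult: "graft_right i (in_left x * z) = in_left x * graft_right i z"
proof -
  have 1: "graft_right i (in_left x * basis p) = in_left x * graft_right i (basis p)" for p
  proof (rule pm_linear_eqI[of "\<lambda>x. graft_right i (in_left x * basis p)"
        "\<lambda>x. in_left x * graft_right i (basis p)"])
    show "graft_right i (in_left (basis a) * basis p) =
        in_left (basis a) * graft_right i (basis p)" for a
      by (cases p) (simp add: mult_single)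
  qed (auto intro!: pm_linear_intros)
  show ?thesis
    by (rule pm_linear_eqI[of "\<lambda>z. graft_right i (in_left x * z)"
          "\<lambda>z. in_left x * graft_right i z"])
      (rule pm_linear_intros 1)+
qed

lemma pm_linear_sum: "pm_linear f \<Longrightarrow> f (sum g A) = (\<Sum>a\<in>A. f (g a))"
proof -
  assume "pm_linear f"
  then interpret pm_linear f .
  show ?thesis by (rule sum)
qed

section \<open>Admissible cuts and the cocycle property\<close>

definition children :: "'i rtree multiset \<Rightarrow> ('i rtree \<times> nat) set" where
  "children ts = {(s, k). k < count ts s}"

lemma children_eq: "children ts = (SIGMA s:set_mset ts. {..<count ts s})"
  by (auto simp: children_def count_greater_zero_iff[symmetric] simp del: count_greater_zero_iff)

lemma finite_children [simp]: "finite (children ts)"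
  by (simp add: children_eq)

lemma image_fst_children: "image_mset fst (mset_set (children ts)) = ts"
proof (rule multiset_eqI)
  fix s
  have "fst -` {s} \<inter> children ts = {s} \<times> {..<count ts s}"
    by (auto simp: children_def)
  moreover have "count (mset_set (children ts)) x = 1" if "x \<in> fst -` {s} \<inter> children ts" for x
    using that by (simp add: count_mset_set)
  ultimately show "count (image_mset fst (mset_set (children ts))) s = count ts s"
    by (simp add: count_image_mset)
qed

lemma prod_children: "(\<Prod>x\<in>children ts. f (fst x)) = (\<Prod>t\<in>#ts. f t)"
proof -
  have "(\<Prod>t\<in>#ts. f t) = prod_mset (image_mset f (image_mset fst (mset_set (children ts))))"
    by (simp only: image_fst_children)
  then show ?thesis
    by (simp add: prod_unfold_prod_mset image_mset.compositionality comp_def)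
qed

lemma child_mem: "x \<in> children ts \<Longrightarrow> fst x \<in># ts"
  by (auto simp: children_eq)

definition vertices :: "'i rtree \<Rightarrow> 'i address set" where
  "vertices t = {p. is_vertex t p}"

lemma Nil_in_vertices [simp]: "[] \<in> vertices t"
  by (simp add: vertices_def is_vertex.root)

lemma Cons_in_vertices [simp]:
  "x # q \<in> vertices (Node i ts) \<longleftrightarrow> x \<in> children ts \<and> q \<in> vertices (fst x)"
  by (cases x) (auto simp: vertices_def children_def intro: is_vertex.child elim: is_vertex.cases)

lemma vertices_Node:
  "vertices (Node i ts) = insert [] (\<Union>x\<in>children ts. (#) x ` vertices (fst x))"
proof (rule set_eqI)
  fix p show "p \<in> vertices (Node i ts) \<longleftrightarrow>
    p \<in> insert [] (\<Union>x\<in>children ts. (#) x ` vertices (fst x))"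
    by (cases p) auto
qed

lemma finite_vertices [simp]: "finite (vertices t)"
proof (induction t)
  case (Node i ts)
  then show ?case
    by (auto simp: vertices_Node dest: child_mem)
qed

section \<open>Cuts as antichains of addresses\<close>

definition antichain :: "'i address set \<Rightarrow> bool" where
  "antichain c \<longleftrightarrow> (\<forall>p\<in>c. \<forall>q\<in>c. prefix p q \<longrightarrow> p = q)"

text \<open>Besides the admissible cuts, these contain the empty cut and the cut above the root, encoded
  by the empty address. They correspond to the terms \<open>1 \<otimes> t\<close> and \<open>t \<otimes> 1\<close> of the coproduct.\<close>

definition general_cuts :: "'i rtree \<Rightarrow> 'i address set set" where
  "general_cuts t = {c. c \<subseteq> vertices t \<and> antichain c}"

lemma finite_general_cuts [simp]: "finite (general_cuts t)"
  by (rule finite_subset[of _ "Pow (vertices t)"]) (auto simp: general_cuts_def)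

text \<open>A longest vertex address extending \<open>q\<close> cannot be prolonged, so it denotes a
  leaf.\<close>

lemma extends_to_leaf:
  assumes "q \<in> vertices t"
  shows "\<exists>l\<in>leaves t. prefix q l"
proof -
  let ?A = "{p \<in> vertices t. prefix q p}"
  have "finite ?A" "?A \<noteq> {}" using assms by auto
  then have "Max (length ` ?A) \<in> length ` ?A" by (intro Max_in) auto
  then obtain l where "l \<in> ?A" "length l = Max (length ` ?A)" by (metis (no_types, lifting) imageE)
  then have l: "l \<in> ?A" "\<And>p. p \<in> ?A \<Longrightarrow> length p \<le> length l"
    using \<open>finite ?A\<close> by auto
  have "l \<in> leaves t"
    unfolding leaves_def
  proof (intro CollectI conjI notI)
    show "is_vertex t l" using l(1) by (simp add: vertices_def)
    assume "\<exists>x. is_vertex t (l @ [x])"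
    then obtain x where "l @ [x] \<in> ?A" using l(1) by (auto simp: vertices_def)
    from l(2)[OF this] show False by simp
  qed
  then show ?thesis using l(1) by auto
qed

text \<open>Two comparable edges of a cut both lie on the path to any leaf below the lower one.
  Conversely, two edges on one path are prefixes of the same address, hence comparable.\<close>

lemma admissible_iff_antichain:
  assumes c: "c \<subseteq> edges t"
  shows "(\<forall>l\<in>leaves t. card (c \<inter> path_edges l) \<le> 1) \<longleftrightarrow> antichain c"
proof
  assume L: "\<forall>l\<in>leaves t. card (c \<inter> path_edges l) \<le> 1"
  show "antichain c"
    unfolding antichain_def
  proof (intro ballI impI)
    fix p q assume pq: "p \<in> c" "q \<in> c" "prefix p q"
    have "q \<in> vertices t" using c pq by (auto simp: edges_def vertices_def)
    then obtain l where l: "l \<in> leaves t" "prefix q l" using extends_to_leaf by blast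
    have "p \<noteq> []" "q \<noteq> []" using c pq by (auto simp: edges_def)
    then have "p \<in> c \<inter> path_edges l" "q \<in> c \<inter> path_edges l"
      using pq l by (auto simp: path_edges_def intro: prefix_order.trans)
    \<comment> \<open>\<open>card\<close> is 0 on infinite sets, so finiteness is needed to read the
      bound as uniqueness.\<close>
    moreover have "finite (c \<inter> path_edges l)"
    proof (rule finite_subset)
      show "c \<inter> path_edges l \<subseteq> vertices t" using c by (auto simp: edges_def vertices_def)
    qed simp
    ultimately show "p = q"
      using L l(1) card_le_Suc0_iff_eq[of "c \<inter> path_edges l"] unfolding One_nat_def by blast
  qed
next
  assume "antichain c"
  show "\<forall>l\<in>leaves t. card (c \<inter> path_edges l) \<le> 1"
  proof
    fix l assume "l \<in> leaves t"
    have "p = q" if "p \<in> c \<inter> path_edges l" "q \<in> c \<inter> path_edges l" for p q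
      using that \<open>antichain c\<close> prefix_same_cases[of p l q]
      by (auto simp: antichain_def path_edges_def)
    then show "card (c \<inter> path_edges l) \<le> 1"
      using card_le_Suc0_iff_eq[of "c \<inter> path_edges l"]
      by (cases "finite (c \<inter> path_edges l)") (simp, simp)
  qed
qed

lemma antichain_with_root:
  assumes "antichain c"
  shows "[] \<in> c \<longleftrightarrow> c = {[]}"
proof
  assume root: "[] \<in> c"
  have "p = []" if "p \<in> c" for p
    using assms root that unfolding antichain_def by (metis Nil_prefix)
  with root show "c = {[]}" by auto
qed simp

lemma antichain_simps [simp]: "antichain {}" "antichain {[]}"
  by (simp_all add: antichain_def)

lemma edges_eq: "edges t = vertices t - {[]}"
  by (auto simp: edges_def vertices_def)

lemma general_cuts_eq: "general_cuts t = insert {[]} (insert {} (admissible_cuts t))"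
proof (rule set_eqI)
  fix c
  have "c \<in> general_cuts t \<longleftrightarrow> c = {[]} \<or> c = {} \<or> c \<in> admissible_cuts t"
  proof (cases "[] \<in> c")
    case True
    have "c \<in> general_cuts t \<longleftrightarrow> c = {[]}"
    proof
      assume "c \<in> general_cuts t"
      then have "antichain c" by (simp add: general_cuts_def)
      then show "c = {[]}" using antichain_with_root True by blast
    qed (simp add: general_cuts_def)
    moreover have "c \<notin> admissible_cuts t" "c \<noteq> {}"
      using True by (auto simp: admissible_cuts_def edges_eq)
    ultimately show ?thesis by simp
  next
    case False
    then have "c \<in> general_cuts t \<longleftrightarrow> c \<subseteq> edges t \<and> antichain c"
      by (simp add: general_cuts_def edges_eq subset_Diff_insert)
    moreover have "c \<in> admissible_cuts t \<longleftrightarrow> c \<noteq> {} \<and> c \<subseteq> edges t \<and> antichain c"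
      by (cases "c \<subseteq> edges t")
        (simp_all add: admissible_cuts_def admissible_iff_antichain[unfolded One_nat_def])
    moreover have "c \<noteq> {[]}" using False by auto
    ultimately show ?thesis by (cases "c = {}") simp_all
  qed
  then show "c \<in> general_cuts t \<longleftrightarrow> c \<in> insert {[]} (insert {} (admissible_cuts t))"
    by simp
qed

lemma root_component_id: "c \<subseteq> {[]} \<Longrightarrow> root_component c t = t"
proof (induction t arbitrary: c)
  case (Node i ts)
  have c: "[x] \<notin> c" "{q. x # q \<in> c} = {}" for x using Node.prems by auto
  have "image_mset (\<lambda>x. root_component {} (fst x)) (mset_set (children ts)) =
      image_mset fst (mset_set (children ts))"
    by (rule image_mset_cong) (simp add: Node.IH[OF child_mem])
  moreover have "{(s, k). k < count ts s \<and> [(s, k)] \<notin> c} = children ts"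
    using c(1) by (auto simp: children_def)
  ultimately show ?case
    by (simp only: root_component.simps c(2) image_fst_children)
qed

text \<open>The right tensor factor of a cut. The cut above the root leaves nothing, as in t
  \<otimes> 1.\<close>

definition cut_remainder :: "'i address set \<Rightarrow> 'i rtree \<Rightarrow> 'i forest" where
  "cut_remainder c t = (if [] \<in> c then {#} else {#R_cut c t#})"

lemma R_cut_eq: "R_cut c t = root_component c t"
  by (simp add: R_cut_def component_at_def subtree_at_def)

text \<open>The cut \<open>{[]}\<close> splits off the whole tree and gives t \<otimes> 1, and the
  cut \<open>{}\<close> gives 1 \<otimes> t. The two exceptional terms of the coproduct thus join
  the sum over cuts.\<close>

lemma coproduct_tree_eq:
  "(coproduct_tree t :: ('i, 'k :: field) ckh2) =
    (\<Sum>c\<in>general_cuts t. basis (P_cut c t, cut_remainder c t))"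
proof -
  have 1: "{[]} \<notin> insert {} (admissible_cuts t)" "{} \<notin> admissible_cuts t"
    by (auto simp: admissible_cuts_def edges_def)
  have fin: "finite (admissible_cuts t)"
    using finite_general_cuts[of t] unfolding general_cuts_eq by simp
  have 2: "P_cut {[]} t = {#t#}" "P_cut {} t = {#}" "R_cut {} t = t"
    by (simp_all add: P_cut_def component_at_def subtree_at_def R_cut_eq root_component_id)
  have 3: "c \<in> admissible_cuts t \<Longrightarrow> cut_remainder c t = {#R_cut c t#}" for c
    by (auto simp: admissible_cuts_def edges_def cut_remainder_def)
  let ?g = "\<lambda>c. basis (P_cut c t, cut_remainder c t) :: ('i, 'k) ckh2"
  have "(\<Sum>c\<in>general_cuts t. ?g c) = ?g {[]} + (?g {} + (\<Sum>c\<in>admissible_cuts t. ?g c))"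
    unfolding general_cuts_eq using 1 fin by (simp only: sum.insert finite_insert not_False_eq_True)
  also have "?g {[]} = tensor (basis {#t#}) (basis {#})"
    unfolding tensor_basis 2 by (simp add: cut_remainder_def)
  also have "?g {} = tensor (basis {#}) (basis {#t#})"
    unfolding tensor_basis 2 cut_remainder_def by simp
  also have "(\<Sum>c\<in>admissible_cuts t. ?g c) =
      (\<Sum>c\<in>admissible_cuts t. tensor (basis (P_cut c t)) (basis {#R_cut c t#}))"
    by (rule sum.cong) (simp_all only: tensor_basis 3)
  finally show ?thesis
    unfolding coproduct_tree_def basis_empty by (simp only: add.assoc)
qed

section \<open>Cuts of a tree and cuts of its subtrees\<close>

definition cut_restrict :: "'i rtree \<times> nat \<Rightarrow> 'i address set \<Rightarrow> 'i address set" where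
  "cut_restrict x c = {q. x # q \<in> c}"

lemma proper_cutD:
  assumes "c \<in> general_cuts t - {{[]}}"
  shows "c \<subseteq> vertices t" "antichain c" "[] \<notin> c"
proof -
  show "c \<subseteq> vertices t" and c: "antichain c"
    using assms by (simp_all add: general_cuts_def)
  have "c \<noteq> {[]}" using assms by simp
  then show "[] \<notin> c" by (simp only: antichain_with_root[OF c] not_False_eq_True)
qed

lemma cut_eq_Union:
  assumes "c \<in> general_cuts (Node i ts) - {{[]}}"
  shows "(\<Union>x\<in>children ts. (#) x ` cut_restrict x c) = c"
proof (rule set_eqI)
  have c: "c \<subseteq> vertices (Node i ts)" "[] \<notin> c"
    by (rule proper_cutD[OF assms])+
  fix p
  show "p \<in> (\<Union>x\<in>children ts. (#) x ` cut_restrict x c) \<longleftrightarrow> p \<in> c"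
  proof (cases p)
    case Nil
    with c(2) show ?thesis by (simp add: image_iff)
  next
    case (Cons x q)
    have "x \<in> children ts" if "x # q \<in> c"
    proof -
      have "x # q \<in> vertices (Node i ts)" using c(1) that by (rule subsetD)
      then show ?thesis by simp
    qed
    then show ?thesis by (auto simp: Cons cut_restrict_def image_iff)
  qed
qed

text \<open>A cut that keeps the root is a free choice of one general cut in each child subtree:
  addresses that start with different children are incomparable, so the antichain condition can be
  checked in each subtree separately. A trace equal to \<open>{[]}\<close> means that the edge to
  that child is itself cut.\<close>

lemma bij_cuts_Node:
  "bij_betw (\<lambda>c. \<lambda>x\<in>children ts. cut_restrict x c) (general_cuts (Node i ts) - {{[]}})
    (PiE (children ts) (\<lambda>x. general_cuts (fst x)))"
proof (rule bij_betw_byWitness[where f' = "\<lambda>D. \<Union>x\<in>children ts. (#) x ` D x"])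
  show "\<forall>c\<in>general_cuts (Node i ts) - {{[]}}.
      (\<Union>x\<in>children ts. (#) x ` (\<lambda>x\<in>children ts. cut_restrict x c) x) = c"
  proof
    fix c assume c: "c \<in> general_cuts (Node i ts) - {{[]}}"
    have "(\<Union>x\<in>children ts. (#) x ` (\<lambda>x\<in>children ts. cut_restrict x c) x) =
        (\<Union>x\<in>children ts. (#) x ` cut_restrict x c)"
      by (rule SUP_cong) simp_all
    then show "(\<Union>x\<in>children ts. (#) x ` (\<lambda>x\<in>children ts. cut_restrict x c) x) = c"
      by (simp only: cut_eq_Union[OF c])
  qed
  show "\<forall>D\<in>PiE (children ts) (\<lambda>x. general_cuts (fst x)).
      (\<lambda>x\<in>children ts. cut_restrict x (\<Union>x\<in>children ts. (#) x ` D x)) = D"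
  proof (intro ballI ext)
    fix D x assume D: "D \<in> PiE (children ts) (\<lambda>x. general_cuts (fst x))"
    show "(\<lambda>x\<in>children ts. cut_restrict x (\<Union>x\<in>children ts. (#) x ` D x)) x = D x"
    proof (cases "x \<in> children ts")
      case True
      then show ?thesis by (auto simp: cut_restrict_def)
    next
      case False
      then show ?thesis using PiE_arb[OF D] by simp
    qed
  qed
  show "(\<lambda>c. \<lambda>x\<in>children ts. cut_restrict x c) ` (general_cuts (Node i ts) - {{[]}}) \<subseteq>
      PiE (children ts) (\<lambda>x. general_cuts (fst x))"
  proof (rule image_subsetI, rule restrict_PiE_iff[THEN iffD2], rule ballI)
    fix c x assume "c \<in> general_cuts (Node i ts) - {{[]}}" "x \<in> children ts"
    note c = proper_cutD(1,2)[OF this(1)]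
    have "p = q" if "x # p \<in> c" "x # q \<in> c" "prefix p q" for p q
    proof -
      have "prefix (x # p) (x # q)" using that by simp
      then have "x # p = x # q" using c(2) that(1,2) unfolding antichain_def by blast
      then show ?thesis by simp
    qed
    then show "cut_restrict x c \<in> general_cuts (fst x)"
      using c(1) unfolding general_cuts_def cut_restrict_def antichain_def
      by (simp add: subset_iff) (metis Cons_in_vertices)
  qed
  show "(\<lambda>D. \<Union>x\<in>children ts. (#) x ` D x) ` (PiE (children ts) (\<lambda>x. general_cuts (fst x))) \<subseteq>
      general_cuts (Node i ts) - {{[]}}"
  proof (rule image_subsetI)
    fix D assume "D \<in> PiE (children ts) (\<lambda>x. general_cuts (fst x))"
    then have D: "D x \<subseteq> vertices (fst x)" "antichain (D x)" if "x \<in> children ts" for x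
      using that by (auto simp: PiE_iff general_cuts_def)
    let ?c = "\<Union>x\<in>children ts. (#) x ` D x"
    have "?c \<subseteq> vertices (Node i ts)" unfolding vertices_Node using D(1) by blast
    moreover have "antichain ?c"
      unfolding antichain_def
    proof (intro ballI impI)
      fix p q assume pq: "p \<in> ?c" "q \<in> ?c" "prefix p q"
      then obtain x p' y q' where "x \<in> children ts" "p = x # p'" "p' \<in> D x" "q = y # q'" "q' \<in> D y"
        by blast
      then show "p = q" using pq(3) D(2)[of x] by (auto simp: antichain_def)
    qed
    moreover have "[] \<notin> ?c" by auto
    then have "?c \<noteq> {[]}" by auto
    ultimately show "?c \<in> general_cuts (Node i ts) - {{[]}}"
      by (simp add: general_cuts_def)
  qed
qed

lemma image_mset_sum: "image_mset f (sum g A) = (\<Sum>a\<in>A. image_mset f (g a))"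
  by (induction A rule: infinite_finite_induct) simp_all

lemma P_cut_Node:
  assumes c: "c \<in> general_cuts (Node i ts) - {{[]}}"
  shows "P_cut c (Node i ts) = (\<Sum>x\<in>children ts. P_cut (cut_restrict x c) (fst x))"
proof -
  have c': "c \<subseteq> vertices (Node i ts)" "[] \<notin> c"
    by (rule proper_cutD[OF c])+
  have fin: "finite c" using c'(1) finite_subset finite_vertices by blast
  have fin': "finite (cut_restrict x c)" for x
    unfolding cut_restrict_def
    using finite_vimageI[OF fin, of "(#) x"] by (simp add: vimage_def)
  have "mset_set (\<Union>x\<in>A. (#) x ` cut_restrict x c) =
      (\<Sum>x\<in>A. mset_set ((#) x ` cut_restrict x c))" if "finite A" for A
    using that
  proof (induction A rule: finite_induct)
    case (insert x A)
    have "(#) x ` cut_restrict x c \<inter> (\<Union>y\<in>A. (#) y ` cut_restrict y c) = {}"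
      using insert.hyps(2) by auto
    then show ?case
      using insert by (simp add: mset_set_Union fin')
  qed simp
  from this[OF finite_children, of ts]
  have "mset_set c = (\<Sum>x\<in>children ts. mset_set ((#) x ` cut_restrict x c))"
    unfolding cut_eq_Union[OF c] .
  then have "P_cut c (Node i ts) = (\<Sum>x\<in>children ts.
      image_mset (component_at c (Node i ts)) (mset_set ((#) x ` cut_restrict x c)))"
    unfolding P_cut_def by (simp add: image_mset_sum)
  also have "\<dots> = (\<Sum>x\<in>children ts. P_cut (cut_restrict x c) (fst x))"
  proof (rule sum.cong[OF refl])
    fix x
    have "component_at c (Node i ts) (x # q) = component_at (cut_restrict x c) (fst x) q" for q
      by (simp add: component_at_def subtree_at_def cut_restrict_def)
    then show "image_mset (component_at c (Node i ts)) (mset_set ((#) x ` cut_restrict x c)) =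
        P_cut (cut_restrict x c) (fst x)"
      unfolding P_cut_def
      by (simp add: image_mset_mset_set[symmetric] image_mset.compositionality comp_def)
  qed
  finally show ?thesis .
qed

text \<open>A child whose edge is cut contributes the empty forest, and every other child
  contributes its remaining root component.\<close>

lemma cut_remainder_Node:
  assumes c: "c \<in> general_cuts (Node i ts) - {{[]}}"
  shows "cut_remainder c (Node i ts) =
    {#Node i (\<Sum>x\<in>children ts. cut_remainder (cut_restrict x c) (fst x))#}"
proof -
  have "[] \<notin> c"
    by (rule proper_cutD[OF c])
  moreover have "image_mset f (mset_set {x \<in> A. P x}) = (\<Sum>x\<in>A. if P x then {#f x#} else {#})"
    if "finite A" for A P and f :: "_ \<Rightarrow> 'a rtree"
  proof -
    have "image_mset f (mset_set B) = (\<Sum>x\<in>B. {#f x#})" if "finite B" for B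
      using that by (induction B rule: finite_induct) auto
    then show ?thesis using that by (simp add: sum.inter_filter)
  qed
  from this[OF finite_children]
  have "image_mset (\<lambda>x. root_component {q. x # q \<in> c} (fst x))
      (mset_set {(s, k). k < count ts s \<and> [(s, k)] \<notin> c}) =
      (\<Sum>x\<in>children ts. if [x] \<notin> c then {#root_component {q. x # q \<in> c} (fst x)#} else {#})"
    by (simp add: children_def case_prod_unfold)
  ultimately show ?thesis
    by (auto simp: cut_remainder_def R_cut_eq cut_restrict_def intro!: sum.cong)
qed

lemma basis_prod: "(\<Prod>x\<in>A. basis (u x, v x)) = (basis (sum u A, sum v A) :: (_, 'k :: field) ckh2)"
proof (induction A rule: infinite_finite_induct)
  case (insert x A)
  then show ?case by (simp add: mult_single)
qed auto

text \<open>The cut above the root gives the first term. The remaining cuts correspond to families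
  of cuts of the child subtrees, so the sum over them is an expanded product of the coproducts of
  the children, with the right factors grafted on the root.\<close>

theorem coproduct_tree_Node:
  "coproduct_tree (Node i ts) =
    in_left (basis {#Node i ts#}) + graft_right i (\<Prod>t\<in>#ts. coproduct_tree t)"
  (is "_ = _ + graft_right i ?P")
proof -
  let ?C = "general_cuts (Node i ts) - {{[]}}"
  let ?g = "\<lambda>c t. basis (P_cut c t, cut_remainder c t)"
  have "{[]} \<in> general_cuts (Node i ts)" by (simp add: general_cuts_def)
  then have "coproduct_tree (Node i ts) = ?g {[]} (Node i ts) + (\<Sum>c\<in>?C. ?g c (Node i ts))"
    unfolding coproduct_tree_eq by (simp add: sum.remove)
  also have "?g {[]} (Node i ts) = in_left (basis {#Node i ts#})"
    by (simp add: P_cut_def component_at_def subtree_at_def cut_remainder_def root_component_id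
        del: root_component.simps)
  also have "(\<Sum>c\<in>?C. ?g c (Node i ts)) =
      (\<Sum>c\<in>?C. graft_right i (\<Prod>x\<in>children ts. ?g (cut_restrict x c) (fst x)))"
    by (intro sum.cong refl) (simp add: P_cut_Node cut_remainder_Node basis_prod)
  also have "\<dots> = graft_right i (\<Sum>c\<in>?C. \<Prod>x\<in>children ts. ?g (cut_restrict x c) (fst x))"
    unfolding graft_right_def by (simp only: pm_linear_sum[OF pm_linear_lin_extend])
  also have "(\<Sum>c\<in>?C. \<Prod>x\<in>children ts. ?g (cut_restrict x c) (fst x)) =
      (\<Sum>c\<in>?C. \<Prod>x\<in>children ts. ?g ((\<lambda>x\<in>children ts. cut_restrict x c) x) (fst x))"
    by (intro sum.cong prod.cong refl) simp
  also have "\<dots> = (\<Sum>D\<in>PiE (children ts) (\<lambda>x. general_cuts (fst x)).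
      \<Prod>x\<in>children ts. ?g (D x) (fst x))"
    by (rule sum.reindex_bij_betw[OF bij_cuts_Node])
  also have "\<dots> = (\<Prod>x\<in>children ts. \<Sum>d\<in>general_cuts (fst x). ?g d (fst x))"
    by (rule prod_sum_PiE[symmetric]) auto
  also have "\<dots> = ?P"
    unfolding coproduct_tree_eq[symmetric] by (rule prod_children)
  finally show ?thesis .
qed

section \<open>The antipode\<close>

lemma coproduct_eq_tree_extend: "coproduct = tree_extend coproduct_tree"
  by (rule ext) (simp add: coproduct_def tree_extend_def lin_extend_def)

lemma alg_hom_coproduct [simp]: "alg_hom coproduct"
  by (simp add: coproduct_eq_tree_extend)

lemma coproduct_basis: "coproduct (basis w) = (\<Prod>t\<in>#w. coproduct_tree t)"
  by (simp add: coproduct_eq_tree_extend tree_extend_basis)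

lemma pm_linear_coproduct [pm_linear_intros]:
  "pm_linear f \<Longrightarrow> pm_linear (\<lambda>x. coproduct (f x))"
  by (rule pm_linear_compose[OF alg_hom_linear[OF alg_hom_coproduct]])

theorem coproduct_graft:
  "coproduct (graft i x) = in_left (graft i x) + graft_right i (coproduct x)"
proof (rule pm_linear_eqI[of "\<lambda>x. coproduct (graft i x)"
      "\<lambda>x. in_left (graft i x) + graft_right i (coproduct x)"])
  show "coproduct (graft i (basis a)) =
      in_left (graft i (basis a)) + graft_right i (coproduct (basis a))" for a
    by (simp add: coproduct_basis coproduct_tree_Node)
qed (intro pm_linear_intros)+

text \<open>The antipode is determined by \<open>S (B\<^sub>i w) = - m ((id \<otimes> B\<^sub>i) ((S \<otimes> id) (\<Delta> w)))\<close>. To make this a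
  structural recursion, we compute \<open>(S \<otimes> id) (\<Delta> t)\<close> along with \<open>S t\<close>.\<close>

primrec antipode_left :: "'i rtree \<Rightarrow> ('i, 'k :: field) ckh2" where
  "antipode_left (Node i ts) =
    (let z = graft_right i (prod_mset (image_mset antipode_left ts))
     in z - in_left (multiply z))"

primrec antipode_tree :: "'i rtree \<Rightarrow> ('i, 'k :: field) ckh" where
  "antipode_tree (Node i ts) =
    - multiply (graft_right i (\<Prod>t\<in>#ts. antipode_left t))"

definition antipode :: "('i, 'k :: field) ckh \<Rightarrow> ('i, 'k) ckh" where
  "antipode = tree_extend antipode_tree"

lemma alg_hom_antipode [simp]: "alg_hom antipode"
  by (simp add: antipode_def)

lemma alg_hom_diff:
  assumes f: "alg_hom f"
  shows "f (x - y) = f x - f y"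
proof -
  have "f (x - y) + f y = f x"
    by (simp only: alg_hom_add[OF f, symmetric] diff_add_cancel)
  then show ?thesis by (simp only: eq_diff_eq)
qed

lemma in_left_uminus: "in_left (- x) = - in_left x"
  using alg_hom_diff[OF alg_hom_in_left, of 0 x] by (simp add: alg_hom_0[OF alg_hom_in_left])

lemma antipode_left_eq:
  "antipode_left (Node i ts) =
    in_left (antipode_tree (Node i ts)) + graft_right i (\<Prod>t\<in>#ts. antipode_left t)"
  by (simp add: Let_def in_left_uminus)

text \<open>This is S \<otimes> id. It commutes with id \<otimes> B_i, which identifies
  \<open>antipode_left\<close> with (S \<otimes> id) \<Delta> on trees.\<close>

definition antipode_id :: "('i, 'k :: field) ckh2 \<Rightarrow> ('i, 'k) ckh2" where
  "antipode_id = lin_extend (\<lambda>(u, v). in_left (antipode (basis u)) * in_right (basis v))"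

lemma pm_linear_antipode_id [pm_linear_intros]:
  "pm_linear f \<Longrightarrow> pm_linear (\<lambda>x. antipode_id (f x))"
  unfolding antipode_id_def by (auto intro!: pm_linear_intros)

lemma alg_hom_antipode_id [simp]: "alg_hom antipode_id"
  unfolding antipode_id_def
proof (rule alg_hom_lin_extend)
  show "(case 0 of (u, v) \<Rightarrow> in_left (antipode (basis u)) * in_right (basis v)) =
      (1 :: ('a, 'b) ckh2)"
    by (simp add: zero_prod_def alg_hom_1[OF alg_hom_antipode] alg_hom_1[OF alg_hom_in_left]
        alg_hom_1[OF alg_hom_in_right])
  fix a b
  show "(case a + b of (u, v) \<Rightarrow> in_left (antipode (basis u)) * in_right (basis v)) =
      (case a of (u, v) \<Rightarrow> in_left (antipode (basis u)) * in_right (basis v)) *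
      (case b of (u, v) \<Rightarrow> in_left (antipode (basis u)) * (in_right (basis v) :: ('a, 'b) ckh2))"
    by (cases a, cases b)
      (simp only: basis_add alg_hom_mult[OF alg_hom_antipode] alg_hom_mult[OF alg_hom_in_left]
        alg_hom_mult[OF alg_hom_in_right] ac_simps split_conv add_Pair)
qed

lemma pm_linear_antipode [pm_linear_intros]:
  "pm_linear f \<Longrightarrow> pm_linear (\<lambda>x. antipode (f x))"
  by (rule pm_linear_compose[OF alg_hom_linear[OF alg_hom_antipode]])

lemma antipode_id_in_left: "antipode_id (in_left x) = in_left (antipode x)"
  by (rule pm_linear_eqI[of "\<lambda>x. antipode_id (in_left x)" "\<lambda>x. in_left (antipode x)"])
    (auto intro!: pm_linear_intros simp: antipode_id_def alg_hom_1[OF alg_hom_in_right])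

lemma antipode_id_graft_right: "antipode_id (graft_right i z) = graft_right i (antipode_id z)"
proof (rule pm_linear_eqI[of "\<lambda>z. antipode_id (graft_right i z)" "\<lambda>z. graft_right i (antipode_id z)"])
  fix p
  show "antipode_id (graft_right i (basis p)) = graft_right i (antipode_id (basis p))"
    by (cases p) (simp add: antipode_id_def graft_right_in_left_mult del: in_right_basis,
      simp add: graft_right_in_right)
qed (auto intro!: pm_linear_intros)

lemma antipode_basis_tree: "antipode (basis {#t#}) = antipode_tree t"
  by (simp only: antipode_def tree_extend_tree)

lemma antipode_id_coproduct_tree:
  "antipode_id (coproduct_tree t) = (antipode_left t :: ('a, 'b :: field) ckh2)"
proof (induction t)
  case (Node i ts)
  have "antipode_id (\<Prod>t\<in>#ts. coproduct_tree t) =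
      (\<Prod>t\<in>#ts. antipode_left t :: ('a, 'b) ckh2)"
    unfolding alg_hom_prod_mset[OF alg_hom_antipode_id]
    by (intro arg_cong[of _ _ prod_mset] image_mset_cong Node)
  then show ?case
    unfolding coproduct_tree_Node antipode_left_eq alg_hom_add[OF alg_hom_antipode_id]
      antipode_id_in_left antipode_id_graft_right antipode_basis_tree
    by (simp only:)
qed

lemma mult_tensor_antipode_id: "mult_tensor antipode id z = multiply (antipode_id z)"
  unfolding mult_tensor_conv
proof (rule pm_linear_eqI[of _ "\<lambda>z. multiply (antipode_id z)"])
  fix p
  show "lin_extend (\<lambda>(u, v). antipode (basis u) * id (basis v)) (basis p) =
      multiply (antipode_id (basis p))"
    by (cases p) (simp add: antipode_id_def alg_hom_mult[OF alg_hom_multiply] del: in_right_basis)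
qed (auto intro!: pm_linear_intros)

text \<open>The correction term \<open>in_left (multiply z)\<close> in \<open>antipode_left\<close>
  is chosen for this: multiplying out gives \<open>multiply z\<close> twice with opposite
  signs.\<close>

lemma multiply_antipode_left: "multiply (antipode_left t) = 0"
  by (cases t) (simp add: Let_def alg_hom_diff[OF alg_hom_multiply])

text \<open>The counit, viewed as a map into the scalars of the algebra, is the algebra morphism
  that kills every tree.\<close>

lemma alg_hom_counit:
  "alg_hom (\<lambda>x :: ('i, 'k :: field) ckh. pm_scale (counit x) (1 :: ('i, 'k) ckh))"
proof -
  define e :: "('i, 'k) ckh \<Rightarrow> ('i, 'k) ckh" where "e = tree_extend (\<lambda>_. 0)"
  have "pm_scale (counit x) 1 = e x" for x
  proof (rule pm_linear_eqI[of "\<lambda>x. pm_scale (counit x) 1" e])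
    show "pm_linear (\<lambda>x :: ('i, 'k) ckh. pm_scale (counit x) (1 :: ('i, 'k) ckh))"
      by unfold_locales (simp_all add: counit_def lookup_add pm.scale_left_distrib)
    show "pm_linear e" by (simp add: e_def alg_hom_linear)
    show "pm_scale (counit (basis w)) 1 = e (basis w)" for w
      by (cases w) (simp_all add: counit_def e_def tree_extend_basis lookup_single
          alg_hom_1[OF alg_hom_tree_extend])
  qed
  then show ?thesis by (simp add: e_def)
qed

lemma counit_tree: "counit (basis {#t#}) = 0"
  by (simp add: counit_def lookup_single)

text \<open>Both sides are algebra morphisms, so it suffices to compare them on trees, where both
  vanish.\<close>

theorem antipode_left_inverse:
  "mult_tensor antipode id (coproduct x) = pm_scale (counit x) 1"
proof (rule alg_hom_eqI[of "\<lambda>x. mult_tensor antipode id (coproduct x)"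
      "\<lambda>x. pm_scale (counit x) 1"])
  show "alg_hom (\<lambda>x. mult_tensor antipode id (coproduct x))"
    unfolding mult_tensor_antipode_id
    by (intro alg_hom_compose[OF alg_hom_multiply] alg_hom_compose[OF alg_hom_antipode_id]
        alg_hom_coproduct)
  show "mult_tensor antipode id (coproduct (basis {#t#})) = pm_scale (counit (basis {#t#})) 1" for t
    unfolding counit_tree coproduct_basis mult_tensor_antipode_id
    by (simp add: antipode_id_coproduct_tree multiply_antipode_left)
qed (rule alg_hom_counit)

text \<open>In Sweedler notation, u \<otimes> v goes to the sum of u S(v_1) \<otimes> v_2, because
  \<open>antipode_left\<close> is (S \<otimes> id) \<Delta> on trees and everything is
  multiplicative.\<close>

definition id_antipode_left :: "('i, 'k :: field) ckh2 \<Rightarrow> ('i, 'k) ckh2" where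
  "id_antipode_left = lin_extend (\<lambda>(u, v). in_left (basis u) * (\<Prod>t\<in>#v. antipode_left t))"

lemma pm_linear_id_antipode_left [pm_linear_intros]:
  "pm_linear f \<Longrightarrow> pm_linear (\<lambda>x. id_antipode_left (f x))"
  unfolding id_antipode_left_def by (auto intro!: pm_linear_intros)

lemma alg_hom_id_antipode_left [simp]: "alg_hom id_antipode_left"
  unfolding id_antipode_left_def
proof (rule alg_hom_lin_extend)
  show "(case 0 of (u, v) \<Rightarrow> in_left (basis u) * (\<Prod>t\<in>#v. antipode_left t)) = (1 :: ('a, 'b) ckh2)"
    by (simp add: zero_prod_def alg_hom_1[OF alg_hom_in_left])
  fix a b
  show "(case a + b of (u, v) \<Rightarrow> in_left (basis u) * (\<Prod>t\<in>#v. antipode_left t)) =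
      (case a of (u, v) \<Rightarrow> in_left (basis u) * (\<Prod>t\<in>#v. antipode_left t)) *
      (case b of (u, v) \<Rightarrow> in_left (basis u) * (\<Prod>t\<in>#v. antipode_left t :: ('a, 'b) ckh2))"
    by (cases a, cases b)
      (simp only: basis_add alg_hom_mult[OF alg_hom_in_left] image_mset_union prod_mset.union
        ac_simps split_conv add_Pair)
qed

lemma alg_hom_id_antipode [simp]: "alg_hom (mult_tensor id antipode)"
  by (rule alg_hom_mult_tensor) (simp_all add: alg_hom_id id_def)

lemma pm_linear_id_antipode [pm_linear_intros]:
  "pm_linear f \<Longrightarrow> pm_linear (\<lambda>x. mult_tensor id antipode (f x))"
  by (rule pm_linear_compose[OF alg_hom_linear[OF alg_hom_id_antipode]])

lemma mult_tensor_in_left: "mult_tensor id antipode (in_left x) = x"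
  by (rule pm_linear_eqI[of "\<lambda>x. mult_tensor id antipode (in_left x)" "\<lambda>x. x"])
    (auto intro!: pm_linear_intros simp: mult_tensor_conv alg_hom_1[OF alg_hom_antipode])

lemma id_antipode_left_in_left: "id_antipode_left (in_left x) = in_left x"
  by (rule pm_linear_eqI[of "\<lambda>x. id_antipode_left (in_left x)" "\<lambda>x. in_left x"])
    (auto intro!: pm_linear_intros simp: id_antipode_left_def)

text \<open>The recursion for S on a grafted tree expresses u S(B_i v) as minus u times m (id
  \<otimes> B_i)(S \<otimes> id) \<Delta> v. The factor u moves inside because id \<otimes> B_i is
  linear over left factors.\<close>

lemma mult_tensor_graft_right:
  "mult_tensor id antipode (graft_right i z) = - multiply (graft_right i (id_antipode_left z))"
proof (rule pm_linear_eqI[of "\<lambda>z. mult_tensor id antipode (graft_right i z)"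
      "\<lambda>z. - multiply (graft_right i (id_antipode_left z))"])
  fix p :: "'a forest \<times> 'a forest"
  obtain u v where p: "p = (u, v)" by (cases p)
  have "mult_tensor id antipode (graft_right i (basis p)) =
      basis u * (antipode_tree (Node i v) :: ('a, 'b) ckh)"
    unfolding p graft_right_basis mult_tensor_conv lin_extend_basis split_conv antipode_basis_tree
    by (simp only: id_apply)
  also have "\<dots> = - multiply (in_left (basis u) * graft_right i (\<Prod>t\<in>#v. antipode_left t))"
    unfolding alg_hom_mult[OF alg_hom_multiply] multiply_in_left by simp
  also have "\<dots> = - multiply (graft_right i (id_antipode_left (basis p)))"
    unfolding graft_right_in_left_mult[symmetric] id_antipode_left_def p lin_extend_basis split_conv ..
  finally show "mult_tensor id antipode (graft_right i (basis p)) =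
      (- multiply (graft_right i (id_antipode_left (basis p))) :: ('a, 'b) ckh)" .
qed (intro pm_linear_intros)+

lemma id_antipode_left_graft_right:
  "id_antipode_left (graft_right i z) =
    in_left (mult_tensor id antipode (graft_right i z)) + graft_right i (id_antipode_left z)"
proof (rule pm_linear_eqI[of "\<lambda>z. id_antipode_left (graft_right i z)"
      "\<lambda>z. in_left (mult_tensor id antipode (graft_right i z)) + graft_right i (id_antipode_left z)"])
  fix p :: "'a forest \<times> 'a forest"
  obtain u v where p: "p = (u, v)" by (cases p)
  have "id_antipode_left (graft_right i (basis p)) =
      in_left (basis u) * (antipode_left (Node i v) :: ('a, 'b) ckh2)"
    unfolding p graft_right_basis id_antipode_left_def lin_extend_basis split_conv by simp
  also have "\<dots> = in_left (basis u * antipode_tree (Node i v)) +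
      graft_right i (in_left (basis u) * (\<Prod>t\<in>#v. antipode_left t))"
    unfolding antipode_left_eq distrib_left alg_hom_mult[OF alg_hom_in_left]
      graft_right_in_left_mult ..
  also have "basis u * antipode_tree (Node i v) =
      (mult_tensor id antipode (graft_right i (basis p)) :: ('a, 'b) ckh)"
    unfolding p graft_right_basis mult_tensor_conv lin_extend_basis split_conv antipode_basis_tree
    by (simp only: id_apply)
  also have "in_left (basis u) * (\<Prod>t\<in>#v. antipode_left t) = id_antipode_left (basis p)"
    unfolding p id_antipode_left_def lin_extend_basis split_conv ..
  finally show "id_antipode_left (graft_right i (basis p)) =
      in_left (mult_tensor id antipode (graft_right i (basis p))) +
      (graft_right i (id_antipode_left (basis p)) :: ('a, 'b) ckh2)" .
qed (intro pm_linear_intros)+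

text \<open>In Sweedler notation, the first conjunct reads \<open>\<Sum> t\<^sub>1 S(t\<^sub>2) \<otimes> t\<^sub>3 = 1 \<otimes> t\<close>. Carrying it through the
  induction makes coassociativity unnecessary.\<close>

lemma right_inverse_tree:
  "id_antipode_left (coproduct_tree t) = (in_right (basis {#t#}) :: ('i, 'k :: field) ckh2) \<and>
    mult_tensor id antipode (coproduct_tree t :: ('i, 'k) ckh2) = 0"
proof (induction t)
  case (Node i ts)
  let ?P = "\<Prod>t\<in>#ts. coproduct_tree t :: ('i, 'k) ckh2"
  have "id_antipode_left ?P = (\<Prod>t\<in>#ts. in_right (basis {#t#}))"
    unfolding alg_hom_prod_mset[OF alg_hom_id_antipode_left]
    by (intro arg_cong[of _ _ prod_mset] image_mset_cong) (simp only: Node)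
  also have "\<dots> = in_right (basis ts)"
    unfolding alg_hom_prod_mset[OF alg_hom_in_right, symmetric] basis_forest[symmetric] ..
  finally have P: "id_antipode_left ?P = in_right (basis ts)" .
  \<comment> \<open>By the induction hypothesis the Sweedler sum collapses, so the recursion yields
    minus the tree itself, which cancels the contribution of t \<otimes> 1.\<close>
  have "mult_tensor id antipode (graft_right i ?P) = - basis {#Node i ts#}"
    unfolding mult_tensor_graft_right P graft_right_in_right multiply_in_right graft_basis ..
  then have "mult_tensor id antipode (coproduct_tree (Node i ts) :: ('i, 'k) ckh2) = 0"
    "id_antipode_left (coproduct_tree (Node i ts)) = (in_right (basis {#Node i ts#}) :: ('i, 'k) ckh2)"
    unfolding coproduct_tree_Node alg_hom_add[OF alg_hom_id_antipode]
      alg_hom_add[OF alg_hom_id_antipode_left] mult_tensor_in_left id_antipode_left_in_left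
      id_antipode_left_graft_right P graft_right_in_right graft_basis
    by (simp_all only: in_left_uminus right_minus add.assoc[symmetric] add_0_left)
  then show ?case by blast
qed

theorem antipode_right_inverse:
  "mult_tensor id antipode (coproduct x) = pm_scale (counit x) 1"
proof (rule alg_hom_eqI[of "\<lambda>x. mult_tensor id antipode (coproduct x)"
      "\<lambda>x. pm_scale (counit x) 1"])
  show "alg_hom (\<lambda>x. mult_tensor id antipode (coproduct x))"
    by (rule alg_hom_compose[OF alg_hom_id_antipode alg_hom_coproduct])
  show "mult_tensor id antipode (coproduct (basis {#t#})) = pm_scale (counit (basis {#t#})) 1" for t
    unfolding counit_tree coproduct_basis by (simp add: right_inverse_tree)
qed (rule alg_hom_counit)

theorem is_antipode_antipode: "is_antipode antipode"
proof -
  interpret pm_linear antipode by (rule alg_hom_linear) simp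
  show ?thesis
    unfolding is_antipode_def
    using linear_axioms antipode_left_inverse antipode_right_inverse by blast
qed

unbundle fps_syntax

section \<open>Composition of power series over commutative rings\<close>

lemma fps_power_nth_0:
  assumes "c $ 0 = 0" "n < k"
  shows "(c ^ k :: 'a :: comm_ring_1 fps) $ n = 0"
  using startsby_zero_power_prefix[OF assms(1)] assms(2) by blast

text \<open>A common summation bound for all degrees up to \<open>N\<close> allows sums over
  coefficients to be interchanged.\<close>

lemma fps_compose_nth_ge:
  assumes "c $ 0 = 0" "n \<le> N"
  shows "(a oo c) $ n = (\<Sum>i\<le>N. a $ i * (c ^ i :: 'a :: comm_ring_1 fps) $ n)"
  unfolding fps_compose_nth
  by (rule sum.mono_neutral_left) (use assms in \<open>auto simp: fps_power_nth_0\<close>)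

lemma fps_compose_mult_comm:
  fixes a b c :: "'a :: comm_ring_1 fps"
  assumes c: "c $ 0 = 0"
  shows "(a * b) oo c = (a oo c) * (b oo c)"
proof (rule fps_ext)
  fix n
  have "((a oo c) * (b oo c)) $ n =
      (\<Sum>k=0..n. (\<Sum>i\<le>n. a $ i * c ^ i $ k) * (\<Sum>j\<le>n. b $ j * c ^ j $ (n - k)))"
    unfolding fps_mult_nth
    by (intro sum.cong refl arg_cong2[of _ _ _ _ "(*)"]) (simp_all add: fps_compose_nth_ge[OF c])
  also have "\<dots> = (\<Sum>k=0..n. \<Sum>(i, j)\<in>{..n} \<times> {..n}. a $ i * b $ j * (c ^ i $ k * c ^ j $ (n - k)))"
    by (simp add: sum_product sum.cartesian_product mult_ac)
  also have "\<dots> = (\<Sum>(i, j)\<in>{..n} \<times> {..n}. a $ i * b $ j * c ^ (i + j) $ n)"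
    by (subst sum.swap) (simp add: power_add fps_mult_nth sum_distrib_left case_prod_unfold)
  \<comment> \<open>Pairs with i + j > n drop out, because \<open>c ^ (i + j)\<close> has no terms
    below degree i + j.\<close>
  also have "\<dots> = (\<Sum>(i, j)\<in>{(i, j). i + j \<le> n}. a $ i * b $ j * c ^ (i + j) $ n)"
    by (rule sum.mono_neutral_right) (auto, metis fps_power_nth_0[OF c] mult_zero_right not_le)
  also have "\<dots> = (\<Sum>k\<le>n. \<Sum>i\<le>k. a $ i * b $ (k - i) * c ^ (i + (k - i)) $ n)"
    by (rule sum.triangle_reindex_eq)
  also have "\<dots> = ((a * b) oo c) $ n"
    unfolding fps_compose_nth fps_mult_nth
    by (simp add: sum_distrib_right atLeast0AtMost)
  finally show "((a * b) oo c) $ n = ((a oo c) * (b oo c)) $ n" ..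
qed

lemma fps_compose_prod_mset:
  fixes c :: "'a :: comm_ring_1 fps"
  assumes c: "c $ 0 = 0"
  shows "(\<Prod>x\<in>#A. f x) oo c = (\<Prod>x\<in>#A. f x oo c)"
  by (induction A) (simp_all add: fps_compose_mult_comm[OF c])

lemma fps_deriv_compose:
  fixes a c :: "'a :: comm_ring_1 fps"
  assumes c: "c $ 0 = 0"
  shows "fps_deriv (a oo c) = (fps_deriv a oo c) * fps_deriv c"
proof (rule fps_ext)
  fix n
  have "fps_deriv (a oo c) $ n = (\<Sum>i\<le>Suc n. a $ i * fps_deriv (c ^ i) $ n)"
    by (simp add: fps_compose_nth atLeast0AtMost sum_distrib_left mult_ac del: sum.atMost_Suc)
  also have "\<dots> = (\<Sum>i\<le>n. a $ Suc i * fps_deriv (c ^ Suc i) $ n)"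
    by (simp only: sum.atMost_Suc_shift power_0 fps_deriv_1 fps_zero_nth mult_zero_right add_0_left)
  also have "\<dots> = (\<Sum>i\<le>n. of_nat (Suc i) * a $ Suc i * (c ^ i * fps_deriv c) $ n)"
    by (intro sum.cong refl)
      (simp only: fps_deriv_power diff_Suc_1 mult.assoc fps_mult_left_const_nth,
        simp add: mult_ac del: of_nat_Suc)
  also have "\<dots> = (\<Sum>i\<le>n. \<Sum>k=0..n. fps_deriv a $ i * c ^ i $ k * fps_deriv c $ (n - k))"
    by (intro sum.cong refl) (simp add: fps_mult_nth sum_distrib_left mult.assoc)
  also have "\<dots> = (\<Sum>k=0..n. (fps_deriv a oo c) $ k * fps_deriv c $ (n - k))"
    by (subst sum.swap)
      (intro sum.cong refl, simp add: fps_compose_nth_ge[OF c, where N = n] sum_distrib_right)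
  finally show "fps_deriv (a oo c) $ n = ((fps_deriv a oo c) * fps_deriv c) $ n"
    by (simp only: fps_mult_nth)
qed

text \<open>As \<open>p\<close> has no constant term, coefficient \<open>m\<close> of the equation
  expresses \<open>of_nat (Suc m) * y $ Suc m\<close> by lower coefficients of \<open>y\<close>,
  which vanish by induction. The ring is arbitrary, so \<open>torsion_free\<close> stands in for
  division by integers.\<close>

lemma fps_linear_ode_zero:
  fixes p q y :: "'a :: comm_ring_1 fps"
  assumes torsion_free: "\<And>n z. of_nat (Suc n) * z = (0 :: 'a) \<Longrightarrow> z = 0"
    and p: "p $ 0 = 0" and y: "y $ 0 = 0" and ode: "(1 - p) * fps_deriv y = q * y"
  shows "y = 0"
proof (rule fps_ext)
  fix n
  show "y $ n = 0 $ n"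
  proof (induction n rule: less_induct)
    case (less n)
    show ?case
    proof (cases n)
      case 0
      then show ?thesis using y by simp
    next
      case (Suc m)
      have "fps_deriv y $ m = (p * fps_deriv y + q * y) $ m"
        using ode by (simp add: algebra_simps)
      also have "\<dots> = (\<Sum>i=0..m. p $ i * fps_deriv y $ (m - i)) + (\<Sum>i=0..m. q $ i * y $ (m - i))"
        by (simp only: fps_add_nth fps_mult_nth)
      also have "(\<Sum>i=0..m. p $ i * fps_deriv y $ (m - i)) = 0"
      proof (rule sum.neutral, rule ballI)
        fix i assume "i \<in> {0..m}"
        then show "p $ i * fps_deriv y $ (m - i) = 0"
          using p less.IH[of "Suc (m - i)"] Suc by (cases i) auto
      qed
      also have "(\<Sum>i=0..m. q $ i * y $ (m - i)) = 0"
        by (rule sum.neutral) (use less.IH Suc in auto)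
      finally have "of_nat (Suc m) * y $ Suc m = 0" by (simp only: fps_deriv_nth add_0_left Suc_eq_plus1)
      then show ?thesis using torsion_free Suc by simp
    qed
  qed
qed

section \<open>Coefficientwise application of ring morphisms\<close>

definition fps_map :: "('a \<Rightarrow> 'b) \<Rightarrow> 'a fps \<Rightarrow> 'b fps" where
  "fps_map f x = Abs_fps (\<lambda>n. f (x $ n))"

lemma fps_map_nth [simp]: "fps_map f x $ n = f (x $ n)"
  by (simp add: fps_map_def)

locale ring_map =
  fixes f :: "'a :: comm_ring_1 \<Rightarrow> 'b :: comm_ring_1"
  assumes add: "f (x + y) = f x + f y" and mult: "f (x * y) = f x * f y" and one: "f 1 = 1"
begin

lemma zero: "f 0 = 0"
  using add[of 0 0] by simp

lemma diff: "f (x - y) = f x - f y"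
  using add[of "x - y" y] by (simp add: algebra_simps)

lemma sum: "f (sum g A) = (\<Sum>a\<in>A. f (g a))"
  by (induction A rule: infinite_finite_induct) (simp_all add: zero add)

lemma of_nat: "f (of_nat n) = of_nat n"
  by (induction n) (simp_all add: zero one add)

lemma map_add: "fps_map f (x + y) = fps_map f x + fps_map f y"
  by (rule fps_ext) (simp add: add)

lemma map_diff: "fps_map f (x - y) = fps_map f x - fps_map f y"
  by (rule fps_ext) (simp add: diff)

lemma map_mult: "fps_map f (x * y) = fps_map f x * fps_map f y"
  by (rule fps_ext) (simp add: fps_mult_nth sum mult)

lemma map_one: "fps_map f 1 = 1"
  by (rule fps_ext) (simp add: one zero)

lemma map_prod_mset: "fps_map f (\<Prod>a\<in>#A. g a) = (\<Prod>a\<in>#A. fps_map f (g a))"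
  by (induction A) (simp_all add: map_mult map_one)

lemma map_deriv: "fps_map f (fps_deriv x) = fps_deriv (fps_map f x)"
  by (rule fps_ext) (simp add: mult add one of_nat)

lemma map_const: "fps_map f (fps_const c) = fps_const (f c)"
  by (rule fps_ext) (simp add: zero)

lemma map_X: "fps_map f fps_X = fps_X"
  by (rule fps_ext) (simp add: zero one fps_X_def)

end

lemma ring_map_alg_hom: "alg_hom f \<Longrightarrow> ring_map f"
  by unfold_locales (simp_all add: alg_hom_add alg_hom_mult alg_hom_1)

section \<open>Evaluation of power series over the ground field\<close>

abbreviation scalar :: "'k :: field \<Rightarrow> ('m :: comm_monoid_add \<Rightarrow>\<^sub>0 'k)" where
  "scalar \<equiv> Poly_Mapping.single 0"

interpretation scalar: ring_map scalar
  by unfold_locales (simp_all add: single_add mult_single)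

text \<open>A positive integer acts on coefficients as a nonzero scalar, by characteristic
  zero.\<close>

lemma poly_mapping_torsion_free:
  fixes z :: "'m :: comm_monoid_add \<Rightarrow>\<^sub>0 'k :: field_char_0"
  assumes "of_nat (Suc n) * z = 0"
  shows "z = 0"
proof (rule poly_mapping_eqI)
  fix m
  have "of_nat (Suc n) * z = pm_scale (of_nat (Suc n)) z"
    by (simp only: pm_scale_conv_mult single_of_nat)
  with assms have "Poly_Mapping.lookup (pm_scale (of_nat (Suc n)) z) m = 0"
    by (simp only: lookup_zero)
  then show "Poly_Mapping.lookup z m = Poly_Mapping.lookup 0 m"
    unfolding lookup_pm_scale by (simp del: of_nat_Suc)
qed

definition eval_fps_at ::
  "'k :: field fps \<Rightarrow> ('m :: comm_monoid_add \<Rightarrow>\<^sub>0 'k) fps \<Rightarrow> ('m \<Rightarrow>\<^sub>0 'k) fps" where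
  "eval_fps_at g x = fps_map scalar g oo x"

lemma eval_fps_at_nth_0: "eval_fps_at g x $ 0 = scalar (g $ 0)"
  by (simp add: eval_fps_at_def)

lemma eval_fps_at_const: "eval_fps_at (fps_const c) x = fps_const (scalar c)"
  by (simp add: eval_fps_at_def scalar.map_const)

lemma eval_fps_at_1: "eval_fps_at 1 x = 1"
  by (simp add: eval_fps_at_def scalar.map_one)

lemma eval_fps_at_X: "x $ 0 = 0 \<Longrightarrow> eval_fps_at fps_X x = x"
  by (simp add: eval_fps_at_def scalar.map_X)

lemma eval_fps_at_diff: "eval_fps_at (g - h) x = eval_fps_at g x - eval_fps_at h x"
  by (simp add: eval_fps_at_def scalar.map_diff fps_compose_sub_distrib)

lemma eval_fps_at_mult:
  "x $ 0 = 0 \<Longrightarrow> eval_fps_at (g * h) x = eval_fps_at g x * eval_fps_at h x"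
  by (simp add: eval_fps_at_def scalar.map_mult fps_compose_mult_comm)

lemma fps_deriv_eval_fps_at:
  "x $ 0 = 0 \<Longrightarrow> fps_deriv (eval_fps_at g x) = eval_fps_at (fps_deriv g) x * fps_deriv x"
  by (simp add: eval_fps_at_def scalar.map_deriv fps_deriv_compose)

text \<open>This is the recursion (k + 1) c_(k+1) = (\<mu> + k \<beta>) c_k between the
  coefficients. The equation covers (1 - \<beta> h)^(-\<mu>/\<beta>) and, for \<beta> = 0, exp(\<mu>
  h) at once, so later arguments need no case split.\<close>

lemma f_quot_ode:
  fixes \<beta> \<mu> :: "'k :: field_char_0"
  shows "(1 - fps_const \<beta> * fps_X) * fps_deriv (f_quot \<beta> \<mu>) = fps_const \<mu> * f_quot \<beta> \<mu>"
proof (rule fps_ext)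
  fix n
  have 1: "of_nat (Suc k) * f_quot \<beta> \<mu> $ Suc k = (\<mu> + of_nat k * \<beta>) * f_quot \<beta> \<mu> $ k" for k
    by (simp add: f_quot_def fact_Suc del: of_nat_Suc)
  have "((1 - fps_const \<beta> * fps_X) * fps_deriv (f_quot \<beta> \<mu>)) $ n =
      fps_deriv (f_quot \<beta> \<mu>) $ n - \<beta> * (fps_X * fps_deriv (f_quot \<beta> \<mu>)) $ n"
    by (simp only: left_diff_distrib mult_1 fps_sub_nth mult.assoc fps_mult_left_const_nth)
  also have "(fps_X * fps_deriv (f_quot \<beta> \<mu>)) $ n = of_nat n * f_quot \<beta> \<mu> $ n"
    by (cases n) simp_all
  also have "fps_deriv (f_quot \<beta> \<mu>) $ n = (\<mu> + of_nat n * \<beta>) * f_quot \<beta> \<mu> $ n"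
    using 1[of n] by simp
  finally show "((1 - fps_const \<beta> * fps_X) * fps_deriv (f_quot \<beta> \<mu>)) $ n =
      (fps_const \<mu> * f_quot \<beta> \<mu>) $ n"
    by (simp add: algebra_simps)
qed

text \<open>The derivative is the geometric series of a / (1 - \<beta> h).\<close>

lemma log_ser_ode:
  fixes a \<beta> :: "'k :: field_char_0"
  shows "(1 - fps_const \<beta> * fps_X) * fps_deriv (log_ser a \<beta>) = fps_const a"
proof (rule fps_ext)
  fix n
  have "((1 - fps_const \<beta> * fps_X) * fps_deriv (log_ser a \<beta>)) $ n =
      fps_deriv (log_ser a \<beta>) $ n - \<beta> * (fps_X * fps_deriv (log_ser a \<beta>)) $ n"
    by (simp only: left_diff_distrib mult_1 fps_sub_nth mult.assoc fps_mult_left_const_nth)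
  moreover have "fps_deriv (log_ser a \<beta>) $ k = a * \<beta> ^ k" for k
    by (simp add: log_ser_def del: of_nat_Suc)
  ultimately show "((1 - fps_const \<beta> * fps_X) * fps_deriv (log_ser a \<beta>)) $ n = fps_const a $ n"
    by (cases n) (simp_all del: fps_deriv_nth)
qed

lemma f_quot_nth_0 [simp]: "f_quot \<beta> \<mu> $ 0 = 1"
  by (simp add: f_quot_def)

lemma log_ser_nth_0 [simp]: "log_ser a \<beta> $ 0 = 0"
  by (simp add: log_ser_def)

text \<open>Both sides have constant term 1 and solve the same linear differential equation.\<close>

lemma f_quot_add: "f_quot \<beta> (\<mu> + \<mu>') = f_quot \<beta> \<mu> * f_quot \<beta> (\<mu>' :: 'k :: field_char_0)"
proof -
  let ?y = "f_quot \<beta> (\<mu> + \<mu>') - f_quot \<beta> \<mu> * f_quot \<beta> \<mu>'"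
  let ?d = "1 - fps_const \<beta> * fps_X"
  have "?y = 0"
  proof (rule fps_linear_ode_zero[where p = "fps_const \<beta> * fps_X" and q = "fps_const (\<mu> + \<mu>')"])
    have "?d * fps_deriv ?y = ?d * fps_deriv (f_quot \<beta> (\<mu> + \<mu>'))
        - (f_quot \<beta> \<mu> * (?d * fps_deriv (f_quot \<beta> \<mu>'))
          + (?d * fps_deriv (f_quot \<beta> \<mu>)) * f_quot \<beta> \<mu>')"
      by (simp add: algebra_simps)
    also have "\<dots> = (fps_const \<mu> + fps_const \<mu>') * ?y"
      unfolding f_quot_ode fps_const_add[symmetric] by (simp only: algebra_simps)
    finally show "?d * fps_deriv ?y = fps_const (\<mu> + \<mu>') * ?y" by simp
    show "z = 0" if "of_nat (Suc n) * z = 0" for n and z :: 'k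
      using that by (simp del: of_nat_Suc)
  qed simp_all
  then show ?thesis by simp
qed

text \<open>From degree 2 on, the factor with index 1 in the coefficient product is -\<beta> +
  \<beta> = 0, so only a linear polynomial remains.\<close>

lemma f_quot_neg: "f_quot \<beta> (- \<beta>) = 1 - fps_const \<beta> * (fps_X :: 'k :: field_char_0 fps)"
proof (rule fps_ext)
  fix n
  consider "n = 0" | "n = 1" | m where "n = Suc (Suc m)" by (metis One_nat_def nat.exhaust)
  then show "f_quot \<beta> (- \<beta>) $ n = (1 - fps_const \<beta> * fps_X) $ n"
  proof cases
    case (3 m)
    have "(\<Prod>i<n. - \<beta> + of_nat i * \<beta>) = 0"
      by (rule prod_zero) (use 3 in \<open>auto intro!: bexI[of _ 1]\<close>)
    then show ?thesis using 3 by (simp add: f_quot_def fps_X_def)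
  qed (simp_all add: f_quot_def)
qed

section \<open>The addition formulas\<close>

text \<open>With respect to the formal group law \<open>x + y - \<beta> x y\<close>, the series
  \<open>(1 - \<beta> h)\<^sup>-\<^sup>\<mu>\<^sup>/\<^sup>\<beta>\<close> are multiplicative and the logarithms are additive.\<close>

context
  fixes x y :: "('m :: comm_monoid_add \<Rightarrow>\<^sub>0 'k :: field_char_0) fps" and \<beta> :: 'k
  assumes x: "x $ 0 = 0" and y: "y $ 0 = 0"
begin

private abbreviation (input) "B \<equiv> fps_const (scalar \<beta>) :: ('m \<Rightarrow>\<^sub>0 'k) fps"
private abbreviation (input) "w \<equiv> x + (1 - B * x) * y"

lemma w_0: "w $ 0 = 0"
  using x y by simp

text \<open>This factorization is the reason for the choice of group law: it makes powers of 1 -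
  \<beta> h multiplicative and its logarithm additive.\<close>

lemma one_minus_w: "1 - B * w = (1 - B * x) * (1 - B * y)"
  by (simp add: algebra_simps)

lemma deriv_w: "fps_deriv w = fps_deriv x * (1 - B * y) + fps_deriv y * (1 - B * x)"
  by (simp add: algebra_simps)

lemma eval_ode:
  assumes ode: "(1 - fps_const \<beta> * fps_X) * fps_deriv g = fps_const \<mu> * h" and v: "v $ 0 = 0"
  shows "(1 - B * v) * fps_deriv (eval_fps_at g v) =
    fps_const (scalar \<mu>) * eval_fps_at h v * fps_deriv v"
proof -
  have "eval_fps_at ((1 - fps_const \<beta> * fps_X) * fps_deriv g) v = eval_fps_at (fps_const \<mu> * h) v"
    by (simp only: ode)
  then have "(1 - B * v) * eval_fps_at (fps_deriv g) v = fps_const (scalar \<mu>) * eval_fps_at h v"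
    by (simp only: eval_fps_at_mult[OF v] eval_fps_at_diff eval_fps_at_1 eval_fps_at_const
        eval_fps_at_X[OF v])
  then show ?thesis
    by (simp only: fps_deriv_eval_fps_at[OF v] mult.assoc[symmetric])
qed

text \<open>Both sides have constant term 1 and satisfy (1 - \<beta> w) z' = \<mu> w' z, with
  derivatives in the formal variable. For the product this follows from the factorization of 1 -
  \<beta> w and the product rule.\<close>

lemma eval_f_quot_add:
  "eval_fps_at (f_quot \<beta> \<mu>) w = eval_fps_at (f_quot \<beta> \<mu>) x * eval_fps_at (f_quot \<beta> \<mu>) y"
proof -
  let ?g = "eval_fps_at (f_quot \<beta> \<mu>)" and ?M = "fps_const (scalar \<mu>) :: ('m \<Rightarrow>\<^sub>0 'k) fps"
  let ?u = "?g w - ?g x * ?g y"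
  note ode = eval_ode[OF f_quot_ode]
  have "?u = 0"
  proof (rule fps_linear_ode_zero[where p = "B * w" and q = "?M * fps_deriv w"])
    have "(1 - B * w) * fps_deriv (?g x * ?g y) =
        (1 - B * x) * ?g x * ((1 - B * y) * fps_deriv (?g y))
        + (1 - B * y) * ?g y * ((1 - B * x) * fps_deriv (?g x))"
      unfolding one_minus_w fps_deriv_mult by (simp only: algebra_simps)
    also have "\<dots> = ?M * fps_deriv w * (?g x * ?g y)"
      unfolding ode[OF x] ode[OF y] deriv_w by (simp only: algebra_simps)
    finally have 1: "(1 - B * w) * fps_deriv (?g x * ?g y) = ?M * fps_deriv w * (?g x * ?g y)" .
    have "(1 - B * w) * fps_deriv ?u =
        (1 - B * w) * fps_deriv (?g w) - (1 - B * w) * fps_deriv (?g x * ?g y)"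
      unfolding fps_deriv_sub by (rule right_diff_distrib)
    also have "\<dots> = ?M * fps_deriv w * ?u"
      unfolding 1 ode[OF w_0] by (simp only: right_diff_distrib mult_ac)
    finally show "(1 - B * w) * fps_deriv ?u = ?M * fps_deriv w * ?u" .
    show "?u $ 0 = 0"
      by (simp add: eval_fps_at_nth_0)
    show "(B * w) $ 0 = 0"
      by (simp only: fps_mult_nth_0 w_0 mult_zero_right)
  qed (rule poly_mapping_torsion_free)
  then show ?thesis by simp
qed

text \<open>Both sides satisfy the same inhomogeneous equation (1 - \<beta> w) z' = a w', so their
  difference satisfies the homogeneous one with \<open>q = 0\<close>.\<close>

lemma eval_log_ser_add:
  "eval_fps_at (log_ser a \<beta>) w = eval_fps_at (log_ser a \<beta>) x + eval_fps_at (log_ser a \<beta>) y"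
proof -
  let ?g = "eval_fps_at (log_ser a \<beta>)" and ?M = "fps_const (scalar a) :: ('m \<Rightarrow>\<^sub>0 'k) fps"
  let ?u = "?g w - (?g x + ?g y)"
  have "(1 - fps_const \<beta> * fps_X) * fps_deriv (log_ser a \<beta>) = fps_const a * 1"
    by (simp only: log_ser_ode mult_1_right)
  note ode = eval_ode[OF this, unfolded eval_fps_at_1 mult_1_right]
  have "?u = 0"
  proof (rule fps_linear_ode_zero[where p = "B * w" and q = 0])
    have "(1 - B * w) * fps_deriv (?g x + ?g y) =
        (1 - B * x) * ((1 - B * y) * fps_deriv (?g y))
        + (1 - B * y) * ((1 - B * x) * fps_deriv (?g x))"
      unfolding one_minus_w fps_deriv_add by (simp only: algebra_simps)
    also have "\<dots> = ?M * fps_deriv w"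
      unfolding ode[OF x] ode[OF y] deriv_w by (simp only: algebra_simps)
    finally have 1: "(1 - B * w) * fps_deriv (?g x + ?g y) = ?M * fps_deriv w" .
    have "(1 - B * w) * fps_deriv ?u =
        (1 - B * w) * fps_deriv (?g w) - (1 - B * w) * fps_deriv (?g x + ?g y)"
      unfolding fps_deriv_sub by (rule right_diff_distrib)
    also have "\<dots> = 0"
      unfolding 1 ode[OF w_0] by (rule diff_self)
    finally show "(1 - B * w) * fps_deriv ?u = 0 * ?u" by (simp only: mult_zero_left)
    show "?u $ 0 = 0"
      by (simp add: eval_fps_at_nth_0)
    show "(B * w) $ 0 = 0"
      by (simp only: fps_mult_nth_0 w_0 mult_zero_right)
  qed (rule poly_mapping_torsion_free)
  then show ?thesis by simp
qed

end

section \<open>Evaluation of power series in several variables\<close>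

lemma finite_size_le: "finite {p :: 'v :: finite multiset. size p \<le> n}"
proof -
  have "{p :: 'v multiset. size p \<le> n} \<subseteq> mset ` {xs. set xs \<subseteq> UNIV \<and> length xs \<le> n}"
  proof
    fix p :: "'v multiset" assume p: "p \<in> {p. size p \<le> n}"
    obtain xs where "p = mset xs" by (metis ex_mset)
    then show "p \<in> mset ` {xs. set xs \<subseteq> UNIV \<and> length xs \<le> n}" using p by auto
  qed
  then show ?thesis
    by (rule finite_subset) (intro finite_imageI finite_lists_length_le finite_class.finite_UNIV)
qed

definition mps_eval ::
  "('v, 'k :: field) mps \<Rightarrow> ('v \<Rightarrow> ('m :: comm_monoid_add \<Rightarrow>\<^sub>0 'k) fps) \<Rightarrow> ('m \<Rightarrow>\<^sub>0 'k) fps" where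
  \<comment> \<open>meant for \<open>X j $ 0 = 0\<close>, when larger monomials do not contribute\<close>
  "mps_eval F X = Abs_fps (\<lambda>n. \<Sum>p | size p \<le> n. scalar (mcoeff F p) * (\<Prod>j\<in>#p. X j) $ n)"

lemma prod_mset_nth_less:
  fixes X :: "'v \<Rightarrow> 'a :: comm_ring_1 fps"
  assumes X: "\<And>j. X j $ 0 = 0" and n: "n < size p"
  shows "(\<Prod>j\<in>#p. X j) $ n = 0"
  using n
proof (induction p arbitrary: n)
  case (add j p)
  have "X j $ i * (\<Prod>j\<in>#p. X j) $ (n - i) = 0" if "i \<in> {0..n}" for i
    using that add.prems add.IH[of "n - i"] X[of j] by (cases i) auto
  then show ?case by (simp add: fps_mult_nth)
qed simp

lemma mps_eval_nth_ge:
  fixes X :: "'v :: finite \<Rightarrow> ('m :: comm_monoid_add \<Rightarrow>\<^sub>0 'k :: field) fps"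
  assumes X: "\<And>j. X j $ 0 = 0" and n: "n \<le> N"
  shows "mps_eval F X $ n = (\<Sum>p | size p \<le> N. scalar (mcoeff F p) * (\<Prod>j\<in>#p. X j) $ n)"
  unfolding mps_eval_def fps_nth_Abs_fps
proof (rule sum.mono_neutral_left[OF finite_size_le])
  show "\<forall>p\<in>{p. size p \<le> N} - {p. size p \<le> n}. scalar (mcoeff F p) * (\<Prod>j\<in>#p. X j) $ n = 0"
    by (auto simp: prod_mset_nth_less[OF X])
qed (use n in auto)

text \<open>Evaluation never looks at higher degrees of its arguments; this lets fixed-point
  equations determine their solution degree by degree.\<close>

lemma mps_eval_cong_nth:
  fixes X Y :: "'v \<Rightarrow> ('m :: comm_monoid_add \<Rightarrow>\<^sub>0 'k :: field) fps"
  assumes XY: "\<And>j k. k < N \<Longrightarrow> X j $ k = Y j $ k" and n: "n < N"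
  shows "mps_eval F X $ n = mps_eval F Y $ n"
proof -
  have "(\<Prod>j\<in>#p. X j) $ n = (\<Prod>j\<in>#p. Y j) $ n" if "n < N" for p n
    using that
    by (induction p arbitrary: n) (auto simp: fps_mult_nth XY intro!: sum.cong)
  then show ?thesis using n by (simp add: mps_eval_def)
qed

lemma mps_eval_add: "mps_eval (F + G) X = mps_eval F X + mps_eval G X"
  by (rule fps_ext) (simp add: mps_eval_def plus_mps_def single_add distrib_right sum.distrib)

lemma mps_eval_mult:
  fixes X :: "'v :: finite \<Rightarrow> ('m :: comm_monoid_add \<Rightarrow>\<^sub>0 'k :: field) fps"
  assumes X: "\<And>j. X j $ 0 = 0"
  shows "mps_eval (F * G) X = mps_eval F X * mps_eval G X"
proof (rule fps_ext)
  fix n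
  let ?P = "\<lambda>p. \<Prod>j\<in>#p. X j" and ?S = "{p :: 'v multiset. size p \<le> n}"
  let ?f = "\<lambda>p. scalar (mcoeff F p) :: 'm \<Rightarrow>\<^sub>0 'k" and ?g = "\<lambda>p. scalar (mcoeff G p) :: 'm \<Rightarrow>\<^sub>0 'k"
  have "(mps_eval F X * mps_eval G X) $ n =
      (\<Sum>k=0..n. (\<Sum>u\<in>?S. ?f u * ?P u $ k) * (\<Sum>v\<in>?S. ?g v * ?P v $ (n - k)))"
    unfolding fps_mult_nth
    by (intro sum.cong refl arg_cong2[of _ _ _ _ "(*)"]) (simp_all add: mps_eval_nth_ge[OF X])
  also have "\<dots> = (\<Sum>k=0..n. \<Sum>(u, v)\<in>?S \<times> ?S. ?f u * ?g v * (?P u $ k * ?P v $ (n - k)))"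
    by (simp add: sum_product sum.cartesian_product mult_ac)
  also have "\<dots> = (\<Sum>(u, v)\<in>?S \<times> ?S. ?f u * ?g v * ?P (u + v) $ n)"
    by (subst sum.swap) (simp add: fps_mult_nth sum_distrib_left case_prod_unfold)
  \<comment> \<open>Arguments without constant term leave only pairs of total size at most
    \<open>n\<close>. These are then regrouped by their sum \<open>m\<close>, as in the definition
    of the product of series.\<close>
  also have "\<dots> = (\<Sum>(u, v)\<in>{(u, v). size u + size v \<le> n}. ?f u * ?g v * ?P (u + v) $ n)"
  proof (rule sum.mono_neutral_right)
    show "\<forall>i\<in>?S \<times> ?S - {(u, v). size u + size v \<le> n}.
        (case i of (u, v) \<Rightarrow> ?f u * ?g v * ?P (u + v) $ n) = 0"
    proof
      fix i assume i: "i \<in> ?S \<times> ?S - {(u, v). size u + size v \<le> n}"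
      obtain u v where uv: "i = (u, v)" by (cases i)
      have "?P (u + v) $ n = 0"
        by (rule prod_mset_nth_less[OF X]) (use i uv in auto)
      then show "(case i of (u, v) \<Rightarrow> ?f u * ?g v * ?P (u + v) $ n) = 0"
        by (simp only: uv split_conv mult_zero_right)
    qed
  qed (auto simp: finite_size_le)
  also have "\<dots> = (\<Sum>(m, u)\<in>(SIGMA m:?S. {u. u \<subseteq># m}). ?f u * ?g (m - u) * ?P m $ n)"
    by (rule sum.reindex_bij_witness[where i = "\<lambda>(m, u). (u, m - u)" and j = "\<lambda>(u, v). (u + v, u)"])
      (auto simp: size_Diff_submset size_mset_mono)
  also have "\<dots> = (\<Sum>m\<in>?S. \<Sum>u | u \<subseteq># m. ?f u * ?g (m - u) * ?P m $ n)"
    by (rule sum.Sigma[symmetric]) (auto simp: finite_size_le finite_submsets)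
  also have "\<dots> = mps_eval (F * G) X $ n"
    by (simp add: mps_eval_def times_mps_def scalar.sum scalar.mult sum_distrib_right)
  finally show "mps_eval (F * G) X $ n = (mps_eval F X * mps_eval G X) $ n" ..
qed

lemma mps_eval_of_fps:
  fixes X :: "'v :: finite \<Rightarrow> ('m :: comm_monoid_add \<Rightarrow>\<^sub>0 'k :: field) fps"
  shows "mps_eval (mps_of_fps j g) X = eval_fps_at g (X j)"
proof (rule fps_ext)
  fix n
  let ?R = "\<lambda>k. replicate_mset k j"
  have "mps_eval (mps_of_fps j g) X $ n =
      (\<Sum>p\<in>?R ` {0..n}. scalar (mcoeff (mps_of_fps j g) p) * (\<Prod>j\<in>#p. X j) $ n)"
    unfolding mps_eval_def fps_nth_Abs_fps
  proof (rule sum.mono_neutral_right[OF finite_size_le])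
    show "\<forall>p\<in>{p. size p \<le> n} - ?R ` {0..n}.
        scalar (mcoeff (mps_of_fps j g) p) * (\<Prod>j\<in>#p. X j) $ n = 0"
    proof
      fix p assume p: "p \<in> {p. size p \<le> n} - ?R ` {0..n}"
      have "p \<noteq> ?R (size p)"
      proof
        assume "p = ?R (size p)"
        moreover have "size p \<in> {0..n}" using p by simp
        ultimately have "p \<in> ?R ` {0..n}" by (rule image_eqI)
        then show False using p by simp
      qed
      then show "scalar (mcoeff (mps_of_fps j g) p) * (\<Prod>j\<in>#p. X j) $ n = 0"
        by (simp add: mps_of_fps_def)
    qed
  qed auto
  also have "\<dots> = (\<Sum>k=0..n. scalar (g $ k) * X j ^ k $ n)"
    by (subst sum.reindex) (auto simp: inj_on_def mps_of_fps_def dest: arg_cong[of _ _ size])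
  finally show "mps_eval (mps_of_fps j g) X $ n = eval_fps_at g (X j) $ n"
    by (simp add: eval_fps_at_def fps_compose_nth)
qed

lemma mps_eval_const:
  fixes X :: "'v :: finite \<Rightarrow> ('m :: comm_monoid_add \<Rightarrow>\<^sub>0 'k :: field) fps"
  shows "mps_eval (mps_const c) X = fps_const (scalar c)"
proof -
  \<comment> \<open>A constant is a constant series in any one variable, so \<open>undefined\<close>
    can serve as that variable.\<close>
  have "mps_const c = (mps_of_fps undefined (fps_const c) :: ('v, 'k) mps)"
    by (rule mps_eqI) (auto simp: mps_const_def mps_of_fps_def)
  then show ?thesis by (simp only: mps_eval_of_fps eval_fps_at_const)
qed

lemma mps_eval_1:
  fixes X :: "'v :: finite \<Rightarrow> ('m :: comm_monoid_add \<Rightarrow>\<^sub>0 'k :: field) fps"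
  shows "mps_eval 1 X = 1"
proof -
  have "mps_const 1 = (1 :: ('v, 'k) mps)" by (simp add: one_mps_def mps_const_def)
  moreover have "mps_eval (mps_const 1) X = 1" by (simp add: mps_eval_const)
  ultimately show ?thesis by simp
qed

lemma mps_eval_0: "mps_eval 0 X = 0"
  by (rule fps_ext) (simp add: mps_eval_def zero_mps_def)

lemma mps_eval_var:
  fixes X :: "'v :: finite \<Rightarrow> ('m :: comm_monoid_add \<Rightarrow>\<^sub>0 'k :: field) fps"
  assumes "X j $ 0 = 0"
  shows "mps_eval (mps_var j) X = X j"
proof -
  have "mcoeff (mps_var j) m = mcoeff (mps_of_fps j fps_X :: ('v, 'k) mps) m" for m
  proof (cases "size m = 1")
    case True
    then obtain i where "m = {#i#}" using size_1_singleton_mset by blast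
    then show ?thesis by (simp add: mps_var_def mps_of_fps_def)
  next
    case False
    then have "m \<noteq> {#j#}" by auto
    then show ?thesis using False by (simp add: mps_var_def mps_of_fps_def fps_X_def)
  qed
  then have "mps_var j = (mps_of_fps j fps_X :: ('v, 'k) mps)" by (rule mps_eqI)
  then show ?thesis using assms by (simp add: mps_eval_of_fps eval_fps_at_X)
qed

lemma mps_eval_sum: "mps_eval (sum F A) X = (\<Sum>a\<in>A. mps_eval (F a) X)"
  by (induction A rule: infinite_finite_induct) (simp_all add: mps_eval_0 mps_eval_add)

lemma mps_eval_prod:
  fixes X :: "'v :: finite \<Rightarrow> ('m :: comm_monoid_add \<Rightarrow>\<^sub>0 'k :: field) fps"
  assumes X: "\<And>j. X j $ 0 = 0"
  shows "mps_eval (prod F A) X = (\<Prod>a\<in>A. mps_eval (F a) X)"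
  by (induction A rule: infinite_finite_induct) (simp_all add: mps_eval_1 mps_eval_mult[OF X])

lemma fps_map_mps_eval:
  assumes f: "alg_hom f"
  shows "fps_map f (mps_eval F X) = mps_eval F (\<lambda>j. fps_map f (X j))"
proof -
  interpret ring_map f by (rule ring_map_alg_hom[OF f])
  show ?thesis
    unfolding mps_eval_def
    by (rule fps_ext) (simp add: sum mult alg_hom_scalar[OF f] map_prod_mset[symmetric])
qed

lemma mps_eval_compose:
  fixes X :: "'v :: finite \<Rightarrow> ('m :: comm_monoid_add \<Rightarrow>\<^sub>0 'k :: field) fps"
  assumes X: "\<And>j. X j $ 0 = 0" and c: "c $ 0 = 0"
  shows "mps_eval F (\<lambda>j. X j oo c) = mps_eval F X oo c"
proof (rule fps_ext)
  fix n
  have "(mps_eval F X oo c) $ n =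
      (\<Sum>i=0..n. \<Sum>p | size p \<le> n. scalar (mcoeff F p) * ((\<Prod>j\<in>#p. X j) $ i * c ^ i $ n))"
    unfolding fps_compose_nth
    by (intro sum.cong refl) (simp add: mps_eval_nth_ge[OF X, where N = n] sum_distrib_right mult.assoc)
  also have "\<dots> = (\<Sum>p | size p \<le> n. scalar (mcoeff F p) * ((\<Prod>j\<in>#p. X j) oo c) $ n)"
    by (subst sum.swap) (simp add: fps_compose_nth sum_distrib_left)
  also have "\<dots> = mps_eval F (\<lambda>j. X j oo c) $ n"
    by (simp add: mps_eval_def fps_compose_prod_mset[OF c])
  finally show "mps_eval F (\<lambda>j. X j oo c) $ n = (mps_eval F X oo c) $ n" ..
qed

section \<open>Homogeneous components\<close>

lemma forest_weight_simps [simp]: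
  "forest_weight {#} = 0" "forest_weight (add_mset t w) = nvertices t + forest_weight w"
  "forest_weight (u + v) = forest_weight u + forest_weight v"
  by (simp_all add: forest_weight_def)

lemma nvertices_Node: "nvertices (Node i w) = Suc (forest_weight w)"
  by (simp add: forest_weight_def)

lemma lookup_homogeneous_component:
  "Poly_Mapping.lookup (homogeneous_component X n) w = (if forest_weight w = n then mcoeff X w else 0)"
  by (simp add: homogeneous_component_def lookup_sum lookup_single when_def finite_forest_weight)

lemma lookup_mult_forest:
  fixes x y :: "'t multiset \<Rightarrow>\<^sub>0 'k :: field"
  shows "Poly_Mapping.lookup (x * y) w =
    (\<Sum>u | u \<subseteq># w. Poly_Mapping.lookup x u * Poly_Mapping.lookup y (w - u))"
proof -
  have 1: "(\<Sum>q. Poly_Mapping.lookup y q when w = l + q) = (Poly_Mapping.lookup y (w - l) when l \<subseteq># w)" for l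
  proof (cases "l \<subseteq># w")
    case True
    then have "w = l + q \<longleftrightarrow> q = w - l" for q by (auto simp: subset_mset.add_diff_inverse)
    then show ?thesis using True by simp
  next
    case False
    then have "w \<noteq> l + q" for q by auto
    then show ?thesis using False by simp
  qed
  have "Poly_Mapping.lookup (x * y) w =
      (\<Sum>l. Poly_Mapping.lookup x l * (Poly_Mapping.lookup y (w - l) when l \<subseteq># w))"
    unfolding lookup_mult 1 ..
  also have "\<dots> = (\<Sum>l | l \<subseteq># w. Poly_Mapping.lookup x l * (Poly_Mapping.lookup y (w - l) when l \<subseteq># w))"
    by (rule Sum_any.expand_superset) (auto simp: finite_submsets)
  also have "\<dots> = (\<Sum>u | u \<subseteq># w. Poly_Mapping.lookup x u * Poly_Mapping.lookup y (w - u))"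
    by (intro sum.cong refl) simp
  finally show ?thesis .
qed

text \<open>The degree is recorded as the exponent of a formal variable. Elements of the completion
  become power series over the polynomial algebra, whose coefficients have finite support.\<close>

definition components :: "('i :: finite rtree, 'k :: field) mps \<Rightarrow> ('i, 'k) ckh fps" where
  "components X = Abs_fps (homogeneous_component X)"

lemma lookup_components:
  "Poly_Mapping.lookup (components X $ n) w = (if forest_weight w = n then mcoeff X w else 0)"
  by (simp add: components_def lookup_homogeneous_component)

lemma components_1: "components 1 = 1"
proof (intro fps_ext poly_mapping_eqI)
  fix n w
  show "Poly_Mapping.lookup (components 1 $ n) w = Poly_Mapping.lookup (1 $ n) w"
    by (auto simp: lookup_components one_mps_def lookup_one when_def)
qed

lemma components_mult:
  fixes X Y :: "('i :: finite rtree, 'k :: field) mps"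
  shows "components (X * Y) = components X * components Y"
proof (intro fps_ext poly_mapping_eqI)
  fix n and w :: "'i forest"
  have wt: "forest_weight w = forest_weight u + forest_weight (w - u)" if "u \<subseteq># w" for u
    using that by (metis forest_weight_simps(3) subset_mset.add_diff_inverse)
  have "Poly_Mapping.lookup ((components X * components Y) $ n) w =
      (\<Sum>u | u \<subseteq># w. \<Sum>k=0..n. Poly_Mapping.lookup (components X $ k) u *
        Poly_Mapping.lookup (components Y $ (n - k)) (w - u))"
    by (subst sum.swap) (simp add: fps_mult_nth lookup_sum lookup_mult_forest)
  also have "\<dots> = (\<Sum>u | u \<subseteq># w. if forest_weight w = n then mcoeff X u * mcoeff Y (w - u) else 0)"
  proof (rule sum.cong[OF refl])
    fix u assume "u \<in> {u. u \<subseteq># w}"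
    then have u: "forest_weight w = forest_weight u + forest_weight (w - u)" by (simp add: wt)
    \<comment> \<open>Weights are additive, so for fixed \<open>u\<close> only
      \<open>k = forest_weight u\<close> contributes.\<close>
    have "(\<Sum>k=0..n. Poly_Mapping.lookup (components X $ k) u *
        Poly_Mapping.lookup (components Y $ (n - k)) (w - u)) =
      (\<Sum>k=0..n. if k = forest_weight u then
        (if forest_weight w = n then mcoeff X u * mcoeff Y (w - u) else 0) else 0)"
      by (rule sum.cong) (auto simp: lookup_components u)
    also have "\<dots> = (if forest_weight w = n then mcoeff X u * mcoeff Y (w - u) else 0)"
      using u by (auto simp: sum.delta)
    finally show "(\<Sum>k=0..n. Poly_Mapping.lookup (components X $ k) u *
        Poly_Mapping.lookup (components Y $ (n - k)) (w - u)) =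
      (if forest_weight w = n then mcoeff X u * mcoeff Y (w - u) else 0)" .
  qed
  also have "\<dots> = Poly_Mapping.lookup (components (X * Y) $ n) w"
    by (simp add: lookup_components times_mps_def)
  finally show "Poly_Mapping.lookup (components (X * Y) $ n) w =
      Poly_Mapping.lookup ((components X * components Y) $ n) w" ..
qed

lemma components_prod_mset: "components (\<Prod>j\<in>#p. X j) = (\<Prod>j\<in>#p. components (X j))"
  by (induction p) (simp_all add: components_1 components_mult)

lemma components_nth_0:
  fixes X :: "('i :: finite rtree, 'k :: field) mps"
  assumes "mcoeff X {#} = 0"
  shows "components X $ 0 = 0"
proof (rule poly_mapping_eqI)
  fix w :: "'i forest"
  have "forest_weight w = 0 \<Longrightarrow> w = {#}"
    using size_le_forest_weight[of w] by simp
  then show "Poly_Mapping.lookup (components X $ 0) w = Poly_Mapping.lookup 0 w"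
    using assms by (auto simp: lookup_components)
qed

lemma components_subst:
  fixes X :: "'v :: finite \<Rightarrow> ('i :: finite rtree, 'k :: field) mps"
  assumes X: "\<And>j. mcoeff (X j) {#} = 0"
  shows "components (mps_subst F X) = mps_eval F (\<lambda>j. components (X j))"
proof (intro fps_ext poly_mapping_eqI)
  fix n w
  have X': "components (X j) $ 0 = 0" for j by (rule components_nth_0[OF X])
  have mono: "mcoeff (\<Prod>j\<in>#p. X j) w = Poly_Mapping.lookup ((\<Prod>j\<in>#p. components (X j)) $ forest_weight w) w" for p
    by (simp add: components_prod_mset[symmetric] lookup_components)
  have "Poly_Mapping.lookup (mps_eval F (\<lambda>j. components (X j)) $ n) w =
      (\<Sum>p | size p \<le> n. mcoeff F p * Poly_Mapping.lookup ((\<Prod>j\<in>#p. components (X j)) $ n) w)"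
    by (simp add: mps_eval_def lookup_sum pm_scale_conv_mult[symmetric])
  also have "\<dots> = (if forest_weight w = n then mcoeff (mps_subst F X) w else 0)"
  proof (cases "forest_weight w = n")
    case True
    \<comment> \<open>A product of \<open>size p\<close> factors without constant term has no terms
      below degree \<open>size p\<close>, so the sum in \<open>mps_subst\<close> is finite.\<close>
    have "{p. mcoeff F p * mcoeff (\<Prod>j\<in>#p. X j) w \<noteq> 0} \<subseteq> {p. size p \<le> n}"
    proof
      fix p assume "p \<in> {p. mcoeff F p * mcoeff (\<Prod>j\<in>#p. X j) w \<noteq> 0}"
      then have "(\<Prod>j\<in>#p. components (X j)) $ n \<noteq> 0" using mono True by auto
      then show "p \<in> {p. size p \<le> n}"
        using prod_mset_nth_less[of "\<lambda>j. components (X j)", OF X'] by (auto simp: not_le[symmetric])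
    qed
    then have "mcoeff (mps_subst F X) w = (\<Sum>p | size p \<le> n. mcoeff F p * mcoeff (\<Prod>j\<in>#p. X j) w)"
      by (simp add: mps_subst_def Sum_any.expand_superset[OF finite_size_le])
    then show ?thesis using True mono by simp
  next
    case False
    then show ?thesis by (simp add: components_prod_mset[symmetric] lookup_components)
  qed
  finally show "Poly_Mapping.lookup (components (mps_subst F X) $ n) w =
      Poly_Mapping.lookup (mps_eval F (\<lambda>j. components (X j)) $ n) w"
    by (simp add: lookup_components)
qed

lemma mcoeff_B_plus:
  "mcoeff (B_plus i X) w = (if \<exists>u. w = {#Node i u#} then mcoeff X (THE u. w = {#Node i u#}) else 0)"
proof (cases "\<exists>u. w = {#Node i u#}")
  case True
  then obtain u where u: "w = {#Node i u#}" by blast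
  then have "{#Node i v#} = w \<longleftrightarrow> v = u" for v by auto
  then show ?thesis using u by (simp add: B_plus_def)
next
  case False
  then have "{#Node i v#} \<noteq> w" for v by auto
  then show ?thesis using False by (simp add: B_plus_def)
qed

lemma mcoeff_B_plus_Node [simp]: "mcoeff (B_plus i X) {#Node i u#} = mcoeff X u"
  by (simp add: mcoeff_B_plus)

lemma lookup_graft:
  "Poly_Mapping.lookup (graft i x) w =
    (if \<exists>u. w = {#Node i u#} then Poly_Mapping.lookup x (THE u. w = {#Node i u#}) else 0)"
proof -
  have "Poly_Mapping.lookup (graft i x) w =
      (\<Sum>a\<in>Poly_Mapping.keys x. if {#Node i a#} = w then Poly_Mapping.lookup x a else 0)"
    by (simp add: graft_def lin_extend_def lookup_sum lookup_single when_def if_distrib cong: if_cong)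
  also have "\<dots> = (if \<exists>u. w = {#Node i u#} then Poly_Mapping.lookup x (THE u. w = {#Node i u#}) else 0)"
  proof (cases "\<exists>u. w = {#Node i u#}")
    case True
    then obtain u where u: "w = {#Node i u#}" by blast
    then show ?thesis by (simp add: in_keys_iff)
  next
    case False
    then have "{#Node i a#} \<noteq> w" for a by auto
    then show ?thesis using False by simp
  qed
  finally show ?thesis .
qed

text \<open>Grafting adds one vertex, hence the factor \<open>fps_X\<close>.\<close>

lemma components_B_plus: "components (B_plus i X) = fps_X * fps_map (graft i) (components X)"
proof (intro fps_ext poly_mapping_eqI)
  fix n w
  show "Poly_Mapping.lookup (components (B_plus i X) $ n) w =
      Poly_Mapping.lookup ((fps_X * fps_map (graft i) (components X)) $ n) w"
  proof (cases "\<exists>u. w = {#Node i u#}")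
    case True
    then obtain u where u: "w = {#Node i u#}" by blast
    show ?thesis
      by (cases n) (simp_all add: lookup_components lookup_graft u nvertices_Node del: nvertices.simps)
  next
    case False
    then show ?thesis
      by (cases n) (simp_all add: lookup_components lookup_graft mcoeff_B_plus)
  qed
qed

section \<open>The solution of a system\<close>

text \<open>Closeness in the topology of the completion.\<close>

definition agree_below :: "nat \<Rightarrow> ('i \<Rightarrow> ('j rtree, 'k :: field) mps) \<Rightarrow> ('i \<Rightarrow> ('j rtree, 'k) mps) \<Rightarrow> bool" where
  "agree_below n X Y \<longleftrightarrow> (\<forall>i w. forest_weight w < n \<longrightarrow> mcoeff (X i) w = mcoeff (Y i) w)"

definition SDSE_step :: "('i \<Rightarrow> ('i, 'k :: field) mps) \<Rightarrow> ('i \<Rightarrow> ('i rtree, 'k) mps) \<Rightarrow> ('i \<Rightarrow> ('i rtree, 'k) mps)" where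
  "SDSE_step F X i = B_plus i (mps_subst (F i) X)"

lemma forest_weight_mono: "u \<subseteq># w \<Longrightarrow> forest_weight u \<le> forest_weight w"
  by (metis forest_weight_simps(3) le_add1 subset_mset.add_diff_inverse)

lemma agree_below_prod:
  assumes XY: "agree_below n X Y" and w: "forest_weight w < n"
  shows "mcoeff (\<Prod>j\<in>#p. X j) w = mcoeff (\<Prod>j\<in>#p. Y j) w"
  using w
proof (induction p arbitrary: w)
  case (add j p)
  have "mcoeff (X j) u * mcoeff (\<Prod>j\<in>#p. X j) (w - u) = mcoeff (Y j) u * mcoeff (\<Prod>j\<in>#p. Y j) (w - u)"
    if "u \<subseteq># w" for u
  proof -
    have "forest_weight u < n" "forest_weight (w - u) < n"
      using forest_weight_mono[OF that] forest_weight_mono[of "w - u" w] add.prems by auto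
    then show ?thesis using add.IH XY by (simp add: agree_below_def)
  qed
  then show ?case by (simp add: times_mps_def)
qed simp

text \<open>Substitution preserves agreement and the new root raises the degree by one, so the
  system acts as a contraction.\<close>

lemma agree_below_step:
  assumes "agree_below n X Y"
  shows "agree_below (Suc n) (SDSE_step F X) (SDSE_step F Y)"
  unfolding agree_below_def
proof (intro allI impI)
  fix i and w :: "'a forest" assume w: "forest_weight w < Suc n"
  show "mcoeff (SDSE_step F X i) w = mcoeff (SDSE_step F Y i) w"
  proof (cases "\<exists>u. w = {#Node i u#}")
    case True
    then obtain u where u: "w = {#Node i u#}" by blast
    have "forest_weight u < n" using w by (simp add: u nvertices_Node del: nvertices.simps)
    then show ?thesis
      by (simp add: SDSE_step_def u mps_subst_def agree_below_prod[OF assms])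
  next
    case False
    then show ?thesis by (simp add: SDSE_step_def mcoeff_B_plus)
  qed
qed

lemma agree_below_trans: "agree_below n X Y \<Longrightarrow> agree_below n Y Z \<Longrightarrow> agree_below n X Z"
  by (simp add: agree_below_def)

lemma agree_below_le: "agree_below n X Y \<Longrightarrow> m \<le> n \<Longrightarrow> agree_below m X Y"
  by (auto simp: agree_below_def)

lemma ex1_SDSE_solution:
  fixes F :: "'i \<Rightarrow> ('i, 'k :: field) mps"
  shows "\<exists>!X. is_SDSE_solution F X"
proof (rule ex_ex1I)
  \<comment> \<open>Successive approximations, starting from 0.\<close>
  define It where "It k = (SDSE_step F ^^ k) (\<lambda>_. 0)" for k
  have It_Suc: "It (Suc k) = SDSE_step F (It k)" for k by (simp add: It_def)
  have It_step: "agree_below k (It k) (It (Suc k))" for k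
  proof (induction k)
    case (Suc k)
    then show ?case using agree_below_step[of k "It k" "It (Suc k)" F] by (simp only: It_Suc)
  qed (simp add: agree_below_def)
  have It_le: "agree_below k (It k) (It m)" if "k \<le> m" for k m
    using that
  proof (induction m rule: dec_induct)
    case (step m)
    then show ?case using agree_below_trans agree_below_le[OF It_step] by (metis less_imp_le)
  qed (simp add: agree_below_def)
  \<comment> \<open>The coefficient of \<open>w\<close> is stable from iteration
    \<open>Suc (forest_weight w)\<close> on, so the limit is read off there.\<close>
  define X where "X i = Abs_mps (\<lambda>w. mcoeff (It (Suc (forest_weight w)) i) w)" for i
  have X_It: "agree_below k X (It k)" for k
    unfolding agree_below_def
  proof (intro allI impI)
    fix i and w :: "'i forest" assume "forest_weight w < k"
    then show "mcoeff (X i) w = mcoeff (It k i) w"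
      using It_le[of "Suc (forest_weight w)" k] by (simp add: X_def agree_below_def)
  qed
  have "X i = SDSE_step F X i" for i
  proof (rule mps_eqI)
    fix w :: "'i forest"
    have "agree_below (Suc (Suc (forest_weight w))) X (It (Suc (Suc (forest_weight w))))"
      by (rule X_It)
    moreover have "agree_below (Suc (Suc (forest_weight w))) (SDSE_step F X) (It (Suc (Suc (forest_weight w))))"
      unfolding It_Suc[of "Suc (forest_weight w)"] by (rule agree_below_step[OF X_It])
    ultimately show "mcoeff (X i) w = mcoeff (SDSE_step F X i) w"
      by (simp add: agree_below_def)
  qed
  then show "\<exists>X. is_SDSE_solution F X"
    unfolding is_SDSE_solution_def SDSE_step_def by blast
next
  fix X Y assume "is_SDSE_solution F X" "is_SDSE_solution F Y"
  then have XY: "SDSE_step F X = X" "SDSE_step F Y = Y"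
    by (simp_all add: is_SDSE_solution_def SDSE_step_def fun_eq_iff)
  have "agree_below n X Y" for n
  proof (induction n)
    case (Suc n)
    then show ?case using agree_below_step[of n X Y F] by (simp only: XY)
  qed (simp add: agree_below_def)
  then show "X = Y"
    by (intro ext mps_eqI) (auto simp: agree_below_def)
qed

lemma SDSE_solution_eq: "SDSE_solution F i = B_plus i (mps_subst (F i) (SDSE_solution F))"
  using theI'[OF ex1_SDSE_solution[of F]] unfolding SDSE_solution_def is_SDSE_solution_def by blast

lemma SDSE_solution_no_const: "mcoeff (SDSE_solution F i) {#} = 0"
  by (subst SDSE_solution_eq) (simp add: mcoeff_B_plus)

definition SDSE_fps :: "('i :: finite \<Rightarrow> ('i, 'k :: field) mps) \<Rightarrow> 'i \<Rightarrow> ('i, 'k) ckh fps" where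
  "SDSE_fps F i = components (SDSE_solution F i)"

lemma SDSE_fps_nth_0: "SDSE_fps F i $ 0 = 0"
  by (simp add: SDSE_fps_def components_nth_0 SDSE_solution_no_const)

lemma SDSE_fps_eq: "SDSE_fps F i = fps_X * fps_map (graft i) (mps_eval (F i) (SDSE_fps F))"
proof -
  have "SDSE_fps F i = components (B_plus i (mps_subst (F i) (SDSE_solution F)))"
    unfolding SDSE_fps_def by (subst SDSE_solution_eq) (rule refl)
  also have "\<dots> = fps_X * fps_map (graft i) (mps_eval (F i) (SDSE_fps F))"
    unfolding components_B_plus components_subst[of "SDSE_solution F", OF SDSE_solution_no_const]
      SDSE_fps_def[symmetric] ..
  finally show ?thesis .
qed

section \<open>A criterion for Hopf systems\<close>

interpretation in_left: ring_map in_left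
  by (rule ring_map_alg_hom[OF alg_hom_in_left])

interpretation in_right: ring_map in_right
  by (rule ring_map_alg_hom[OF alg_hom_in_right])

lemma pm_linear_diff: "pm_linear f \<Longrightarrow> f (x - y) = f x - f y"
  and pm_linear_0: "pm_linear f \<Longrightarrow> f 0 = 0"
proof -
  assume "pm_linear f"
  then interpret pm_linear f .
  show "f (x - y) = f x - f y" "f 0 = 0" by (rule diff, rule zero)
qed

lemma fps_map_pm_linear_add:
  assumes "pm_linear f"
  shows "fps_map f (x + y) = fps_map f x + fps_map f y"
  by (rule fps_ext) (simp add: pm_linear.add[OF assms])

lemma fps_map_graft_right_in_left_mult:
  "fps_map (graft_right i) (fps_map in_left x * y) = fps_map in_left x * fps_map (graft_right i) y"
  by (rule fps_ext)
    (simp add: fps_mult_nth pm_linear_sum[OF pm_linear_graft_right[OF pm_linear_id]]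
      graft_right_in_left_mult)

lemma fps_map_in_left_power: "fps_map in_left x ^ k = fps_map in_left (x ^ k)"
  by (induction k) (simp_all add: in_left.map_one in_left.map_mult)

text \<open>id \<otimes> B_i acts on right factors while the substituted series has only left ones,
  so the two operations commute.\<close>

lemma fps_map_graft_right_compose:
  fixes x y :: "('i, 'k :: field) ckh fps"
  shows "fps_map (graft_right i) (fps_map in_right x oo fps_map in_left y) =
    fps_map in_right (fps_map (graft i) x) oo fps_map in_left y"
proof (rule fps_ext)
  fix n
  have "graft_right i (in_right a * in_left b) = in_right (graft i a) * in_left b"
    for a b :: "('i, 'k) ckh"
    using graft_right_in_left_mult[of i b "in_right a"] by (simp add: graft_right_in_right mult.commute)
  then show "fps_map (graft_right i) (fps_map in_right x oo fps_map in_left y) $ n =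
      (fps_map in_right (fps_map (graft i) x) oo fps_map in_left y) $ n"
    by (simp add: fps_compose_nth fps_map_in_left_power
        pm_linear_sum[OF pm_linear_graft_right[OF pm_linear_id]])
qed

text \<open>Substituting a series of left factors places \<open>y ^ k\<close> next to coefficient
  \<open>k\<close> of \<open>v\<close>. This turns a composition into the sum of tensors required of
  the coproduct.\<close>

lemma left_mult_compose_nth:
  assumes y: "y $ 0 = 0"
  shows "(fps_map in_left e * (fps_map in_right v oo fps_map in_left y)) $ n =
    (\<Sum>k\<le>n. tensor ((e * y ^ k) $ n) (v $ k))"
proof -
  have "(fps_map in_left e * (fps_map in_right v oo fps_map in_left y)) $ n =
      (\<Sum>j=0..n. \<Sum>k\<le>n. in_left (e $ j) * (in_right (v $ k) * in_left (y ^ k $ (n - j))))"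
    unfolding fps_mult_nth
    by (intro sum.cong refl)
      (simp add: fps_compose_nth_ge[where N = n] y in_left.zero fps_map_in_left_power sum_distrib_left)
  also have "\<dots> = (\<Sum>k\<le>n. tensor ((e * y ^ k) $ n) (v $ k))"
    by (subst sum.swap)
      (simp add: fps_mult_nth tensor_conv in_left.sum in_left.mult sum_distrib_left sum_distrib_right
        mult_ac)
  finally show ?thesis .
qed

text \<open>The cocycle identity is applied to \<open>SDSE_fps_eq\<close>, and multiplicativity
  moves the coproduct inside the series \<open>F i\<close>.\<close>

lemma fps_map_coproduct_SDSE:
  fixes F :: "'i :: finite \<Rightarrow> ('i, 'k :: field) mps"
  shows "fps_map coproduct (SDSE_fps F i) = fps_map in_left (SDSE_fps F i) +
    fps_X * fps_map (graft_right i) (mps_eval (F i) (\<lambda>j. fps_map coproduct (SDSE_fps F j)))"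
proof -
  let ?M = "mps_eval (F i) (SDSE_fps F)"
  have "fps_map coproduct (fps_map (graft i) ?M) =
      fps_map in_left (fps_map (graft i) ?M) + fps_map (graft_right i) (fps_map coproduct ?M)"
    by (rule fps_ext) (simp add: coproduct_graft)
  moreover have "fps_map f (fps_X * x) = fps_X * fps_map f x" if "alg_hom f"
    for f :: "('i, 'k) ckh \<Rightarrow> ('i, 'k) ckh2" and x
  proof -
    interpret ring_map f by (rule ring_map_alg_hom[OF that])
    show ?thesis by (simp add: map_mult map_X)
  qed
  ultimately have "fps_map coproduct (fps_X * fps_map (graft i) ?M) =
      fps_map in_left (fps_X * fps_map (graft i) ?M) +
      fps_X * fps_map (graft_right i) (fps_map coproduct ?M)"
    by (simp add: distrib_left)
  then show ?thesis
    unfolding SDSE_fps_eq[symmetric] fps_map_mps_eval[OF alg_hom_coproduct] .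
qed

text \<open>The factor \<open>fps_X\<close> makes each coefficient of the right-hand side depend
  only on strictly lower coefficients of \<open>Y\<close>.\<close>

lemma SDSE_equation_unique:
  fixes Y Y' :: "'i \<Rightarrow> ('m :: comm_monoid_add \<Rightarrow>\<^sub>0 'k :: field) fps"
  assumes Y: "\<And>i. Y i = A i + fps_X * fps_map (f i) (mps_eval (F i) Y)"
    and Y': "\<And>i. Y' i = A i + fps_X * fps_map (f i) (mps_eval (F i) Y')"
  shows "Y i = Y' i"
proof -
  have "\<forall>k<n. \<forall>j. Y j $ k = Y' j $ k" for n
  proof (induction n)
    case (Suc n)
    have "Y j $ n = Y' j $ n" for j
    proof (cases n)
      case 0
      then show ?thesis by (subst Y, subst Y') simp
    next
      case (Suc m)
      have "mps_eval (F j) Y $ m = mps_eval (F j) Y' $ m"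
        by (rule mps_eval_cong_nth[where N = n]) (use Suc.IH Suc in auto)
      then show ?thesis by (subst Y, subst Y') (simp add: Suc)
    qed
    then show ?case using Suc by (auto simp: less_Suc_eq)
  qed simp
  then show ?thesis by (intro fps_ext) blast
qed

section \<open>Reduction of the Hopf conditions to generators\<close>

lemma is_subalgebra_hull: "is_subalgebra (is_subalgebra hull S :: ('i, 'k :: field) ckh set)"
proof (rule hull_in)
  fix T :: "('i, 'k) ckh set set" assume T: "\<forall>t\<in>T. is_subalgebra t"
  then show "is_subalgebra (\<Inter> T)"
    by (auto simp: is_subalgebra_def pm.subspace_def)
qed

lemma is_subalgebra_SDSE_algebra: "is_subalgebra (SDSE_algebra F)"
  unfolding SDSE_algebra_def by (rule is_subalgebra_hull)

lemma SDSE_fps_mem: "SDSE_fps F i $ n \<in> SDSE_algebra F"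
  unfolding SDSE_algebra_def SDSE_fps_def components_def fps_nth_Abs_fps
  by (rule hull_inc) blast

lemma SDSE_algebra_least:
  assumes "is_subalgebra B" "\<And>i n. SDSE_fps F i $ n \<in> B"
  shows "SDSE_algebra F \<subseteq> B"
  unfolding SDSE_algebra_def
  by (rule hull_minimal) (use assms in \<open>auto simp: SDSE_fps_def components_def\<close>)

context
  fixes A :: "('i, 'k :: field) ckh set"
  assumes A: "is_subalgebra A"
begin

lemma subalgebra_closed:
  "0 \<in> A" "1 \<in> A" "x \<in> A \<Longrightarrow> y \<in> A \<Longrightarrow> x + y \<in> A" "x \<in> A \<Longrightarrow> y \<in> A \<Longrightarrow> x * y \<in> A"
  "x \<in> A \<Longrightarrow> pm_scale c x \<in> A"
  using A by (auto simp: is_subalgebra_def pm.subspace_def)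

lemma subalgebra_diff: "x \<in> A \<Longrightarrow> y \<in> A \<Longrightarrow> x - y \<in> A"
  using A by (auto simp: is_subalgebra_def intro: pm.subspace_diff)

lemma subalgebra_sum: "(\<And>a. a \<in> S \<Longrightarrow> g a \<in> A) \<Longrightarrow> sum g S \<in> A"
  using A by (auto simp: is_subalgebra_def intro: pm.subspace_sum)

lemma subalgebra_fps_mult:
  "(\<And>n. x $ n \<in> A) \<Longrightarrow> (\<And>n. y $ n \<in> A) \<Longrightarrow> (x * y) $ n \<in> A"
  unfolding fps_mult_nth by (intro subalgebra_sum subalgebra_closed(4))

lemma subalgebra_fps_power: "(\<And>n. x $ n \<in> A) \<Longrightarrow> (x ^ k) $ n \<in> A"
proof (induction k arbitrary: n)
  case 0
  then show ?case by (simp add: subalgebra_closed)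
next
  case (Suc k)
  then show ?case using subalgebra_fps_mult[of x "x ^ k" n] by simp
qed

lemma subalgebra_mps_eval:
  assumes X: "\<And>j n. X j $ n \<in> A"
  shows "mps_eval F X $ n \<in> A"
proof -
  have "(\<Prod>j\<in>#p. X j) $ n \<in> A" for p n
  proof (induction p arbitrary: n)
    case empty
    then show ?case by (simp add: subalgebra_closed)
  next
    case (add j p)
    then show ?case using subalgebra_fps_mult[OF X] by simp
  qed
  then show ?thesis
    unfolding mps_eval_def fps_nth_Abs_fps pm_scale_conv_mult[symmetric]
    by (intro subalgebra_sum subalgebra_closed(5))
qed

end

lemma tensor_mult: "tensor x y * tensor x' y' = tensor (x * x') (y * y')"
  by (simp add: tensor_conv in_left.mult in_right.mult mult_ac)

text \<open>The span of tensors from \<open>A\<close> is closed under products and the coproduct is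
  an algebra morphism. Hence the coproduct condition need only be checked on generators.\<close>

lemma is_subalgebra_coproduct_vimage:
  assumes A: "is_subalgebra A"
  shows "is_subalgebra {x. coproduct x \<in> pm.span {tensor x y | x y. x \<in> A \<and> y \<in> A}}"
    (is "is_subalgebra {x. coproduct x \<in> pm.span ?T}")
proof -
  have T: "u * v \<in> pm.span ?T" if u: "u \<in> pm.span ?T" and v: "v \<in> pm.span ?T" for u v
  proof -
    have 1: "s * v \<in> pm.span ?T" if s: "s \<in> ?T" for s
    proof -
      have "pm_linear (\<lambda>v. s * v)" by (intro pm_linear_intros)
      then interpret pm_linear "\<lambda>v. s * v" .
      show ?thesis
        using v
      proof (induction rule: pm.span_induct_alt)
        case base
        then show ?case by (simp add: pm.span_zero)
      next
        case (step c t w)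
        obtain x y x' y' where "s = tensor x y" "t = tensor x' y'"
          and xy: "x \<in> A" "y \<in> A" "x' \<in> A" "y' \<in> A"
          using s step(1) by blast
        then have "s * t = tensor (x * x') (y * y')" by (simp add: tensor_mult)
        moreover have "x * x' \<in> A" "y * y' \<in> A"
          using xy by (simp_all add: subalgebra_closed(4)[OF A])
        ultimately have "s * t \<in> ?T" by blast
        then show ?case
          using step(2) by (simp add: add scale pm.span_add pm.span_scale pm.span_base)
      qed
    qed
    have "pm_linear (\<lambda>u. u * v)" by (intro pm_linear_intros)
    then interpret pm_linear "\<lambda>u. u * v" .
    show ?thesis
      using u
    proof (induction rule: pm.span_induct_alt)
      case base
      then show ?case by (simp add: pm.span_zero)
    next
      case (step c s w)
      then show ?case using 1 by (simp add: add scale pm.span_add pm.span_scale)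
    qed
  qed
  have "tensor 1 1 \<in> pm.span ?T"
    by (rule pm.span_base) (use subalgebra_closed(2)[OF A] in blast)
  then have one: "coproduct 1 \<in> pm.span ?T"
    by (simp add: tensor_conv in_left.one in_right.one alg_hom_1[OF alg_hom_coproduct])
  show ?thesis
    unfolding is_subalgebra_def pm.subspace_def
    using T one
    by (auto simp: alg_hom_0[OF alg_hom_coproduct] alg_hom_add[OF alg_hom_coproduct]
        alg_hom_mult[OF alg_hom_coproduct] pm_linear.scale[OF alg_hom_linear[OF alg_hom_coproduct]]
        intro: pm.span_zero pm.span_add pm.span_scale)
qed

lemma is_subalgebra_antipode_vimage:
  assumes A: "is_subalgebra A"
  shows "is_subalgebra {x. antipode x \<in> A}"
  unfolding is_subalgebra_def pm.subspace_def
  by (auto simp: alg_hom_0[OF alg_hom_antipode] alg_hom_1[OF alg_hom_antipode]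
      alg_hom_add[OF alg_hom_antipode] alg_hom_mult[OF alg_hom_antipode]
      pm_linear.scale[OF alg_hom_linear[OF alg_hom_antipode]] intro: subalgebra_closed[OF A])

lemma mult_tensor_id_antipode_tensor: "mult_tensor id antipode (tensor x y) = x * antipode y"
proof -
  have "mult_tensor id antipode (in_right y) = antipode y" for y :: "('a, 'b) ckh"
  proof (rule pm_linear_eqI[of "\<lambda>y. mult_tensor id antipode (in_right y)" antipode])
    show "pm_linear (\<lambda>y. mult_tensor id antipode (in_right y) :: ('a, 'b) ckh)"
      by (intro pm_linear_intros)
  qed (simp_all add: alg_hom_linear mult_tensor_conv)
  then show ?thesis
    unfolding tensor_conv alg_hom_mult[OF alg_hom_id_antipode] mult_tensor_in_left by simp
qed

text \<open>Applying \<open>m (id \<otimes> S)\<close> to such a formula for the coproduct expresses \<open>S (X\<^sub>i (m + 1))\<close> by the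
  \<open>S (X\<^sub>i (k))\<close> with \<open>k \<le> m\<close>, with coefficients in the subalgebra.\<close>

lemma SDSE_is_hopfI:
  fixes F :: "'i :: finite \<Rightarrow> ('i, 'k :: field) mps"
  assumes p_mem: "\<And>i m k. k \<le> m \<Longrightarrow> p i m k \<in> SDSE_algebra F"
    and p_top: "\<And>i m. p i m m = 1"
    and coproduct: "\<And>i m. coproduct (SDSE_fps F i $ Suc m) = tensor (SDSE_fps F i $ Suc m) 1 +
      (\<Sum>k\<le>m. tensor (p i m k) (SDSE_fps F i $ Suc k))"
  shows "SDSE_is_hopf F"
proof -
  let ?A = "SDSE_algebra F" and ?X = "SDSE_fps F"
  have A: "is_subalgebra ?A" by (rule is_subalgebra_SDSE_algebra)
  let ?T = "pm.span {tensor x y | x y. x \<in> ?A \<and> y \<in> ?A}"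
  have tensor_mem: "tensor x y \<in> ?T" if "x \<in> ?A" "y \<in> ?A" for x y
    by (rule pm.span_base) (use that in blast)
  have "?A \<subseteq> {x. coproduct x \<in> ?T}"
  proof (rule SDSE_algebra_least[OF is_subalgebra_coproduct_vimage[OF A]])
    fix i n
    show "?X i $ n \<in> {x. coproduct x \<in> ?T}"
    proof (cases n)
      case 0
      then show ?thesis
        by (simp add: SDSE_fps_nth_0 alg_hom_0[OF alg_hom_coproduct] pm.span_zero)
    next
      case (Suc m)
      show ?thesis
        unfolding Suc mem_Collect_eq coproduct
        by (intro pm.span_add pm.span_sum tensor_mem SDSE_fps_mem subalgebra_closed(2)[OF A] p_mem)
          simp
    qed
  qed
  moreover have "?A \<subseteq> {x. antipode x \<in> ?A}"
  proof (rule SDSE_algebra_least[OF is_subalgebra_antipode_vimage[OF A]])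
    fix i n
    have "antipode (?X i $ n) \<in> ?A"
    proof (induction n rule: less_induct)
      case (less n)
      show ?case
      proof (cases n)
        case 0
        then show ?thesis
          by (simp add: SDSE_fps_nth_0 alg_hom_0[OF alg_hom_antipode] subalgebra_closed[OF A])
      next
        case (Suc m)
        have "counit (?X i $ Suc m) = 0"
          by (simp add: counit_def SDSE_fps_def lookup_components)
        then have "0 = mult_tensor id antipode (coproduct (?X i $ Suc m))"
          by (simp add: antipode_right_inverse)
        also have "\<dots> = ?X i $ Suc m + (\<Sum>k\<le>m. p i m k * antipode (?X i $ Suc k))"
          unfolding coproduct alg_hom_add[OF alg_hom_id_antipode] alg_hom_sum[OF alg_hom_id_antipode]
            mult_tensor_id_antipode_tensor alg_hom_1[OF alg_hom_antipode] mult_1_right ..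
        also have "(\<Sum>k\<le>m. p i m k * antipode (?X i $ Suc k)) =
            (\<Sum>k<m. p i m k * antipode (?X i $ Suc k)) + antipode (?X i $ Suc m)"
          by (simp add: lessThan_Suc_atMost[symmetric] p_top)
        finally have "antipode (?X i $ Suc m) =
            0 - (?X i $ Suc m + (\<Sum>k<m. p i m k * antipode (?X i $ Suc k)))"
          by (simp add: algebra_simps eq_neg_iff_add_eq_0)
        also have "\<dots> \<in> ?A"
          by (intro subalgebra_diff[OF A] subalgebra_closed[OF A] subalgebra_sum[OF A] p_mem
              SDSE_fps_mem less) (use Suc in auto)
        finally show ?thesis using Suc by simp
      qed
    qed
    then show "?X i $ n \<in> {x. antipode x \<in> ?A}" by simp
  qed
  ultimately show ?thesis
    unfolding SDSE_is_hopf_def is_hopf_subalgebra_def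
    using A is_antipode_antipode by blast
qed

text \<open>With \<open>X\<close> the solution, \<open>e\<^sub>i = E\<^sub>i(X)\<close> and \<open>q = Q(X)\<close>, the coproduct is
  \<open>\<Delta> X\<^sub>i = X\<^sub>i \<otimes> 1 + F\<^sub>i(X) \<otimes> X\<^sub>i(1) + \<Sum>\<^sub>n\<^sub>\<ge>\<^sub>1 e\<^sub>i q\<^sup>n \<otimes> X\<^sub>i(n + 1)\<close>. A formal variable keeps track of
  the degree, so that the scaling by \<open>q\<^sup>n\<close> in degree \<open>n\<close> is composition with \<open>shift\<close>.\<close>

locale SDSE_coproduct =
  fixes F E :: "'i :: finite \<Rightarrow> ('i, 'k :: field) mps" and Q :: "('i, 'k) mps"
begin

abbreviation X :: "'i \<Rightarrow> ('i, 'k) ckh fps" where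
  "X \<equiv> SDSE_fps F"

abbreviation M :: "'i \<Rightarrow> ('i, 'k) ckh fps" where
  "M i \<equiv> mps_eval (F i) X"

abbreviation e :: "'i \<Rightarrow> ('i, 'k) ckh fps" where
  "e i \<equiv> mps_eval (E i) X"

abbreviation q :: "('i, 'k) ckh fps" where
  "q \<equiv> mps_eval Q X"

abbreviation left :: "('i, 'k) ckh fps \<Rightarrow> ('i, 'k) ckh2 fps" where
  "left \<equiv> fps_map in_left"

abbreviation right :: "('i, 'k) ckh fps \<Rightarrow> ('i, 'k) ckh2 fps" where
  "right \<equiv> fps_map in_right"

abbreviation shift :: "('i, 'k) ckh2 fps" where
  "shift \<equiv> left (fps_X * q)"

text \<open>When \<open>M i\<close> starts with 1, the degree 1 part of \<open>X i\<close> is the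
  single vertex \<open>graft i 1\<close>. Its left partner is \<open>M i\<close> instead of
  \<open>e i\<close>, so this term is split off and \<open>M i - 1\<close> remains. In
  \<open>shift\<close> the formal variable accompanies \<open>q\<close> because its exponent counts
  the total degree of both tensor factors.\<close>

definition Y :: "'i \<Rightarrow> ('i, 'k) ckh2 fps" where
  "Y i = left (X i) + fps_X * (left (M i) * fps_const (in_right (graft i 1)) +
    left (e i) * (right (fps_map (graft i) (M i - 1)) oo shift))"

lemma shift_nth_0: "shift $ 0 = 0"
  by (simp add: in_left.zero)

lemma Y_nth_0: "Y i $ 0 = 0"
  by (simp add: Y_def SDSE_fps_nth_0 in_left.zero)

lemma X_eq: "X i = fps_X * fps_map (graft i) (M i)"
  by (rule SDSE_fps_eq)

text \<open>The assumption makes \<open>Y\<close> a solution of the fixed-point equation satisfied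
  by the coproducts, whose solution is unique.\<close>

lemma coproduct_eq_Y:
  assumes "\<And>i. mps_eval (F i) Y = left (M i) + left (e i) * (right (M i - 1) oo shift)"
  shows "fps_map coproduct (X i) = Y i"
proof (rule SDSE_equation_unique[where A = "\<lambda>i. left (X i)" and f = graft_right and F = F])
  fix i
  have "fps_map (graft_right i) (left (M i) * 1) = left (M i) * fps_map (graft_right i) 1"
    by (rule fps_map_graft_right_in_left_mult)
  also have "fps_map (graft_right i) (1 :: ('i, 'k) ckh2 fps) = fps_const (in_right (graft i 1))"
  proof (rule fps_ext)
    fix n
    have "graft_right i (1 :: ('i, 'k) ckh2) = in_right (graft i 1)"
      using graft_right_in_right[of i 1] by (simp add: in_right.one)
    then show "fps_map (graft_right i) (1 :: ('i, 'k) ckh2 fps) $ n = fps_const (in_right (graft i 1)) $ n"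
      by (simp add: pm_linear_0[OF pm_linear_graft_right[OF pm_linear_id]])
  qed
  finally have 1: "fps_map (graft_right i) (left (M i)) = left (M i) * fps_const (in_right (graft i 1))"
    by simp
  show "Y i = left (X i) + fps_X * fps_map (graft_right i) (mps_eval (F i) Y)"
    unfolding assms fps_map_pm_linear_add[OF pm_linear_graft_right[OF pm_linear_id]] 1
      fps_map_graft_right_in_left_mult fps_map_graft_right_compose Y_def ..
qed (rule fps_map_coproduct_SDSE)

theorem is_hopf:
  assumes eq: "\<And>i. mps_eval (F i) Y = left (M i) + left (e i) * (right (M i - 1) oo shift)"
    and M0: "\<And>i. M i $ 0 = 1" and e0: "\<And>i. e i $ 0 = 1" and q0: "q $ 0 = 1"
  shows "SDSE_is_hopf F"
proof (rule SDSE_is_hopfI)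
  \<comment> \<open>\<open>?p i m k\<close> is the left partner of \<open>X i $ Suc k\<close> in
    total degree \<open>Suc m\<close>; the index \<open>Suc k\<close> accounts for the root vertex
    added by grafting.\<close>
  let ?p = "\<lambda>i m k. if k = 0 then M i $ m else (e i * (fps_X * q) ^ k) $ m"
  let ?A = "SDSE_algebra F"
  have A: "is_subalgebra ?A" by (rule is_subalgebra_SDSE_algebra)
  have mem: "mps_eval G X $ n \<in> ?A" for G n
    by (rule subalgebra_mps_eval[OF A SDSE_fps_mem])
  have "(fps_X :: ('i, 'k) ckh fps) $ n \<in> ?A" for n
    by (simp add: fps_X_def subalgebra_closed[OF A])
  then have "(fps_X * q) $ n \<in> ?A" for n
    using mem by (rule subalgebra_fps_mult[OF A])
  then show "?p i m k \<in> ?A" for i m k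
    using mem subalgebra_fps_mult[OF A mem subalgebra_fps_power[OF A]] by simp
  show "?p i m m = 1" for i m
  proof (cases m)
    case (Suc n)
    \<comment> \<open>The power of \<open>fps_X\<close> uses up all of degree \<open>m\<close>, so
      only the constant terms of \<open>e i\<close> and \<open>q\<close> remain.\<close>
    have "(e i * (fps_X * q) ^ m) $ m = (fps_X ^ m * (e i * q ^ m)) $ m"
      by (simp add: power_mult_distrib mult_ac)
    also have "\<dots> = 1"
      by (simp only: fps_X_power_mult_nth less_irrefl if_False diff_self_eq_0 fps_mult_nth_0
          fps_power_zeroth e0 q0 power_one mult_1_right)
    finally show ?thesis using Suc by simp
  qed (simp add: M0)
  fix i m
  have X_Suc: "X i $ Suc k = graft i (M i $ k)" for k
    by (subst X_eq) simp
  let ?v = "fps_map (graft i) (M i - 1)"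
  have v: "?v $ k = (if k = 0 then 0 else X i $ Suc k)" for k
    by (cases k) (simp_all add: X_Suc M0 pm_linear_0[OF pm_linear_graft[OF pm_linear_id]])
  have "coproduct (X i $ Suc m) = Y i $ Suc m"
    using coproduct_eq_Y[OF eq, of i] fps_map_nth[of coproduct "X i" "Suc m"] by simp
  also have "\<dots> = in_left (X i $ Suc m) + (in_left (M i $ m) * in_right (graft i 1) +
      (left (e i) * (right ?v oo shift)) $ m)"
    by (simp add: Y_def)
  also have "(left (e i) * (right ?v oo shift)) $ m = (\<Sum>k\<le>m. tensor ((e i * (fps_X * q) ^ k) $ m) (?v $ k))"
    by (rule left_mult_compose_nth) simp
  also have "\<dots> = (\<Sum>k\<in>{..m} - {0}. tensor (?p i m k) (X i $ Suc k))"
    by (rule sum.mono_neutral_cong_right) (auto simp: v tensor_conv in_right.zero simp del: fps_map_nth)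
  also have "in_left (M i $ m) * in_right (graft i 1) = tensor (?p i m 0) (X i $ Suc 0)"
    by (simp add: tensor_conv X_Suc M0)
  also have "in_left (X i $ Suc m) = tensor (X i $ Suc m) 1"
    by (simp add: tensor_conv in_right.one)
  also have "tensor (?p i m 0) (X i $ Suc 0) + (\<Sum>k\<in>{..m} - {0}. tensor (?p i m k) (X i $ Suc k)) =
      (\<Sum>k\<le>m. tensor (?p i m k) (X i $ Suc k))"
    by (rule sum.remove[symmetric]) simp_all
  finally show "coproduct (X i $ Suc m) = tensor (X i $ Suc m) 1 +
      (\<Sum>k\<le>m. tensor (?p i m k) (X i $ Suc k))" .
qed

text \<open>With \<open>E i = F i\<close> the term split off for the single vertex merges with the
  rest. As \<open>M i\<close> contains \<open>q\<close>, a factor \<open>shift\<close> appears, and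
  it completes the grafted series to \<open>X i\<close> composed with \<open>shift\<close>.\<close>

lemma Y_multiplicative:
  assumes "E i = F i" and M: "M i = q * g"
  shows "Y i = left (X i) + left g * (right (X i) oo shift)"
proof -
  let ?m = "right (fps_map (graft i) (M i)) oo shift"
  have "fps_map (graft i) (M i - 1) = fps_map (graft i) (M i) - fps_const (graft i 1)"
    by (rule fps_ext) (simp add: pm_linear_diff[OF pm_linear_graft[OF pm_linear_id]]
        pm_linear_0[OF pm_linear_graft[OF pm_linear_id]])
  then have 1: "right (fps_map (graft i) (M i - 1)) oo shift = ?m - fps_const (in_right (graft i 1))"
    by (simp add: in_right.map_diff in_right.map_const fps_compose_sub_distrib)
  have "Y i = left (X i) + fps_X * (left (M i) * ?m)"
    unfolding Y_def assms(1) 1 by (simp add: algebra_simps)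
  also have "fps_X * (left (M i) * ?m) = left g * (shift * ?m)"
    by (simp add: M in_left.map_mult in_left.map_X mult_ac)
  also have "shift * ?m = right (X i) oo shift"
  proof -
    have "right (X i) = fps_X * right (fps_map (graft i) (M i))"
      by (subst X_eq) (simp add: in_right.map_mult in_right.map_X)
    then show ?thesis
      by (simp only: fps_compose_mult_comm[OF shift_nth_0] fps_X_fps_compose_startby0[OF shift_nth_0])
  qed
  finally show ?thesis .
qed

end

section \<open>The systems of the theorem\<close>

lemma mps_of_fps_1 [simp]: "mps_of_fps j 1 = 1"
  by (rule mps_eqI) (auto simp: mps_of_fps_def one_mps_def)

lemma mps_of_fps_linear: "mps_of_fps j (fps_const c * fps_X) = mps_const c * mps_var j"
proof (rule mps_eqI)
  fix m :: "'a multiset"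
  have "mcoeff (mps_const c * mps_var j) m =
      (\<Sum>u | u \<subseteq># m. if u = {#} then c * mcoeff (mps_var j) m else 0)"
    unfolding times_mps_def mcoeff_Abs_mps by (rule sum.cong) (auto simp: mps_const_def)
  also have "\<dots> = c * mcoeff (mps_var j) m"
    by (simp add: finite_submsets)
  also have "\<dots> = mcoeff (mps_of_fps j (fps_const c * fps_X)) m"
  proof (cases "size m = 1")
    case True
    then obtain i where "m = {#i#}" using size_1_singleton_mset by blast
    then show ?thesis by (simp add: mps_var_def mps_of_fps_def)
  next
    case False
    then have "m \<noteq> {#j#}" by auto
    then show ?thesis using False by (simp add: mps_var_def mps_of_fps_def fps_X_def)
  qed
  finally show "mcoeff (mps_of_fps j (fps_const c * fps_X)) m = mcoeff (mps_const c * mps_var j) m" ..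
qed

lemma fps_map_eval_fps_at:
  fixes f :: "('m :: comm_monoid_add \<Rightarrow>\<^sub>0 'k :: field) \<Rightarrow> ('n :: comm_monoid_add \<Rightarrow>\<^sub>0 'k)"
  assumes "alg_hom f"
  shows "fps_map f (eval_fps_at g x) = eval_fps_at g (fps_map f x)"
  \<comment> \<open>A series in one variable is treated as a series in the single variable
    \<open>()\<close>.\<close>
  using fps_map_mps_eval[OF assms, of "mps_of_fps () g" "\<lambda>_. x"] by (simp only: mps_eval_of_fps)

lemma eval_fps_at_compose:
  assumes "x $ 0 = 0" "c $ 0 = 0"
  shows "eval_fps_at g (x oo c) = eval_fps_at g x oo c"
  using mps_eval_compose[of "\<lambda>_ :: unit. x" c "mps_of_fps () g"] assms
  by (simp only: mps_eval_of_fps)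

text \<open>A product of the powers (1 - \<beta>_j h_j)^(-\<mu>_j/\<beta>_j), with exponentials
  where \<beta>_j = 0. All products in the systems have this form, and multiplying them adds the
  parameters \<open>\<mu>\<close>.\<close>

definition f_quot_prod :: "'v set \<Rightarrow> ('v \<Rightarrow> 'k) \<Rightarrow> ('v \<Rightarrow> 'k) \<Rightarrow> ('v, 'k :: field_char_0) mps" where
  "f_quot_prod P \<beta> \<mu> = (\<Prod>j\<in>P. mps_of_fps j (f_quot (\<beta> j) (\<mu> j)))"

definition log_ser_sum :: "'v set \<Rightarrow> ('v \<Rightarrow> 'k) \<Rightarrow> ('v \<Rightarrow> 'k) \<Rightarrow> ('v, 'k :: field_char_0) mps" where
  "log_ser_sum P \<beta> a = (\<Sum>j\<in>P. mps_of_fps j (log_ser (a j) (\<beta> j)))"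

lemma f_quot_prod_cong: "(\<And>j. j \<in> P \<Longrightarrow> \<mu> j = \<mu>' j) \<Longrightarrow> f_quot_prod P \<beta> \<mu> = f_quot_prod P \<beta> \<mu>'"
  unfolding f_quot_prod_def by (rule prod.cong) auto

lemma f_quot_prod_0: "f_quot_prod P \<beta> (\<lambda>_. 0) = 1"
  by (simp add: f_quot_prod_def f_quot_0)

context
  fixes Z :: "'v :: finite \<Rightarrow> ('m :: comm_monoid_add \<Rightarrow>\<^sub>0 'k :: field_char_0) fps"
  assumes Z: "\<And>j. Z j $ 0 = 0"
begin

lemma mps_eval_f_quot_prod:
  "mps_eval (f_quot_prod P \<beta> \<mu>) Z = (\<Prod>j\<in>P. eval_fps_at (f_quot (\<beta> j) (\<mu> j)) (Z j))"
  by (simp add: f_quot_prod_def mps_eval_prod[OF Z] mps_eval_of_fps)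

lemma mps_eval_f_quot_prod_nth_0: "mps_eval (f_quot_prod P \<beta> \<mu>) Z $ 0 = 1"
proof -
  have "(\<Prod>j\<in>P. f j) $ 0 = 1" if "\<And>j. f j $ 0 = 1" for f :: "'v \<Rightarrow> ('m \<Rightarrow>\<^sub>0 'k) fps"
    by (induction P rule: infinite_finite_induct) (simp_all add: that)
  then show ?thesis
    unfolding mps_eval_f_quot_prod by (simp add: eval_fps_at_nth_0)
qed

lemma mps_eval_f_quot_prod_add:
  "mps_eval (f_quot_prod P \<beta> (\<lambda>j. \<mu> j + \<mu>' j)) Z =
    mps_eval (f_quot_prod P \<beta> \<mu>) Z * mps_eval (f_quot_prod P \<beta> \<mu>') Z"
  unfolding mps_eval_f_quot_prod by (simp add: f_quot_add eval_fps_at_mult[OF Z] prod.distrib)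

lemma mps_eval_f_quot_prod_neg:
  assumes "i \<in> P"
  shows "mps_eval (f_quot_prod P \<beta> (\<lambda>j. if j = i then - \<beta> i else 0)) Z =
    1 - fps_const (scalar (\<beta> i)) * Z i"
proof -
  have "mps_eval (f_quot_prod P \<beta> (\<lambda>j. if j = i then - \<beta> i else 0)) Z =
      (\<Prod>j\<in>P. if j = i then eval_fps_at (f_quot (\<beta> i) (- \<beta> i)) (Z i) else 1)"
    unfolding mps_eval_f_quot_prod
    by (rule prod.cong) (auto simp: f_quot_0 eval_fps_at_1)
  also have "\<dots> = eval_fps_at (f_quot (\<beta> i) (- \<beta> i)) (Z i)"
    using assms by simp
  also have "\<dots> = 1 - fps_const (scalar (\<beta> i)) * Z i"
    by (simp only: f_quot_neg eval_fps_at_diff eval_fps_at_1 eval_fps_at_mult[OF Z]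
        eval_fps_at_const eval_fps_at_X[OF Z])
  finally show ?thesis .
qed

lemma mps_eval_log_ser_sum:
  "mps_eval (log_ser_sum P \<beta> a) Z = (\<Sum>j\<in>P. eval_fps_at (log_ser (a j) (\<beta> j)) (Z j))"
  by (simp add: log_ser_sum_def mps_eval_sum mps_eval_of_fps)

end

lemma fps_compose_prod:
  fixes c :: "'a :: comm_ring_1 fps"
  assumes "c $ 0 = 0"
  shows "(\<Prod>j\<in>A. f j) oo c = (\<Prod>j\<in>A. f j oo c)"
  by (induction A rule: infinite_finite_induct) (simp_all add: fps_compose_mult_comm[OF assms])

context ring_map
begin

lemma map_prod: "fps_map f (\<Prod>j\<in>A. g j) = (\<Prod>j\<in>A. fps_map f (g j))"
  by (induction A rule: infinite_finite_induct) (simp_all add: map_one map_mult)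

lemma map_sum: "fps_map f (\<Sum>j\<in>A. g j) = (\<Sum>j\<in>A. fps_map f (g j))"
  by (rule fps_ext) (simp add: fps_sum_nth sum)

end

abbreviation const_ser :: "'k :: field \<Rightarrow> ('m :: comm_monoid_add \<Rightarrow>\<^sub>0 'k) fps" where
  "const_ser c \<equiv> fps_const (scalar c)"

text \<open>\<open>Y_P\<close> puts \<open>Y j\<close> in the shape of the group law with parameter
  \<open>\<beta> j\<close>, so the addition formulas apply to each factor or summand over
  \<open>P\<close>.\<close>

locale SDSE_coproduct_addition = SDSE_coproduct F E Q
  for F E :: "'i :: finite \<Rightarrow> ('i, 'k :: field_char_0) mps" and Q +
  fixes P :: "'i set" and \<beta> :: "'i \<Rightarrow> 'k"
  assumes Y_P: "j \<in> P \<Longrightarrow>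
    Y j = left (X j) + (1 - const_ser (\<beta> j) * left (X j)) * (right (X j) oo shift)"
begin

lemma left_X_nth_0: "left (X j) $ 0 = 0" and right_X_nth_0: "right (X j) $ 0 = 0"
  by (simp_all add: SDSE_fps_nth_0 in_left.zero in_right.zero)

lemma right_X_compose_nth_0: "(right (X j) oo shift) $ 0 = 0"
  by (simp only: fps_compose_nth_0 right_X_nth_0)

lemma const_ser_simps:
  "left (const_ser c) = const_ser c" "right (const_ser c) = const_ser c" "const_ser c oo shift = const_ser c"
  by (simp_all add: in_left.map_const in_right.map_const alg_hom_scalar[OF alg_hom_in_left]
      alg_hom_scalar[OF alg_hom_in_right])

lemma eval_Y_f_quot_prod:
  "mps_eval (f_quot_prod P \<beta> \<mu>) Y =
    left (mps_eval (f_quot_prod P \<beta> \<mu>) X) * (right (mps_eval (f_quot_prod P \<beta> \<mu>) X) oo shift)"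
proof -
  have "eval_fps_at (f_quot (\<beta> j) (\<mu> j)) (Y j) =
      left (eval_fps_at (f_quot (\<beta> j) (\<mu> j)) (X j)) *
      (right (eval_fps_at (f_quot (\<beta> j) (\<mu> j)) (X j)) oo shift)" if "j \<in> P" for j
    unfolding Y_P[OF that] eval_f_quot_add[OF left_X_nth_0 right_X_compose_nth_0]
      eval_fps_at_compose[OF right_X_nth_0 shift_nth_0]
      fps_map_eval_fps_at[OF alg_hom_in_left] fps_map_eval_fps_at[OF alg_hom_in_right] ..
  then show ?thesis
    unfolding mps_eval_f_quot_prod[OF Y_nth_0] mps_eval_f_quot_prod[OF SDSE_fps_nth_0]
      in_left.map_prod in_right.map_prod fps_compose_prod[OF shift_nth_0]
    by (simp add: prod.distrib)
qed

lemma eval_Y_log_ser_sum: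
  "mps_eval (log_ser_sum P \<beta> a) Y =
    left (mps_eval (log_ser_sum P \<beta> a) X) + (right (mps_eval (log_ser_sum P \<beta> a) X) oo shift)"
proof -
  have "eval_fps_at (log_ser (a j) (\<beta> j)) (Y j) =
      left (eval_fps_at (log_ser (a j) (\<beta> j)) (X j)) +
      (right (eval_fps_at (log_ser (a j) (\<beta> j)) (X j)) oo shift)" if "j \<in> P" for j
    unfolding Y_P[OF that] eval_log_ser_add[OF left_X_nth_0 right_X_compose_nth_0]
      eval_fps_at_compose[OF right_X_nth_0 shift_nth_0]
      fps_map_eval_fps_at[OF alg_hom_in_left] fps_map_eval_fps_at[OF alg_hom_in_right] ..
  then show ?thesis
    unfolding mps_eval_log_ser_sum[OF Y_nth_0] mps_eval_log_ser_sum[OF SDSE_fps_nth_0]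
      in_left.map_sum in_right.map_sum fps_compose_sum_distrib
    by (simp add: sum.distrib)
qed

end

section \<open>Verification of the criterion for the given systems\<close>

theorem theorem32:
  fixes F :: "'i :: finite \<Rightarrow> ('i, 'k :: field_char_0) mps"
    and I0 J0 K0 I1 J1 :: "'i set"
    and \<beta> \<nu> :: "'i \<Rightarrow> 'k"
    and a b :: "'i \<Rightarrow> 'i \<Rightarrow> 'k"
    and I1sub :: "'i \<Rightarrow> 'i set"
  assumes part_union: "I0 \<union> J0 \<union> K0 \<union> I1 \<union> J1 = UNIV"
    and part_disjoint: "I0 \<inter> J0 = {}" "(I0 \<union> J0) \<inter> K0 = {}" "(I0 \<union> J0 \<union> K0) \<inter> I1 = {}"
      "(I0 \<union> J0 \<union> K0 \<union> I1) \<inter> J1 = {}"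
    and nonempty: "I0 \<union> J0 \<noteq> {}"
    and nonconstant: "\<And>i. mps_nonconstant (F i)"
    and F_I0: "\<And>i. i \<in> I0 \<Longrightarrow>
      F i = mps_of_fps i (f_ser (\<beta> i))
        * (\<Prod>j\<in>I0 - {i}. mps_of_fps j (f_quot (\<beta> j) (1 + \<beta> j)))
        * (\<Prod>j\<in>J0. mps_of_fps j (f_ser 1))"
    and F_J0: "\<And>i. i \<in> J0 \<Longrightarrow>
      F i = (\<Prod>j\<in>I0. mps_of_fps j (f_quot (\<beta> j) (1 + \<beta> j)))
        * (\<Prod>j\<in>J0 - {i}. mps_of_fps j (f_ser 1))"
    and F_K0: "\<And>i. i \<in> K0 \<Longrightarrow>
      F i = (\<Prod>j\<in>I0. mps_of_fps j (f_quot (\<beta> j) (1 + \<beta> j)))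
        * (\<Prod>j\<in>J0. mps_of_fps j (f_ser 1))"
    and I1_cond: "\<And>i. i \<in> I1 \<Longrightarrow>
      \<nu> i \<noteq> 1 \<or> (\<exists>j\<in>I0. a i j \<noteq> 1 + \<beta> j) \<or> (\<exists>j\<in>J0. a i j \<noteq> 1) \<or> (\<exists>j\<in>K0. a i j \<noteq> 0)"
    and F_I1: "\<And>i. i \<in> I1 \<Longrightarrow> \<nu> i \<noteq> 0 \<Longrightarrow>
      F i = mps_const (1 / \<nu> i)
        * (\<Prod>j\<in>I0. mps_of_fps j (f_quot (\<beta> j) (\<nu> i * a i j)))
        * (\<Prod>j\<in>J0. mps_of_fps j (f_quot 1 (\<nu> i * a i j)))
        * (\<Prod>j\<in>K0. mps_of_fps j (f_quot 0 (\<nu> i * a i j)))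
        + mps_const (1 - 1 / \<nu> i)"
    and F_I1_0: "\<And>i. i \<in> I1 \<Longrightarrow> \<nu> i = 0 \<Longrightarrow>
      F i = (\<Sum>j\<in>I0. mps_of_fps j (log_ser (a i j) (\<beta> j)))
        + (\<Sum>j\<in>J0. mps_of_fps j (log_ser (a i j) 1))
        + (\<Sum>j\<in>K0. mps_const (a i j) * mps_var j)
        + 1"
    and I1sub: "\<And>i. i \<in> J1 \<Longrightarrow> I1sub i = {j \<in> I1. a i j \<noteq> 0}"
    and J1_nu: "\<And>i. i \<in> J1 \<Longrightarrow> \<nu> i \<noteq> 0"
    and J1_nonempty: "\<And>i. i \<in> J1 \<Longrightarrow> I1sub i \<noteq> {}"
    and J1_nu_1: "\<And>i j. i \<in> J1 \<Longrightarrow> j \<in> I1sub i \<Longrightarrow> \<nu> j = 1"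
    and J1_eq: "\<And>i j k. i \<in> J1 \<Longrightarrow> j \<in> I1sub i \<Longrightarrow> k \<in> I1sub i \<Longrightarrow> F j = F k"
    and b: "\<And>i j t. i \<in> J1 \<Longrightarrow> j \<in> I1sub i \<Longrightarrow> t \<in> I0 \<union> J0 \<union> K0 \<Longrightarrow> b i t = a j t"
    and F_J1: "\<And>i. i \<in> J1 \<Longrightarrow>
      F i = mps_const (1 / \<nu> i)
        * (\<Prod>j\<in>I0. mps_of_fps j (f_quot (\<beta> j) (b i j - 1 - \<beta> j)))
        * (\<Prod>j\<in>J0. mps_of_fps j (f_quot 1 (b i j - 1)))
        * (\<Prod>j\<in>K0. mps_of_fps j (f_quot 0 (b i j)))
        + (\<Sum>j\<in>I1sub i. mps_const (a i j) * mps_var j)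
        + mps_const (1 - 1 / \<nu> i)"
  shows "SDSE_is_hopf F"
proof -
  define P where "P = I0 \<union> J0 \<union> K0"
  define \<beta>' where "\<beta>' j = (if j \<in> I0 then \<beta> j else if j \<in> J0 then 1 else 0)" for j
  \<comment> \<open>The parameters \<open>\<mu>\<close> of the factors of Q. The value 0 on
    \<open>K0\<close> encodes the factor 1, so Q is
    \<open>f_quot_prod P \<beta>' \<gamma>\<close>.\<close>
  define \<gamma> where "\<gamma> j = (if j \<in> I0 then 1 + \<beta> j else if j \<in> J0 then 1 else 0)" for j
  have disj: "I0 \<inter> J0 = {}" "(I0 \<union> J0) \<inter> K0 = {}" using part_disjoint by auto
  have mem: "j \<in> I0 \<Longrightarrow> \<beta>' j = \<beta> j" "j \<in> J0 \<Longrightarrow> \<beta>' j = 1" "j \<in> K0 \<Longrightarrow> \<beta>' j = 0"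
    "j \<in> I0 \<Longrightarrow> \<gamma> j = 1 + \<beta> j" "j \<in> J0 \<Longrightarrow> \<gamma> j = 1" "j \<in> K0 \<Longrightarrow> \<gamma> j = 0" for j
    using disj by (auto simp: \<beta>'_def \<gamma>_def)
  have prod_eq: "f_quot_prod P \<beta>' \<mu> = (\<Prod>j\<in>I0. mps_of_fps j (f_quot (\<beta> j) (\<mu> j)))
      * (\<Prod>j\<in>J0. mps_of_fps j (f_quot 1 (\<mu> j))) * (\<Prod>j\<in>K0. mps_of_fps j (f_quot 0 (\<mu> j)))" for \<mu>
    unfolding f_quot_prod_def P_def
    by (simp add: prod.union_disjoint disj mem)
  have sum_eq: "log_ser_sum P \<beta>' \<mu> = (\<Sum>j\<in>I0. mps_of_fps j (log_ser (\<mu> j) (\<beta> j)))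
      + (\<Sum>j\<in>J0. mps_of_fps j (log_ser (\<mu> j) 1)) + (\<Sum>j\<in>K0. mps_const (\<mu> j) * mps_var j)" for \<mu>
    unfolding log_ser_sum_def P_def
    by (simp add: sum.union_disjoint disj mem log_ser_0 mps_of_fps_linear)
  \<comment> \<open>On \<open>I1\<close> this is the multiplicative part of \<open>F i\<close>,
    which is 1 when \<open>\<nu> i = 0\<close>. On \<open>J1\<close> it is the quotient by Q of the
    series \<open>F j\<close> with \<open>j \<in> I1sub i\<close>.\<close>
  define E where "E i = (if i \<in> P then F i else if i \<in> I1 then f_quot_prod P \<beta>' (\<lambda>j. \<nu> i * a i j)
    else f_quot_prod P \<beta>' (\<lambda>j. b i j - \<gamma> j))" for i
  \<comment> \<open>These parameters encode the factor 1 - \<beta>'_i h_i. On \<open>I0\<close> they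
    lower 1 + \<beta>_i to 1, on \<open>J0\<close> they remove the factor in h_i, and on
    \<open>K0\<close> they change nothing.\<close>
  let ?D = "\<lambda>i j. if j = i then - \<beta>' i else 0"
  have F_P: "F i = f_quot_prod P \<beta>' (\<lambda>j. \<gamma> j + ?D i j)" if iP: "i \<in> P" for i
  proof -
    consider "i \<in> I0" | "i \<in> J0" | "i \<in> K0" using iP unfolding P_def by blast
    then show ?thesis
    proof cases
      case 1
      have "(\<Prod>j\<in>I0. mps_of_fps j (f_quot (\<beta> j) (\<gamma> j + ?D i j))) =
          mps_of_fps i (f_ser (\<beta> i)) * (\<Prod>j\<in>I0 - {i}. mps_of_fps j (f_quot (\<beta> j) (1 + \<beta> j)))"
        using 1 by (subst prod.remove[of _ i]) (auto simp: mem f_quot_1 intro!: prod.cong arg_cong2[of _ _ _ _ "(*)"])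
      moreover have "(\<Prod>j\<in>J0. mps_of_fps j (f_quot 1 (\<gamma> j + ?D i j))) = (\<Prod>j\<in>J0. mps_of_fps j (f_ser 1))"
        using 1 disj by (intro prod.cong) (auto simp: mem f_quot_1)
      moreover have "(\<Prod>j\<in>K0. mps_of_fps j (f_quot 0 (\<gamma> j + ?D i j))) = 1"
        using 1 disj by (intro prod.neutral) (auto simp: mem f_quot_0)
      ultimately show ?thesis unfolding prod_eq F_I0[OF 1] by simp
    next
      case 2
      have "(\<Prod>j\<in>I0. mps_of_fps j (f_quot (\<beta> j) (\<gamma> j + ?D i j))) =
          (\<Prod>j\<in>I0. mps_of_fps j (f_quot (\<beta> j) (1 + \<beta> j)))"
        using 2 disj by (intro prod.cong) (auto simp: mem)
      moreover have "(\<Prod>j\<in>J0. mps_of_fps j (f_quot 1 (\<gamma> j + ?D i j))) =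
          (\<Prod>j\<in>J0 - {i}. mps_of_fps j (f_ser 1))"
        using 2 by (subst prod.remove[of _ i]) (auto simp: mem f_quot_1 f_quot_0 intro!: prod.cong)
      moreover have "(\<Prod>j\<in>K0. mps_of_fps j (f_quot 0 (\<gamma> j + ?D i j))) = 1"
        using 2 disj by (intro prod.neutral) (auto simp: mem f_quot_0)
      ultimately show ?thesis unfolding prod_eq F_J0[OF 2] by simp
    next
      case 3
      have "(\<Prod>j\<in>I0. mps_of_fps j (f_quot (\<beta> j) (\<gamma> j + ?D i j))) =
          (\<Prod>j\<in>I0. mps_of_fps j (f_quot (\<beta> j) (1 + \<beta> j)))"
        using 3 disj by (intro prod.cong) (auto simp: mem)
      moreover have "(\<Prod>j\<in>J0. mps_of_fps j (f_quot 1 (\<gamma> j + ?D i j))) = (\<Prod>j\<in>J0. mps_of_fps j (f_ser 1))"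
        using 3 disj by (intro prod.cong) (auto simp: mem f_quot_1)
      moreover have "(\<Prod>j\<in>K0. mps_of_fps j (f_quot 0 (\<gamma> j + ?D i j))) = 1"
        using 3 disj by (intro prod.neutral) (auto simp: mem f_quot_0)
      ultimately show ?thesis unfolding prod_eq F_K0[OF 3] by simp
    qed
  qed
  interpret SDSE_coproduct F E "f_quot_prod P \<beta>' \<gamma>" .
  let ?g = "\<lambda>\<mu>. mps_eval (f_quot_prod P \<beta>' \<mu>) X"
  have M_P: "M i = q * (1 - const_ser (\<beta>' i) * X i)" if "i \<in> P" for i
    using mps_eval_f_quot_prod_neg[of X i P \<beta>', OF SDSE_fps_nth_0 that]
    by (simp only: F_P[OF that] mps_eval_f_quot_prod_add[OF SDSE_fps_nth_0])
  interpret SDSE_coproduct_addition F E "f_quot_prod P \<beta>' \<gamma>" P \<beta>'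
  proof
    fix j assume j: "j \<in> P"
    have "Y j = left (X j) + left (1 - const_ser (\<beta>' j) * X j) * (right (X j) oo shift)"
      by (rule Y_multiplicative[OF _ M_P[OF j]]) (simp add: E_def j)
    then show "Y j = left (X j) + (1 - const_ser (\<beta>' j) * left (X j)) * (right (X j) oo shift)"
      by (simp add: in_left.map_diff in_left.map_mult in_left.map_one in_left.map_const
          alg_hom_scalar[OF alg_hom_in_left])
  qed
  note left_simps = in_left.map_add in_left.map_diff in_left.map_mult in_left.map_one in_left.map_sum
  note right_simps = in_right.map_add in_right.map_diff in_right.map_mult in_right.map_one in_right.map_sum
  note compose_simps = fps_compose_add_distrib fps_compose_sub_distrib fps_compose_mult_comm[OF shift_nth_0]
    fps_compose_sum_distrib
  note eval_simps = mps_eval_add mps_eval_mult[OF SDSE_fps_nth_0] mps_eval_mult[OF Y_nth_0]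
    mps_eval_const mps_eval_sum mps_eval_1 mps_eval_var[of X, OF SDSE_fps_nth_0] mps_eval_var[of Y, OF Y_nth_0]
  have const_ser_diff: "const_ser (1 - c) = 1 - (const_ser c :: ('m :: comm_monoid_add \<Rightarrow>\<^sub>0 'k) fps)" for c
    by (simp add: scalar.diff fps_const_sub[symmetric])
  have g0: "?g \<mu> $ 0 = 1" for \<mu>
    by (rule mps_eval_f_quot_prod_nth_0[OF SDSE_fps_nth_0])
  have "mps_eval (F i) Y = left (M i) + left (e i) * (right (M i - 1) oo shift) \<and>
      M i $ 0 = 1 \<and> e i $ 0 = 1" for i
  proof -
    consider "i \<in> P" | "i \<in> I1" "i \<notin> P" "\<nu> i \<noteq> 0" | "i \<in> I1" "i \<notin> P" "\<nu> i = 0"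
      | "i \<in> J1" "i \<notin> P" "i \<notin> I1"
      using part_union part_disjoint unfolding P_def by blast
    then show ?thesis
    proof cases
      case 1
      \<comment> \<open>For a multiplicative series, writing the right factor as 1 plus the rest
        gives the required form with left factor \<open>M i\<close>.\<close>
      have "E i = F i" using 1 by (simp add: E_def)
      then show ?thesis
        unfolding F_P[OF 1] using g0
        by (simp add: eval_Y_f_quot_prod right_simps compose_simps algebra_simps)
    next
      case 2
      let ?s = "?g (\<lambda>j. \<nu> i * a i j)"
      have F: "F i = mps_const (1 / \<nu> i) * f_quot_prod P \<beta>' (\<lambda>j. \<nu> i * a i j) + mps_const (1 - 1 / \<nu> i)"
        unfolding prod_eq F_I1[OF 2(1,3)] by (simp only: mult.assoc)
      have E: "E i = f_quot_prod P \<beta>' (\<lambda>j. \<nu> i * a i j)" using 2 by (simp add: E_def)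
      have M: "M i = const_ser (1 / \<nu> i) * ?s + (1 - const_ser (1 / \<nu> i))"
        unfolding F by (simp only: eval_simps const_ser_diff)
      have "mps_eval (F i) Y = const_ser (1 / \<nu> i) * (left ?s * (right ?s oo shift)) + (1 - const_ser (1 / \<nu> i))"
        unfolding F by (simp only: eval_simps const_ser_diff eval_Y_f_quot_prod)
      also have "\<dots> = left (M i) + left (e i) * (right (M i - 1) oo shift)"
      proof -
        have "left (M i) = const_ser (1 / \<nu> i) * left ?s + (1 - const_ser (1 / \<nu> i))"
          unfolding M by (simp only: left_simps const_ser_simps)
        moreover have "right (M i - 1) oo shift =
            const_ser (1 / \<nu> i) * (right ?s oo shift) + (1 - const_ser (1 / \<nu> i)) - 1"
          unfolding M by (simp only: right_simps compose_simps const_ser_simps fps_compose_1)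
        \<comment> \<open>For F = t g + (1 - t) with g multiplicative, subtracting the left part of
          F(Y) leaves g(X) times the shifted F(X) - 1. Hence the left factor is g and not F.\<close>
        moreover have "t * (x * y) + (1 - t) = t * x + (1 - t) + x * (t * y + (1 - t) - 1)"
          for t x y :: "('i, 'k) ckh2 fps"
          by (simp add: algebra_simps)
        ultimately show ?thesis by (simp only: E)
      qed
      finally show ?thesis using g0 by (simp add: M E scalar.one)
    next
      case 3
      let ?s = "mps_eval (log_ser_sum P \<beta>' (a i)) X"
      have F: "F i = log_ser_sum P \<beta>' (a i) + 1"
        unfolding sum_eq F_I1_0[OF 3(1,3)] ..
      \<comment> \<open>Logarithms are additive, so the right part comes with left factor 1.\<close>
      have E: "E i = 1" using 3 by (simp add: E_def f_quot_prod_0)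
      have M: "M i = ?s + 1"
        unfolding F by (simp only: eval_simps)
      have "mps_eval (F i) Y = left (M i) + left (e i) * (right (M i - 1) oo shift)"
        unfolding M E unfolding F
        by (simp add: eval_simps eval_Y_log_ser_sum left_simps)
      moreover have "M i $ 0 = 1"
        unfolding M by (simp add: mps_eval_log_ser_sum[OF SDSE_fps_nth_0] fps_sum_nth eval_fps_at_nth_0)
      ultimately show ?thesis by (simp add: E mps_eval_1)
    next
      case 4
      let ?g = "?g (\<lambda>j. b i j - \<gamma> j)" and ?r = "\<lambda>j. right (X j) oo shift"
      have F: "F i = mps_const (1 / \<nu> i) * f_quot_prod P \<beta>' (\<lambda>j. b i j - \<gamma> j)
          + (\<Sum>j\<in>I1sub i. mps_const (a i j) * mps_var j) + mps_const (1 - 1 / \<nu> i)"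
      proof -
        have "f_quot_prod P \<beta>' (\<lambda>j. b i j - \<gamma> j) =
            (\<Prod>j\<in>I0. mps_of_fps j (f_quot (\<beta> j) (b i j - 1 - \<beta> j)))
            * (\<Prod>j\<in>J0. mps_of_fps j (f_quot 1 (b i j - 1)))
            * (\<Prod>j\<in>K0. mps_of_fps j (f_quot 0 (b i j)))"
          unfolding prod_eq by (simp add: mem diff_diff_eq)
        then show ?thesis unfolding F_J1[OF 4(1)] by (simp only: mult.assoc)
      qed
      have E: "E i = f_quot_prod P \<beta>' (\<lambda>j. b i j - \<gamma> j)" using 4 by (simp add: E_def)
      \<comment> \<open>Since \<open>\<nu> j = 1\<close>, the series \<open>F j\<close> is a pure
        product with parameters \<gamma> + (b - \<gamma>), that is, Q times the multiplicative part
        of \<open>F i\<close>. So \<open>Y_multiplicative\<close> applies with the same left factor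
        for every such \<open>j\<close>.\<close>
      have Y_sub: "Y j = left (X j) + left ?g * ?r j" if j: "j \<in> I1sub i" for j
      proof (rule Y_multiplicative)
        have j': "j \<in> I1" "j \<notin> P" using j part_disjoint by (auto simp: I1sub[OF 4(1)] P_def)
        have \<nu>: "\<nu> j = 1" by (rule J1_nu_1[OF 4(1) j])
        have "F j = f_quot_prod P \<beta>' (\<lambda>t. \<nu> j * a j t)"
        proof -
          have "mps_const 1 = (1 :: ('i, 'k) mps)" "mps_const 0 = (0 :: ('i, 'k) mps)"
            by (simp_all add: one_mps_def mps_const_def zero_mps_def)
          then show ?thesis
            unfolding prod_eq using F_I1[OF j'(1)] \<nu> by simp
        qed
        also have "\<dots> = f_quot_prod P \<beta>' (\<lambda>t. \<gamma> t + (b i t - \<gamma> t))"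
          by (rule f_quot_prod_cong) (simp add: \<nu> b[OF 4(1) j] P_def)
        finally have F_j: "F j = f_quot_prod P \<beta>' (\<lambda>t. \<gamma> t + (b i t - \<gamma> t))" .
        show "M j = q * ?g"
          unfolding F_j by (rule mps_eval_f_quot_prod_add[OF SDSE_fps_nth_0])
        show "E j = F j"
          using j' \<open>F j = f_quot_prod P \<beta>' (\<lambda>t. \<nu> j * a j t)\<close> by (simp add: E_def)
      qed
      have M: "M i = const_ser (1 / \<nu> i) * ?g + (\<Sum>j\<in>I1sub i. const_ser (a i j) * X j) + (1 - const_ser (1 / \<nu> i))"
        unfolding F by (simp only: eval_simps const_ser_diff)
      have "mps_eval (F i) Y = const_ser (1 / \<nu> i) * (left ?g * (right ?g oo shift))
          + (\<Sum>j\<in>I1sub i. const_ser (a i j) * Y j) + (1 - const_ser (1 / \<nu> i))"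
        unfolding F by (simp only: eval_simps const_ser_diff eval_Y_f_quot_prod)
      \<comment> \<open>The linear terms carry the same left factor \<open>?g\<close> as the product
        term, so \<open>e i = ?g\<close> serves both.\<close>
      also have "(\<Sum>j\<in>I1sub i. const_ser (a i j) * Y j) =
          (\<Sum>j\<in>I1sub i. const_ser (a i j) * left (X j)) + left ?g * (\<Sum>j\<in>I1sub i. const_ser (a i j) * ?r j)"
        unfolding sum_distrib_left sum.distrib[symmetric]
        by (rule sum.cong) (simp_all add: Y_sub distrib_left mult_ac)
      also have "const_ser (1 / \<nu> i) * (left ?g * (right ?g oo shift)) +
          ((\<Sum>j\<in>I1sub i. const_ser (a i j) * left (X j)) + left ?g * (\<Sum>j\<in>I1sub i. const_ser (a i j) * ?r j))
          + (1 - const_ser (1 / \<nu> i)) = left (M i) + left (e i) * (right (M i - 1) oo shift)"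
      proof -
        have "left (M i) = const_ser (1 / \<nu> i) * left ?g
            + (\<Sum>j\<in>I1sub i. const_ser (a i j) * left (X j)) + (1 - const_ser (1 / \<nu> i))"
          unfolding M by (simp only: left_simps const_ser_simps)
        moreover have "right (M i - 1) oo shift = const_ser (1 / \<nu> i) * (right ?g oo shift)
            + (\<Sum>j\<in>I1sub i. const_ser (a i j) * ?r j) + (1 - const_ser (1 / \<nu> i)) - 1"
          unfolding M by (simp only: right_simps compose_simps const_ser_simps fps_compose_1)
        moreover have "t * (x * y) + (u + x * v) + (1 - t) =
            t * x + u + (1 - t) + x * (t * y + v + (1 - t) - 1)"
          for t u v x y :: "('i, 'k) ckh2 fps"
          by (simp add: algebra_simps)
        ultimately show ?thesis by (simp only: E)
      qed
      finally show ?thesis using g0 by (simp add: M E scalar.one fps_sum_nth SDSE_fps_nth_0)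
    qed
  qed
  then show ?thesis
    by (intro is_hopf) (simp_all add: g0)
qed

end
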